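(* Let $K$ be an algebraically closed field of characteristic zero, $G$ a finite abelian group, and let $(M_n(K),\Gamma)$ be the matrix algebra endowed with a $G$-grading $\Gamma$. Then $(M_n(K),\Gamma)$ is isomorphic, as a graded algebra, to a tensor product $(K^{\alpha}Q\otimes M_r(K),\Gamma')$, where $r\ge 1$, $Q$ is a subgroup of $G$, $\alpha$ is a $2$-cocycle on $Q$ with values in $K^*$, $K^{\alpha}Q$ is the corresponding twisted group algebra, $M_r(K)$ carries the elementary grading induced by a tuple $(g_1,\dots,g_r)\in G^r$, and $\Gamma'$ is the grading described in the context. Moreover, for such data: (i) Suppose the bicharacter induced by $\alpha$ is non-trivial. If $(M_n(K),\Gamma)$ satisfies the primeness property for graded central polynomials, then $\Gamma$ is an elementary grading. (ii) Suppose the bicharacter induced by $\alpha$ is trivial. Then $(M_n(K),\Gamma)$ satisfies the primeness property for graded central polynomials if and only if $M_r(K)$, endowed with its elementary grading induced by $(g_1,\dots,g_r)$, satisfies it.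
   Context: Groups are written additively. For $\vec g=(g_1,\dots,g_r)\in G^r$, the elementary grading on $M_r(K)$ induced by $\vec g$ has homogeneous components $\operatorname{span}_K\{e_{i,j}\mid g_j-g_i=g\}$, $g\in G$, where $e_{i,j}$ are the matrix units. The twisted group algebra $K^\alpha Q$ has $K$-basis $\{X_q\mid q\in Q\}$ and multiplication $X_qX_{q'}=\alpha(q,q')X_{q+q'}$. The bicharacter induced by $\alpha$ is $\beta_\alpha(q,q')=\alpha(q,q')\alpha(q',q)^{-1}$; it is trivial if it is identically $1$. The grading $\Gamma'$ on $K^\alpha Q\otimes M_r(K)$ is given by $$(K^\alpha Q\otimes M_r(K))_g=\operatorname{span}_K\{X_h\otimes e_{i,j}\mid h\in Q,\ g=-g_j+h+g_i\},\quad g\in G.$$ $K\langle X_G\rangle$ is the free unitary associative $G$-graded algebra on countably infinite disjoint sets $X_g$ ($g\in G$) of variables of degree $g$, written $x_i^{(g)}$. Let $A=\bigoplus_{g\in G}A_g$ be a $G$-graded algebra. A polynomial $f(x_1^{(g_1)},\dots,x_n^{(g_n)})\in K\langle X_G\rangle$ is a graded identity of $A$ if it vanishes under all substitutions $x_i^{(g_i)}\mapsto a_i\in A_{g_i}$; it is a graded central polynomial if all these values lie in the centre $Z(A)$; it is a proper graded central polynomial if moreover it is not a graded identity. $A$ satisfies the primeness property for graded central polynomials if, whenever $f,g\in K\langle X_G\rangle$ are polynomials in disjoint sets of variables such that $fg$ is a proper graded central polynomial, both $f$ and $g$ are proper graded central polynomials. *)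

theory Defs
  imports
    "HOL-Computational_Algebra.Polynomial"
    "HOL-Algebra.QuotRing"
    "HOL-Library.Poly_Mapping"
    "Jordan_Normal_Form.VS_Connect"
begin

text \<open>
  The ground field is a type \<open>'k\<close> and the grading group a type \<open>'g\<close>.  A unital \<open>'k\<close>-algebra is
  a record of type \<open>('k, 'a) module\<close>, which extends the record \<open>ring\<close> by scalar multiplication.
  A family of homogeneous components is a function \<open>'g \<Rightarrow> 'a set\<close>.
\<close>

definition kspan :: "('k::field, 'a) module \<Rightarrow> 'a set \<Rightarrow> 'a set" where
  "kspan A S = LinearCombinations.module.span class_ring A S"

definition algebra_grading ::
    "('k::field, 'a) module \<Rightarrow> ('g::{ab_group_add,finite} \<Rightarrow> 'a set) \<Rightarrow> bool" where
  "algebra_grading A \<Gamma> \<longleftrightarrow>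
     (\<forall>g. VectorSpace.subspace class_ring (\<Gamma> g) A) \<and>
     (\<forall>a\<in>carrier A. \<exists>!c. (\<forall>g. c g \<in> \<Gamma> g) \<and> a = (\<Oplus>\<^bsub>A\<^esub>g\<in>UNIV. c g)) \<and>
     (\<forall>g h. \<forall>a\<in>\<Gamma> g. \<forall>b\<in>\<Gamma> h. a \<otimes>\<^bsub>A\<^esub> b \<in> \<Gamma> (g + h))"

definition graded_isomorphic ::
    "('k::field, 'a) module \<Rightarrow> ('g \<Rightarrow> 'a set) \<Rightarrow> ('k, 'b) module \<Rightarrow> ('g \<Rightarrow> 'b set) \<Rightarrow> bool" where
  "graded_isomorphic A \<Gamma> B \<Delta> \<longleftrightarrow>
     (\<exists>\<phi>\<in>ring_iso A B.
        (\<forall>c. \<forall>x\<in>carrier A. \<phi> (c \<odot>\<^bsub>A\<^esub> x) = c \<odot>\<^bsub>B\<^esub> \<phi> x) \<and> (\<forall>g. \<phi> ` \<Gamma> g = \<Delta> g))"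

abbreviation mat_alg :: "nat \<Rightarrow> ('k::field, 'k mat) module" where
  "mat_alg n \<equiv> module_mat TYPE('k) n n"

text \<open>Matrix units, with rows and columns indexed from 0.\<close>

definition mat_unit :: "nat \<Rightarrow> nat \<Rightarrow> nat \<Rightarrow> 'k::field mat" where
  "mat_unit r i j = mat r r (\<lambda>(a, b). if a = i \<and> b = j then 1 else 0)"

definition elementary_grading :: "'g::ab_group_add list \<Rightarrow> 'g \<Rightarrow> 'k::field mat set" where
  "elementary_grading gs g =
     (let r = length gs in
      kspan (mat_alg r) {mat_unit r i j | i j. i < r \<and> j < r \<and> gs ! j - gs ! i = g})"

text \<open>
  A grading of \<open>M\<^sub>n(K)\<close> is elementary if it is the elementary grading induced by some \<open>n\<close>-tuple
  with respect to a suitable system of matrix units, that is, up to a graded isomorphism.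
\<close>

definition is_elementary ::
    "nat \<Rightarrow> ('g::{ab_group_add,finite} \<Rightarrow> 'k::field mat set) \<Rightarrow> bool" where
  "is_elementary n \<Gamma> \<longleftrightarrow>
     (\<exists>gs. length gs = n \<and> graded_isomorphic (mat_alg n) \<Gamma> (mat_alg n) (elementary_grading gs))"

definition add_subgroup :: "'g::ab_group_add set \<Rightarrow> bool" where
  "add_subgroup Q \<longleftrightarrow> 0 \<in> Q \<and> (\<forall>p\<in>Q. \<forall>q\<in>Q. p + q \<in> Q) \<and> (\<forall>q\<in>Q. - q \<in> Q)"

definition two_cocycle :: "'g::ab_group_add set \<Rightarrow> ('g \<Rightarrow> 'g \<Rightarrow> 'k::field) \<Rightarrow> bool" where
  "two_cocycle Q \<alpha> \<longleftrightarrow>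
     (\<forall>p\<in>Q. \<forall>q\<in>Q. \<alpha> p q \<noteq> 0) \<and>
     (\<forall>p\<in>Q. \<forall>q\<in>Q. \<forall>s\<in>Q. \<alpha> p q * \<alpha> (p + q) s = \<alpha> q s * \<alpha> p (q + s))"

definition bichar :: "('g \<Rightarrow> 'g \<Rightarrow> 'k::field) \<Rightarrow> 'g \<Rightarrow> 'g \<Rightarrow> 'k" where
  "bichar \<alpha> p q = \<alpha> p q * inverse (\<alpha> q p)"

definition trivial_bichar :: "'g set \<Rightarrow> ('g \<Rightarrow> 'g \<Rightarrow> 'k::field) \<Rightarrow> bool" where
  "trivial_bichar Q \<alpha> \<longleftrightarrow> (\<forall>p\<in>Q. \<forall>q\<in>Q. bichar \<alpha> p q = 1)"

definition basis_fun :: "'q \<Rightarrow> 'q \<Rightarrow> 'k::field" where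
  "basis_fun q = (\<lambda>s. if s = q then 1 else 0)"

text \<open>
  An element \<open>\<Sum>\<^sub>q u\<^sub>q X\<^sub>q\<close> is its coefficient function \<open>u\<close>, which vanishes outside \<open>Q\<close>; thus \<open>X\<^sub>q\<close> is
  \<^term>\<open>basis_fun q\<close>.  Cocycles are not assumed to be normalised, so the unit is
  \<open>\<alpha>(0,0)\<^sup>-\<^sup>1 X\<^sub>0\<close>.
\<close>

definition twisted_group_alg ::
    "'g::{ab_group_add,finite} set \<Rightarrow> ('g \<Rightarrow> 'g \<Rightarrow> 'k::field) \<Rightarrow> ('k, 'g \<Rightarrow> 'k) module" where
  "twisted_group_alg Q \<alpha> =
     \<lparr> carrier = {u. \<forall>q. q \<notin> Q \<longrightarrow> u q = 0},
       mult = (\<lambda>u v s. \<Sum>p\<in>Q. \<Sum>q\<in>Q. if p + q = s then u p * v q * \<alpha> p q else 0),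
       one = (\<lambda>s. inverse (\<alpha> 0 0) * basis_fun 0 s),
       zero = (\<lambda>s. 0),
       add = (\<lambda>u v s. u s + v s),
       smult = (\<lambda>c u s. c * u s) \<rparr>"

text \<open>
  Let \<open>A\<close> be an algebra whose elements are the functions on a finite set \<open>Q\<close> (extended by 0), with
  pointwise linear structure, and let \<open>B\<close> be any algebra.  Since \<open>A\<close> has basis
  \<^term>\<open>basis_fun q\<close>, \<open>q \<in> Q\<close>, every element of \<open>A \<otimes> B\<close> is uniquely of the form
  \<open>\<Sum>\<^sub>q basis_fun q \<otimes> F q\<close> with \<open>F q \<in> B\<close>, and it is represented by the function \<open>F\<close>.
  The multiplication is the bilinear extension of \<open>(a \<otimes> b)(a' \<otimes> b') = aa' \<otimes> bb'\<close> from
  basis elements \<open>a\<close>, \<open>a'\<close> of \<open>A\<close>.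
\<close>

definition pure_tensor :: "('k::field, 'b) module \<Rightarrow> ('q \<Rightarrow> 'k) \<Rightarrow> 'b \<Rightarrow> 'q \<Rightarrow> 'b" where
  "pure_tensor B u b = (\<lambda>s. u s \<odot>\<^bsub>B\<^esub> b)"

definition tensor_alg ::
    "'q set \<Rightarrow> ('k::field, 'q \<Rightarrow> 'k) module \<Rightarrow> ('k, 'b) module \<Rightarrow> ('k, 'q \<Rightarrow> 'b) module" where
  "tensor_alg Q A B =
     \<lparr> carrier = {F. (\<forall>q\<in>Q. F q \<in> carrier B) \<and> (\<forall>q. q \<notin> Q \<longrightarrow> F q = \<zero>\<^bsub>B\<^esub>)},
       mult = (\<lambda>F H s. \<Oplus>\<^bsub>B\<^esub>p\<in>Q. \<Oplus>\<^bsub>B\<^esub>q\<in>Q.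
                 (basis_fun p \<otimes>\<^bsub>A\<^esub> basis_fun q) s \<odot>\<^bsub>B\<^esub> (F p \<otimes>\<^bsub>B\<^esub> H q)),
       one = pure_tensor B \<one>\<^bsub>A\<^esub> \<one>\<^bsub>B\<^esub>,
       zero = (\<lambda>s. \<zero>\<^bsub>B\<^esub>),
       add = (\<lambda>F H s. F s \<oplus>\<^bsub>B\<^esub> H s),
       smult = (\<lambda>c F s. c \<odot>\<^bsub>B\<^esub> F s) \<rparr>"

abbreviation twisted_mat_alg ::
    "'g::{ab_group_add,finite} set \<Rightarrow> ('g \<Rightarrow> 'g \<Rightarrow> 'k::field) \<Rightarrow> nat \<Rightarrow> ('k, 'g \<Rightarrow> 'k mat) module"
  where
  "twisted_mat_alg Q \<alpha> r \<equiv> tensor_alg Q (twisted_group_alg Q \<alpha>) (mat_alg r)"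

definition twisted_mat_grading ::
    "'g::{ab_group_add,finite} set \<Rightarrow> ('g \<Rightarrow> 'g \<Rightarrow> 'k::field) \<Rightarrow> 'g list \<Rightarrow>
     'g \<Rightarrow> ('g \<Rightarrow> 'k mat) set" where
  "twisted_mat_grading Q \<alpha> gs g =
     (let r = length gs in
      kspan (twisted_mat_alg Q \<alpha> r)
        {pure_tensor (mat_alg r) (basis_fun h) (mat_unit r i j) | h i j.
           h \<in> Q \<and> i < r \<and> j < r \<and> g = - (gs ! j) + h + gs ! i})"

definition is_decomposition ::
    "nat \<Rightarrow> ('g::{ab_group_add,finite} \<Rightarrow> 'k::field mat set) \<Rightarrow>
     nat \<Rightarrow> 'g set \<Rightarrow> ('g \<Rightarrow> 'g \<Rightarrow> 'k) \<Rightarrow> 'g list \<Rightarrow> bool" where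
  "is_decomposition n \<Gamma> r Q \<alpha> gs \<longleftrightarrow>
     1 \<le> r \<and> add_subgroup Q \<and> two_cocycle Q \<alpha> \<and> length gs = r \<and>
     graded_isomorphic (mat_alg n) \<Gamma> (twisted_mat_alg Q \<alpha> r) (twisted_mat_grading Q \<alpha> gs)"

text \<open>
  \<open>K\<langle>X\<rangle>\<close> is the monoid algebra of the free monoid on \<open>X\<close>.  Convolution of finitely supported
  functions is provided for additively written monoids, whence the wrapper around lists, on which
  \<open>+\<close> is concatenation.
\<close>

datatype 'x fmon = FMon (letters: "'x list")

instantiation fmon :: (type) monoid_add
begin

definition zero_fmon :: "'a fmon" where "0 = FMon []"

definition plus_fmon :: "'a fmon \<Rightarrow> 'a fmon \<Rightarrow> 'a fmon" where
  "v + w = FMon (letters v @ letters w)"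

instance
  by standard (simp_all add: zero_fmon_def plus_fmon_def)

end

text \<open>The variable \<open>x\<^sub>i\<^sup>(\<^sup>g\<^sup>)\<close> is the pair \<open>(g, i)\<close>.\<close>

type_synonym ('g, 'k) gr_poly = "('g \<times> nat) fmon \<Rightarrow>\<^sub>0 'k"

definition poly_vars :: "('g, 'k::zero) gr_poly \<Rightarrow> ('g \<times> nat) set" where
  "poly_vars f = (\<Union>w\<in>Poly_Mapping.keys f. set (letters w))"

definition eval_fmon :: "('k, 'a) module \<Rightarrow> ('x \<Rightarrow> 'a) \<Rightarrow> 'x fmon \<Rightarrow> 'a" where
  "eval_fmon A \<sigma> w = foldr (\<lambda>x a. \<sigma> x \<otimes>\<^bsub>A\<^esub> a) (letters w) \<one>\<^bsub>A\<^esub>"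

definition eval_poly :: "('k::zero, 'a) module \<Rightarrow> ('g \<times> nat \<Rightarrow> 'a) \<Rightarrow> ('g, 'k) gr_poly \<Rightarrow> 'a" where
  "eval_poly A \<sigma> f = (\<Oplus>\<^bsub>A\<^esub>w\<in>Poly_Mapping.keys f. Poly_Mapping.lookup f w \<odot>\<^bsub>A\<^esub> eval_fmon A \<sigma> w)"

definition graded_subst :: "('g \<Rightarrow> 'a set) \<Rightarrow> ('g \<times> nat \<Rightarrow> 'a) \<Rightarrow> bool" where
  "graded_subst \<Gamma> \<sigma> \<longleftrightarrow> (\<forall>g i. \<sigma> (g, i) \<in> \<Gamma> g)"

definition alg_center :: "('k, 'a) module \<Rightarrow> 'a set" where
  "alg_center A = {z \<in> carrier A. \<forall>a\<in>carrier A. z \<otimes>\<^bsub>A\<^esub> a = a \<otimes>\<^bsub>A\<^esub> z}"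

definition graded_identity ::
    "('k::zero, 'a) module \<Rightarrow> ('g \<Rightarrow> 'a set) \<Rightarrow> ('g, 'k) gr_poly \<Rightarrow> bool" where
  "graded_identity A \<Gamma> f \<longleftrightarrow> (\<forall>\<sigma>. graded_subst \<Gamma> \<sigma> \<longrightarrow> eval_poly A \<sigma> f = \<zero>\<^bsub>A\<^esub>)"

definition graded_central ::
    "('k::zero, 'a) module \<Rightarrow> ('g \<Rightarrow> 'a set) \<Rightarrow> ('g, 'k) gr_poly \<Rightarrow> bool" where
  "graded_central A \<Gamma> f \<longleftrightarrow> (\<forall>\<sigma>. graded_subst \<Gamma> \<sigma> \<longrightarrow> eval_poly A \<sigma> f \<in> alg_center A)"

definition proper_graded_central ::
    "('k::zero, 'a) module \<Rightarrow> ('g \<Rightarrow> 'a set) \<Rightarrow> ('g, 'k) gr_poly \<Rightarrow> bool" where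
  "proper_graded_central A \<Gamma> f \<longleftrightarrow> graded_central A \<Gamma> f \<and> \<not> graded_identity A \<Gamma> f"

definition primeness_property ::
    "('k::field, 'a) module \<Rightarrow> ('g \<Rightarrow> 'a set) \<Rightarrow> bool" where
  "primeness_property A \<Gamma> \<longleftrightarrow>
     (\<forall>f g :: ('g, 'k) gr_poly.
        poly_vars f \<inter> poly_vars g = {} \<longrightarrow> proper_graded_central A \<Gamma> (f * g) \<longrightarrow>
        proper_graded_central A \<Gamma> f \<and> proper_graded_central A \<Gamma> g)"

lemma basis_fun_mult:
  assumes "p \<in> Q" "q \<in> Q"
  shows "basis_fun p \<otimes>\<^bsub>twisted_group_alg Q \<alpha>\<^esub> basis_fun q = (\<lambda>s. \<alpha> p q * basis_fun (p + q) s)"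
proof
  fix s
  have "(\<Sum>p'\<in>Q. \<Sum>q'\<in>Q. if p' + q' = s then basis_fun p p' * basis_fun q q' * \<alpha> p' q' else 0)
      = (\<Sum>p'\<in>Q. if p' = p then (\<Sum>q'\<in>Q. if q' = q then (if p + q = s then \<alpha> p q else 0) else 0)
                  else 0)"
    by (intro sum.cong refl) (auto simp: basis_fun_def intro!: sum.neutral sum.cong)
  also have "\<dots> = \<alpha> p q * basis_fun (p + q) s"
    using assms by (simp add: basis_fun_def)
  finally show "(basis_fun p \<otimes>\<^bsub>twisted_group_alg Q \<alpha>\<^esub> basis_fun q) s = \<alpha> p q * basis_fun (p + q) s"
    by (simp add: twisted_group_alg_def)
qed

lemma pure_tensor_mult:
  fixes a b :: "'k::field mat"
  assumes u: "u \<in> carrier (twisted_group_alg Q \<alpha>)" and v: "v \<in> carrier (twisted_group_alg Q \<alpha>)"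
    and a: "a \<in> carrier_mat r r" and b: "b \<in> carrier_mat r r"
  shows "pure_tensor (mat_alg r) u a \<otimes>\<^bsub>twisted_mat_alg Q \<alpha> r\<^esub> pure_tensor (mat_alg r) v b
       = pure_tensor (mat_alg r) (u \<otimes>\<^bsub>twisted_group_alg Q \<alpha>\<^esub> v) (a * b)"
proof
  fix s
  interpret M: abelian_group "mat_alg r :: ('k, 'k mat) module"
    by (rule abelian_group_mat)
  have ab: "a * b \<in> carrier_mat r r"
    using a b by auto
  have zero_smult: "0 \<cdot>\<^sub>m (a * b) = 0\<^sub>m r r"
    using a b by (intro eq_matI) auto
  have smult_smult: "c \<cdot>\<^sub>m (d \<cdot>\<^sub>m X) = (c * d) \<cdot>\<^sub>m X" for c d :: 'k and X
    by (intro eq_matI) (auto simp: mult.assoc)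
  have finsum_smult: "(\<Oplus>\<^bsub>mat_alg r\<^esub>q\<in>S. c q \<cdot>\<^sub>m (a * b)) = (\<Sum>q\<in>S. c q) \<cdot>\<^sub>m (a * b)"
    for S and c :: "_ \<Rightarrow> 'k"
  proof (induction S rule: infinite_finite_induct)
    case (insert q S)
    then show ?case
      using ab by (subst M.finsum_insert)
        (auto simp: module_mat_simps add_smult_distrib_right_mat[OF ab])
  next
    case (infinite S)
    then show ?case
      by (simp add: M.finsum_infinite module_mat_simps zero_smult)
  next
    case empty
    show ?case
      by (simp add: module_mat_simps zero_smult)
  qed
  have "(basis_fun p \<otimes>\<^bsub>twisted_group_alg Q \<alpha>\<^esub> basis_fun q) s \<cdot>\<^sub>m ((u p \<cdot>\<^sub>m a) * (v q \<cdot>\<^sub>m b))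
      = (if p + q = s then u p * v q * \<alpha> p q else 0) \<cdot>\<^sub>m (a * b)" if "p \<in> Q" "q \<in> Q" for p q
  proof -
    have "(u p \<cdot>\<^sub>m a) * (v q \<cdot>\<^sub>m b) = (u p * v q) \<cdot>\<^sub>m (a * b)"
      using a b
      by (simp add: mult_smult_assoc_mat[of _ r r _ r] mult_smult_distrib[of _ r r _ r]
          smult_smult mult.commute)
    moreover have "(basis_fun p \<otimes>\<^bsub>twisted_group_alg Q \<alpha>\<^esub> basis_fun q) s
        = (if p + q = s then \<alpha> p q else 0)"
      unfolding basis_fun_mult[OF that] by (auto simp: basis_fun_def)
    ultimately show ?thesis
      by (simp add: smult_smult mult_ac)
  qed
  then have "(\<Oplus>\<^bsub>mat_alg r\<^esub>p\<in>Q. \<Oplus>\<^bsub>mat_alg r\<^esub>q\<in>Q.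
        (basis_fun p \<otimes>\<^bsub>twisted_group_alg Q \<alpha>\<^esub> basis_fun q) s \<cdot>\<^sub>m ((u p \<cdot>\<^sub>m a) * (v q \<cdot>\<^sub>m b)))
      = (\<Oplus>\<^bsub>mat_alg r\<^esub>p\<in>Q. \<Oplus>\<^bsub>mat_alg r\<^esub>q\<in>Q.
        (if p + q = s then u p * v q * \<alpha> p q else 0) \<cdot>\<^sub>m (a * b))"
    using ab by (intro M.finsum_cong' refl) (auto simp: module_mat_simps finsum_smult simp del: if_distrib)
  also have "\<dots> = (\<Sum>p\<in>Q. \<Sum>q\<in>Q. if p + q = s then u p * v q * \<alpha> p q else 0) \<cdot>\<^sub>m (a * b)"
    by (simp only: finsum_smult)
  finally show "(pure_tensor (mat_alg r) u a \<otimes>\<^bsub>twisted_mat_alg Q \<alpha> r\<^esub> pure_tensor (mat_alg r) v b) s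
      = pure_tensor (mat_alg r) (u \<otimes>\<^bsub>twisted_group_alg Q \<alpha>\<^esub> v) (a * b) s"
    by (simp add: tensor_alg_def pure_tensor_def module_mat_simps)
       (simp add: twisted_group_alg_def)
qed

end

theory Submission
  imports Defs "Jordan_Normal_Form.Matrix_Kernel"
begin

text \<open>
  Write A for the graded algebra M_n(K) and A_g for its homogeneous components.

  Decomposition.  Among the nonzero homogeneous elements choose one with a maximal kernel.  Every
  nonzero homogeneous left multiple of it has the same kernel, so a suitable product has nonzero
  powers, one of which has degree 0; it has a nonzero eigenvalue, and maximality of the kernel forces
  it to be a multiple of an idempotent e of degree 0
  (\<open>exists_kernel_maximal_idempotent\<close>).  Maximality also makes every nonzero homogeneous element of
  e A e invertible there, and its neutral component is K e because K is algebraically closed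
  (\<open>D_neutral\<close>, \<open>D_inverse\<close>).  Hence e A e has a basis of one homogeneous element X_q for each q in a
  subgroup Q, which makes it a twisted group algebra.  As A is prime, the unit is a sum of products
  v_i w_i of homogeneous elements of opposite degrees with w_i v_j = \<delta>_ij e
  (\<open>exists_complete_system\<close>), and X_q \<otimes> e_ij corresponds to v_i X_q w_j.

  Nontrivial bicharacter.  Then the primeness property fails.  Choose s in Q for which the character
  \<beta>(s, _) of Q is not identically 1 and extend it to a character \<chi> of G (\<open>extend_character\<close>).  The
  element u = X_s \<otimes> diag(\<chi>(g_1), ..., \<chi>(g_r)) is invertible and not central, and
  u a u^-1 = \<chi>(g) a for a in A_g.  Razmyslov's construction gives graded polynomials whose values lie
  on the line K u and do not all vanish.  It starts from the alternating function
   \<Delta>(x) = \<Sum>_\<sigma> sgn(\<sigma>) tr(x_\<sigma>(0) y_0 x_\<sigma>(1) y_1 ...)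
  of n^2 matrices, which is a linear combination of determinants in the coordinates of the x_i;
  therefore replacing x_i by P x_i R and summing over i multiplies it by the trace of the operator
  x \<mapsto> P x R, that is by tr(P) tr(R) (\<open>alt_trace_derivation\<close>).  For P = z u and R = u^-1 w this operator
  sends a homogeneous x_i to \<chi>(deg x_i) z x_i w, so the sum is the trace of z times a graded polynomial
  f, and tr(z f) = tr(z u) tr(u^-1 w) \<Delta>(x) for all z says that f is a multiple of u
  (\<open>eval_twisted_trace_poly\<close>).  The same construction for u^-1 in new variables gives f'.  All
  values of f f' are scalar and some are nonzero, but f is not central (\<open>not_primeness\<close>).

  Trivial bicharacter.  Then the elements X_q \<otimes> 1 are central.  The centre of A is K, so Q is trivial
  (\<open>trivial_support\<close>), and A is M_r(K) with e_ij in degree g_i - g_j.  This is the negative of the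
  degree in the elementary grading, and renaming each variable of degree g to one of degree -g
  carries the primeness property from one grading to the other (\<open>primeness_neg_degree\<close>).
\<close>


section \<open>Sums of matrices and matrix units\<close>

declare index_mult_mat(1) [simp del]

text \<open>
  There is no common zero for matrices of all dimensions; an entrywise sum of square matrices keeps
  all calculations in the ground field.
\<close>

definition msum :: "nat \<Rightarrow> ('b \<Rightarrow> 'k::field mat) \<Rightarrow> 'b set \<Rightarrow> 'k mat" where
  "msum n f S = mat n n (\<lambda>(i, j). \<Sum>s\<in>S. f s $$ (i, j))"

lemma msum_carrier [simp, intro]: "msum n f S \<in> carrier_mat n n"
  by (simp add: msum_def)

lemma msum_index [simp]: "i < n \<Longrightarrow> j < n \<Longrightarrow> msum n f S $$ (i, j) = (\<Sum>s\<in>S. f s $$ (i, j))"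
  by (simp add: msum_def)

lemma msum_dim [simp]: "dim_row (msum n f S) = n" "dim_col (msum n f S) = n"
  by (simp_all add: msum_def)

lemma mat_eqI:
  "A \<in> carrier_mat n m \<Longrightarrow> B \<in> carrier_mat n m \<Longrightarrow>
    (\<And>i j. i < n \<Longrightarrow> j < m \<Longrightarrow> A $$ (i, j) = B $$ (i, j)) \<Longrightarrow> A = B"
  by (intro eq_matI) auto

lemma mat_mult_index:
  assumes "A \<in> carrier_mat n m" "B \<in> carrier_mat m l" "i < n" "j < l"
  shows "(A * B) $$ (i, j) = (\<Sum>k<m. A $$ (i, k) * B $$ (k, j))"
  using assms by (auto simp: index_mult_mat(1) scalar_prod_def atLeast0LessThan intro!: sum.cong)

lemma msum_cong:
  "S = T \<Longrightarrow> (\<And>s. s \<in> T \<Longrightarrow> f s = h s) \<Longrightarrow> msum n f S = msum n h T"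
  by (simp add: msum_def)

lemma mult_msum:
  assumes "A \<in> carrier_mat n n" "\<And>s. s \<in> S \<Longrightarrow> f s \<in> carrier_mat n n"
  shows "A * msum n f S = msum n (\<lambda>s. A * f s) S"
proof (rule eq_matI)
  fix i j assume "i < dim_row (msum n (\<lambda>s. A * f s) S)" "j < dim_col (msum n (\<lambda>s. A * f s) S)"
  then have ij: "i < n" "j < n" by (simp_all add: msum_def)
  have "(A * msum n f S) $$ (i, j) = (\<Sum>k<n. \<Sum>s\<in>S. A $$ (i, k) * f s $$ (k, j))"
    using assms(1) ij by (simp add: mat_mult_index[OF assms(1) msum_carrier] sum_distrib_left)
  also have "\<dots> = (\<Sum>s\<in>S. \<Sum>k<n. A $$ (i, k) * f s $$ (k, j))"
    by (rule sum.swap)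
  also have "\<dots> = (\<Sum>s\<in>S. (A * f s) $$ (i, j))"
    using mat_mult_index[OF assms(1) assms(2) ij] by (intro sum.cong refl) simp
  finally show "(A * msum n f S) $$ (i, j) = msum n (\<lambda>s. A * f s) S $$ (i, j)"
    using ij by simp
qed (use assms in \<open>auto simp: msum_def\<close>)

lemma msum_mult:
  assumes "A \<in> carrier_mat n n" "\<And>s. s \<in> S \<Longrightarrow> f s \<in> carrier_mat n n"
  shows "msum n f S * A = msum n (\<lambda>s. f s * A) S"
proof (rule eq_matI)
  fix i j assume "i < dim_row (msum n (\<lambda>s. f s * A) S)" "j < dim_col (msum n (\<lambda>s. f s * A) S)"
  then have ij: "i < n" "j < n" by (simp_all add: msum_def)
  have "(msum n f S * A) $$ (i, j) = (\<Sum>k<n. \<Sum>s\<in>S. f s $$ (i, k) * A $$ (k, j))"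
    using assms(1) ij by (simp add: mat_mult_index[OF msum_carrier assms(1)] sum_distrib_right)
  also have "\<dots> = (\<Sum>s\<in>S. \<Sum>k<n. f s $$ (i, k) * A $$ (k, j))"
    by (rule sum.swap)
  also have "\<dots> = (\<Sum>s\<in>S. (f s * A) $$ (i, j))"
    using mat_mult_index[OF assms(2) assms(1) ij] by (intro sum.cong refl) simp
  finally show "(msum n f S * A) $$ (i, j) = msum n (\<lambda>s. f s * A) S $$ (i, j)"
    using ij by simp
qed (use assms in \<open>auto simp: msum_def\<close>)

lemma finsum_mat_alg:
  assumes "finite S" "\<And>s. s \<in> S \<Longrightarrow> f s \<in> carrier_mat n n"
  shows "finsum (mat_alg n) f S = msum n (f :: 'b \<Rightarrow> 'k::field mat) S"
proof -
  interpret M: abelian_group "mat_alg n :: ('k, 'k mat) module"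
    by (rule abelian_group_mat)
  show ?thesis using assms
  proof (induction S)
    case empty
    show ?case by (auto simp: module_mat_simps intro!: eq_matI)
  next
    case (insert x S)
    then have fx: "f x \<in> carrier_mat n n" by simp
    show ?case
      using insert by (subst M.finsum_insert) (auto simp: module_mat_simps intro!: eq_matI)
  qed
qed

lemma smult_smult_mat: "c \<cdot>\<^sub>m (d \<cdot>\<^sub>m X) = (c * d) \<cdot>\<^sub>m (X :: 'k::field mat)"
  by (intro eq_matI) (auto simp: mult.assoc)

lemma smult_zero_iff_mat:
  "A \<in> carrier_mat n n \<Longrightarrow> c \<cdot>\<^sub>m A = 0\<^sub>m n n \<longleftrightarrow> c = 0 \<or> A = 0\<^sub>m n (n::nat)" for c :: "'k::field"
proof
  assume A: "A \<in> carrier_mat n n" and z: "c \<cdot>\<^sub>m A = 0\<^sub>m n n"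
  show "c = 0 \<or> A = 0\<^sub>m n n"
  proof (rule disjCI)
    assume "A \<noteq> 0\<^sub>m n n"
    then obtain i j where "i < n" "j < n" "A $$ (i, j) \<noteq> 0"
      using A by (metis (no_types, lifting) carrier_matD eq_matI index_zero_mat)
    then show "c = 0" using arg_cong[OF z, of "\<lambda>B. B $$ (i, j)"] A by auto
  qed
qed (auto intro!: eq_matI)

lemma mat_smult_left_cancel:
  assumes "A \<in> carrier_mat n n" "A \<noteq> 0\<^sub>m n n" "c \<cdot>\<^sub>m A = d \<cdot>\<^sub>m A"
  shows "c = (d :: 'k::field)"
proof -
  obtain i j where "i < n" "j < n" "A $$ (i, j) \<noteq> 0"
    using assms by (metis (no_types, lifting) carrier_matD eq_matI index_zero_mat)
  then show ?thesis using arg_cong[OF assms(3), of "\<lambda>B. B $$ (i, j)"] assms(1) by auto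
qed

lemma mat_unit_carrier [simp]: "mat_unit n i j \<in> carrier_mat n n"
  by (simp add: mat_unit_def)

lemma mat_unit_index:
  "a < n \<Longrightarrow> b < n \<Longrightarrow> mat_unit n i j $$ (a, b) = (if a = i \<and> b = j then 1 else 0)"
  by (simp add: mat_unit_def)

text \<open>
  If the entry (i, j) of A and the entry (k, l) of B do not vanish, then the matrix unit e_jk lies
  between them: the entry (i, l) of A e_jk B is their product.
\<close>

lemma matrix_algebra_prime:
  assumes A: "A \<in> carrier_mat n n" "A \<noteq> 0\<^sub>m n n" and B: "B \<in> carrier_mat n n" "B \<noteq> 0\<^sub>m n n"
  shows "\<exists>C\<in>carrier_mat n n. A * C * B \<noteq> (0\<^sub>m n n :: 'k::field mat)"
proof -
  obtain i j where ij: "i < n" "j < n" "A $$ (i, j) \<noteq> 0"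
    using A by (metis (no_types, lifting) carrier_matD eq_matI index_zero_mat)
  obtain k l where kl: "k < n" "l < n" "B $$ (k, l) \<noteq> 0"
    using B by (metis (no_types, lifting) carrier_matD eq_matI index_zero_mat)
  let ?C = "mat_unit n j k :: 'k mat"
  have AC: "A * ?C \<in> carrier_mat n n" using A by auto
  have "(A * ?C) $$ (i, x) = (if x = k then A $$ (i, j) else 0)" if "x < n" for x
  proof -
    have "(A * ?C) $$ (i, x) = (\<Sum>y<n. if y = j then (if x = k then A $$ (i, j) else 0) else 0)"
      unfolding mat_mult_index[OF A(1) mat_unit_carrier ij(1) that]
      using that by (intro sum.cong) (auto simp: mat_unit_index)
    then show ?thesis using ij by simp
  qed
  then have "(A * ?C * B) $$ (i, l) = (\<Sum>x<n. if x = k then A $$ (i, j) * B $$ (k, l) else 0)"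
    unfolding mat_mult_index[OF AC B(1) ij(1) kl(2)] by (intro sum.cong) auto
  also have "\<dots> = A $$ (i, j) * B $$ (k, l)" using kl by simp
  finally have "(A * ?C * B) $$ (i, l) \<noteq> 0" using ij kl by simp
  then show ?thesis using ij kl by (intro bexI[of _ ?C]) auto
qed

section \<open>Gradings of a matrix algebra\<close>

locale graded_matrix =
  fixes n :: nat and \<Gamma> :: "'g::{ab_group_add,finite} \<Rightarrow> 'k::field mat set"
  assumes n_pos: "0 < n" and gr: "algebra_grading (mat_alg n) \<Gamma>"
begin

lemma sub: "submodule class_ring (\<Gamma> g) (mat_alg n)"
  using gr by (simp add: algebra_grading_def VectorSpace.subspace_def)

lemma carrier: "a \<in> \<Gamma> g \<Longrightarrow> a \<in> carrier_mat n n"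
  using submodule.subset[OF sub] by (auto simp: module_mat_simps)

lemma add: "a \<in> \<Gamma> g \<Longrightarrow> b \<in> \<Gamma> g \<Longrightarrow> a + b \<in> \<Gamma> g"
  using submodule.m_closed[OF sub] by (auto simp: module_mat_simps)

lemma zero: "0\<^sub>m n n \<in> \<Gamma> g"
  using submodule.zero_closed[OF sub] by (auto simp: module_mat_simps)

lemma smult: "a \<in> \<Gamma> g \<Longrightarrow> c \<cdot>\<^sub>m a \<in> \<Gamma> g"
  using submodule.smult_closed[OF sub, of c] by (auto simp: module_mat_simps)

lemma diff: "a \<in> \<Gamma> g \<Longrightarrow> b \<in> \<Gamma> g \<Longrightarrow> a - b \<in> \<Gamma> g"
proof -
  assume a: "a \<in> \<Gamma> g" "b \<in> \<Gamma> g"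
  have "a - b = a + (-1) \<cdot>\<^sub>m b" using carrier a by (intro eq_matI) auto
  then show ?thesis using a add smult by auto
qed

lemma mult: "a \<in> \<Gamma> g \<Longrightarrow> b \<in> \<Gamma> h \<Longrightarrow> a * b \<in> \<Gamma> (g + h)"
  using gr by (auto simp: algebra_grading_def module_mat_simps)

lemma msum:
  assumes "finite S" "\<And>s. s \<in> S \<Longrightarrow> f s \<in> \<Gamma> g" shows "msum n f S \<in> \<Gamma> g"
  using assms
proof (induction S)
  case empty
  have "msum n f {} = 0\<^sub>m n n" by (auto intro!: eq_matI)
  then show ?case using zero by simp
next
  case (insert x S)
  then have fx: "f x \<in> carrier_mat n n" using carrier by auto
  have "msum n f (insert x S) = f x + msum n f S" using insert fx by (auto intro!: eq_matI)
  then show ?case using insert add by auto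
qed

text \<open>
  The homogeneous components of a single matrix; the choice is unique by \<open>component_unique\<close>.
\<close>

definition component :: "'k mat \<Rightarrow> 'g \<Rightarrow> 'k mat" where
  "component a = (SOME c. (\<forall>g. c g \<in> \<Gamma> g) \<and> a = msum n c UNIV)"

lemma finsum_Gamma: "(\<And>g. c g \<in> \<Gamma> g) \<Longrightarrow> (\<Oplus>\<^bsub>mat_alg n\<^esub>g\<in>UNIV. c g) = msum n c UNIV"
  by (rule finsum_mat_alg) (auto intro: carrier)

lemma component:
  assumes "a \<in> carrier_mat n n"
  shows "component a g \<in> \<Gamma> g" "a = msum n (component a) UNIV"
proof -
  have "\<exists>c. (\<forall>g. c g \<in> \<Gamma> g) \<and> a = msum n c UNIV"
    using gr assms finsum_Gamma unfolding algebra_grading_def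
    by (metis (lifting) module_mat_simps(5))
  then have "(\<forall>g. component a g \<in> \<Gamma> g) \<and> a = msum n (component a) UNIV"
    unfolding component_def by (rule someI_ex)
  then show "component a g \<in> \<Gamma> g" "a = msum n (component a) UNIV" by auto
qed

lemma component_unique:
  assumes "\<And>g. c g \<in> \<Gamma> g" "a = msum n c UNIV"
  shows "component a = c"
proof -
  have a: "a \<in> carrier_mat n n" using assms by simp
  have ex: "\<exists>!c. (\<forall>g. c g \<in> \<Gamma> g) \<and> a = (\<Oplus>\<^bsub>mat_alg n\<^esub>g\<in>UNIV. c g)"
    using gr a unfolding algebra_grading_def by (simp add: module_mat_simps)
  have "(\<forall>g. c g \<in> \<Gamma> g) \<and> a = (\<Oplus>\<^bsub>mat_alg n\<^esub>g\<in>UNIV. c g)"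
    using assms finsum_Gamma by simp
  moreover have "(\<forall>g. component a g \<in> \<Gamma> g) \<and> a = (\<Oplus>\<^bsub>mat_alg n\<^esub>g\<in>UNIV. component a g)"
    using component[OF a] finsum_Gamma by simp
  ultimately show ?thesis using ex by blast
qed

lemma component_homogeneous:
  assumes "a \<in> \<Gamma> g" shows "component a = (\<lambda>h. if h = g then a else 0\<^sub>m n n)"
proof (rule component_unique)
  show "a = msum n (\<lambda>h. if h = g then a else 0\<^sub>m n n) UNIV"
  proof (rule eq_matI)
    fix i j assume "i < dim_row (msum n (\<lambda>h. if h = g then a else 0\<^sub>m n n) UNIV)"
      "j < dim_col (msum n (\<lambda>h. if h = g then a else 0\<^sub>m n n) UNIV)"
    then have ij: "i < n" "j < n" by (simp_all add: msum_def)
    have "(\<Sum>h\<in>UNIV. (if h = g then a else 0\<^sub>m n n) $$ (i, j)) = (\<Sum>h\<in>UNIV. if h = g then a $$ (i, j) else 0)"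
      using ij by (intro sum.cong) auto
    then show "a $$ (i, j) = msum n (\<lambda>h. if h = g then a else 0\<^sub>m n n) UNIV $$ (i, j)"
      using ij by simp
  qed (use carrier[OF assms] in \<open>auto simp: msum_def\<close>)
qed (use assms zero in auto)

lemma component_mult_left:
  assumes a: "a \<in> \<Gamma> g" and b: "b \<in> carrier_mat n n"
  shows "component (a * b) h = a * component b (h - g)"
proof -
  have "component (a * b) = (\<lambda>h. a * component b (h - g))"
  proof (rule component_unique)
    show "a * component b (h - g) \<in> \<Gamma> h" for h
      using mult[OF a component(1)[OF b]] by (metis add_diff_cancel_left' diff_add_cancel add.commute)
    have "a * b = a * msum n (component b) UNIV" using component(2)[OF b] by simp
    also have "\<dots> = msum n (\<lambda>h. a * component b h) UNIV"
      using carrier[OF a] carrier[OF component(1)[OF b]] by (intro mult_msum) auto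
    also have "\<dots> = msum n (\<lambda>h. a * component b (h - g)) UNIV"
    proof -
      have "(\<Sum>h\<in>UNIV. (a * component b h) $$ (i, j)) = (\<Sum>h\<in>UNIV. (a * component b (h - g)) $$ (i, j))" for i j
        by (rule sum.reindex_bij_witness[of _ "\<lambda>h. h - g" "\<lambda>h. h + g"]) auto
      then show ?thesis by (simp add: msum_def)
    qed
    finally show "a * b = msum n (\<lambda>h. a * component b (h - g)) UNIV" .
  qed
  then show ?thesis by simp
qed

lemma component_mult_right:
  assumes a: "a \<in> \<Gamma> g" and b: "b \<in> carrier_mat n n"
  shows "component (b * a) h = component b (h - g) * a"
proof -
  have "component (b * a) = (\<lambda>h. component b (h - g) * a)"
  proof (rule component_unique)
    show "component b (h - g) * a \<in> \<Gamma> h" for h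
      using mult[OF component(1)[OF b] a] by (metis diff_add_cancel)
    have "b * a = msum n (component b) UNIV * a" using component(2)[OF b] by simp
    also have "\<dots> = msum n (\<lambda>h. component b h * a) UNIV"
      using carrier[OF a] carrier[OF component(1)[OF b]] by (intro msum_mult) auto
    also have "\<dots> = msum n (\<lambda>h. component b (h - g) * a) UNIV"
    proof -
      have "(\<Sum>h\<in>UNIV. (component b h * a) $$ (i, j)) = (\<Sum>h\<in>UNIV. (component b (h - g) * a) $$ (i, j))" for i j
        by (rule sum.reindex_bij_witness[of _ "\<lambda>h. h - g" "\<lambda>h. h + g"]) auto
      then show ?thesis by (simp add: msum_def)
    qed
    finally show "b * a = msum n (\<lambda>h. component b (h - g) * a) UNIV" .
  qed
  then show ?thesis by simp
qed

text \<open>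
  Right multiplication by the neutral part e of 1 fixes every homogeneous element, by comparison of
  degrees in a = a 1; hence it fixes 1 itself.
\<close>

lemma one: "1\<^sub>m n \<in> \<Gamma> 0"
proof -
  define e where "e = component (1\<^sub>m n) 0"
  have e: "e \<in> \<Gamma> 0" unfolding e_def by (rule component) simp
  have ae: "a * e = a" if "a \<in> \<Gamma> g" for a g
  proof -
    have "component (a * 1\<^sub>m n) g = a * e" unfolding e_def using component_mult_left[OF that, of "1\<^sub>m n" g] by simp
    then show ?thesis using carrier[OF that] component_homogeneous[OF that] by simp
  qed
  have "1\<^sub>m n * e = msum n (component (1\<^sub>m n)) UNIV * e" using component(2)[of "1\<^sub>m n"] by simp
  also have "\<dots> = msum n (\<lambda>h. component (1\<^sub>m n) h * e) UNIV"
    using component(1)[of "1\<^sub>m n"] carrier carrier[OF e] by (intro msum_mult) auto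
  also have "\<dots> = msum n (component (1\<^sub>m n)) UNIV"
    using ae component(1)[of "1\<^sub>m n"] by (intro msum_cong) auto
  also have "\<dots> = 1\<^sub>m n" using component(2)[of "1\<^sub>m n"] by simp
  finally show ?thesis using e carrier[OF e] by simp
qed

lemma homogeneous_part_nonzero:
  assumes "a \<in> carrier_mat n n" "a \<noteq> 0\<^sub>m n n"
  shows "\<exists>g. component a g \<noteq> 0\<^sub>m n n"
proof (rule ccontr)
  assume "\<not> ?thesis"
  then have "component a = (\<lambda>g. 0\<^sub>m n n)" by auto
  then have "a = msum n (\<lambda>g. 0\<^sub>m n n) (UNIV :: 'g set)" using component(2)[OF assms(1)] by simp
  then have "a = 0\<^sub>m n n" by (auto intro!: eq_matI)
  then show False using assms by simp
qed

text \<open>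
  A matrix c with a c b \<noteq> 0 may be replaced by one of its homogeneous components, because the
  components of a c b are the products of a, a component of c, and b.
\<close>

lemma graded_prime:
  assumes "a \<in> \<Gamma> g" "a \<noteq> 0\<^sub>m n n" "b \<in> \<Gamma> h" "b \<noteq> 0\<^sub>m n n"
  shows "\<exists>t. \<exists>c\<in>\<Gamma> t. a * c * b \<noteq> 0\<^sub>m n n"
proof -
  obtain c where c: "c \<in> carrier_mat n n" "a * c * b \<noteq> 0\<^sub>m n n"
    using matrix_algebra_prime assms carrier by blast
  have ac: "a * c \<in> carrier_mat n n" and acb: "a * c * b \<in> carrier_mat n n"
    using c(1) carrier[OF assms(1)] carrier[OF assms(3)] by auto
  obtain t where "component (a * c * b) t \<noteq> 0\<^sub>m n n" using homogeneous_part_nonzero[OF acb c(2)] by blast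
  then have "a * component c (t - h - g) * b \<noteq> 0\<^sub>m n n"
    using component_mult_right[OF assms(3) ac] component_mult_left[OF assms(1) c(1)] by simp
  then show ?thesis using component(1)[OF c(1)] by blast
qed

end

section \<open>Maximal kernels and eigenvalues\<close>

text \<open>
  The dimension of the kernel, counted as the largest number of independent vectors in it, is bounded
  by n, and a vector outside a subspace enlarges any independent subset of the subspace.
\<close>

lemma exists_maximal_kernel:
  fixes S :: "'k::field mat set"
  assumes S: "S \<subseteq> carrier_mat n n" "S \<noteq> {}"
  shows "\<exists>a\<in>S. \<forall>b\<in>S. mat_kernel a \<subseteq> mat_kernel b \<longrightarrow> mat_kernel b \<subseteq> mat_kernel a"
proof -
  interpret V: vec_space "TYPE('k)" n .
  define P where "P k \<longleftrightarrow> (\<exists>a\<in>S. \<exists>B. B \<subseteq> mat_kernel a \<and> \<not> V.lin_dep B \<and> card B = k)" for k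
  have kc: "mat_kernel a \<subseteq> carrier_vec n" if "a \<in> S" for a
    using mat_kernel_carrier S that by blast
  have fin: "finite B" "card B \<le> n" if "a \<in> S" "B \<subseteq> mat_kernel a" "\<not> V.lin_dep B" for a B
    using V.li_le_dim[of B] that kc[of a] V.dim_is_n by auto
  have P0: "P 0"
    unfolding P_def using S(2) by (intro bexI[of _ "SOME a. a \<in> S"] exI[of _ "{}"])
      (auto simp: V.lin_dep_def some_in_eq)
  have Pn: "k \<le> n" if "P k" for k
    using that fin unfolding P_def by auto
  obtain k where k: "P k" "\<And>l. P l \<Longrightarrow> l \<le> k"
    using ex_has_greatest_nat[of P 0 "\<lambda>x. x" "Suc n"] P0 Pn le_imp_less_Suc by blast
  obtain a B where a: "a \<in> S" and B: "B \<subseteq> mat_kernel a" "\<not> V.lin_dep B" "card B = k"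
    using k(1) unfolding P_def by blast
  have "mat_kernel b \<subseteq> mat_kernel a" if b: "b \<in> S" "mat_kernel a \<subseteq> mat_kernel b" for b
  proof (rule ccontr)
    assume "\<not> ?thesis"
    then obtain v where v: "v \<in> mat_kernel b" "v \<notin> mat_kernel a" by blast
    have ac: "a \<in> carrier_mat n n" using a S by auto
    have subm: "submodule class_ring (mat_kernel a) (module_vec TYPE('k) n)"
      by unfold_locales (use ac mult_add_distrib_mat_vec[OF ac] mult_mat_vec[OF ac] mat_kernel[OF ac]
          in \<open>auto simp: class_ring_simps module_vec_simps\<close>)
    have "V.span B \<subseteq> mat_kernel a"
      by (rule V.span_is_subset[OF B(1) subm])
    then have "v \<notin> V.span B" using v by auto
    moreover have "v \<in> carrier_vec n" using v kc[OF b(1)] by auto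
    moreover have "v \<notin> B" using v B by auto
    ultimately have "\<not> V.lin_dep (B \<union> {v})"
      using V.lin_dep_iff_in_span[of B v] B kc[OF a] by auto
    moreover have "B \<union> {v} \<subseteq> mat_kernel b" using B b v by auto
    moreover have "card (B \<union> {v}) = Suc k" using fin(1)[OF a B(1,2)] \<open>v \<notin> B\<close> B(3) by simp
    ultimately have "P (Suc k)" unfolding P_def using b(1) by metis
    then show False using k(2) by fastforce
  qed
  then show ?thesis using a by blast
qed

definition poly_apply :: "'k::field mat \<Rightarrow> 'k poly \<Rightarrow> 'k vec \<Rightarrow> 'k vec" where
  "poly_apply a p v = vec (dim_vec v) (\<lambda>i. \<Sum>k\<le>degree p. coeff p k * (a ^\<^sub>m k *\<^sub>v v) $ i)"

lemma pow_mat_Suc_left: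
  assumes "a \<in> carrier_mat n n" shows "a ^\<^sub>m Suc k = a * a ^\<^sub>m k"
  using assms by (induction k) (auto simp: assoc_mult_mat[of a n n _ n a n])

lemma pow_mat_add:
  assumes "a \<in> carrier_mat n n" shows "a ^\<^sub>m (k + l) = a ^\<^sub>m k * a ^\<^sub>m l"
  using assms by (induction l) (auto simp: assoc_mult_mat[of _ n n _ n a n])

lemma poly_apply_carrier: "v \<in> carrier_vec n \<Longrightarrow> poly_apply a p v \<in> carrier_vec n"
  by (simp add: poly_apply_def)

lemma poly_apply_index:
  assumes "v \<in> carrier_vec n" "i < n" "degree p \<le> N"
  shows "poly_apply a p v $ i = (\<Sum>k\<le>N. coeff p k * (a ^\<^sub>m k *\<^sub>v v) $ i)"
proof -
  have "(\<Sum>k\<le>degree p. coeff p k * (a ^\<^sub>m k *\<^sub>v v) $ i) = (\<Sum>k\<le>N. coeff p k * (a ^\<^sub>m k *\<^sub>v v) $ i)"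
    using assms by (intro sum.mono_neutral_left) (auto simp: coeff_eq_0)
  then show ?thesis using assms by (simp add: poly_apply_def)
qed

lemma mult_mat_vec_index:
  "a \<in> carrier_mat n n \<Longrightarrow> w \<in> carrier_vec n \<Longrightarrow> i < n \<Longrightarrow> (a *\<^sub>v w) $ i = (\<Sum>j<n. a $$ (i, j) * w $ j)"
  by (auto simp: scalar_prod_def atLeast0LessThan)

lemma mult_unit_vec_index:
  assumes "a \<in> carrier_mat n n" "i < n" "j < n"
  shows "(a *\<^sub>v unit_vec n j) $ i = (a $$ (i, j) :: 'k::field)"
proof -
  have "(a *\<^sub>v unit_vec n j) $ i = (\<Sum>k<n. if k = j then a $$ (i, j) else 0)"
    unfolding mult_mat_vec_index[OF assms(1) unit_vec_carrier assms(2)]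
    using assms by (intro sum.cong) (auto simp: unit_vec_def)
  then show ?thesis using assms by simp
qed

lemma poly_apply_linear_factor:
  fixes a :: "'k::field mat"
  assumes a: "a \<in> carrier_mat n n" and v: "v \<in> carrier_vec n"
  shows "poly_apply a ([:-c, 1:] * q) v = a *\<^sub>v poly_apply a q v - c \<cdot>\<^sub>v poly_apply a q v"
proof (rule eq_vecI)
  note pc = poly_apply_carrier[OF v]
  show "dim_vec (poly_apply a ([:-c, 1:] * q) v) = dim_vec (a *\<^sub>v poly_apply a q v - c \<cdot>\<^sub>v poly_apply a q v)"
    using pc by (metis carrier_vecD index_minus_vec(2) index_smult_vec(2))
  fix i assume "i < dim_vec (a *\<^sub>v poly_apply a q v - c \<cdot>\<^sub>v poly_apply a q v)"
  then have i: "i < n" using carrier_vecD[OF pc[of a q]] by simp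
  let ?N = "degree q"
  let ?u = "\<lambda>k. a ^\<^sub>m k *\<^sub>v v"
  have uc: "?u k \<in> carrier_vec n" for k using pow_carrier_mat[OF a, of k] v by auto
  have pq: "[:-c, 1:] * q = pCons 0 q - Polynomial.smult c q" by simp
  have deg: "degree ([:-c, 1:] * q) \<le> Suc ?N"
    using degree_mult_le[of "[:-c, 1:]" q] by simp
  have "poly_apply a ([:-c, 1:] * q) v $ i = (\<Sum>k\<le>Suc ?N. coeff ([:-c, 1:] * q) k * ?u k $ i)"
    by (rule poly_apply_index[OF v i deg])
  also have "\<dots> = (\<Sum>k\<le>Suc ?N. coeff (pCons 0 q) k * ?u k $ i) - (\<Sum>k\<le>Suc ?N. c * (coeff q k * ?u k $ i))"
    unfolding pq by (simp add: sum_subtractf algebra_simps)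
  also have "(\<Sum>k\<le>Suc ?N. c * (coeff q k * ?u k $ i)) = c * poly_apply a q v $ i"
    unfolding poly_apply_index[OF v i le_SucI[OF order_refl]] sum_distrib_left ..
  also have "(\<Sum>k\<le>Suc ?N. coeff (pCons 0 q) k * ?u k $ i) = (\<Sum>k\<le>?N. coeff q k * ?u (Suc k) $ i)"
    by (subst sum.atMost_Suc_shift) simp
  also have "\<dots> = (\<Sum>k\<le>?N. \<Sum>j<n. coeff q k * (a $$ (i, j) * ?u k $ j))"
  proof (intro sum.cong refl)
    fix k
    have "?u (Suc k) = a *\<^sub>v ?u k"
      unfolding pow_mat_Suc_left[OF a] by (rule assoc_mult_mat_vec[OF a pow_carrier_mat[OF a] v])
    then show "coeff q k * ?u (Suc k) $ i = (\<Sum>j<n. coeff q k * (a $$ (i, j) * ?u k $ j))"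
      using mult_mat_vec_index[OF a uc i] by (simp add: sum_distrib_left)
  qed
  also have "\<dots> = (\<Sum>j<n. a $$ (i, j) * (\<Sum>k\<le>?N. coeff q k * ?u k $ j))"
    by (subst sum.swap) (simp add: sum_distrib_left mult_ac)
  also have "\<dots> = (\<Sum>j<n. a $$ (i, j) * poly_apply a q v $ j)"
    using poly_apply_index[OF v _ order_refl] by (intro sum.cong refl) auto
  also have "\<dots> = (a *\<^sub>v poly_apply a q v) $ i"
    using mult_mat_vec_index[OF a pc i] by simp
  finally show "poly_apply a ([:-c, 1:] * q) v $ i = (a *\<^sub>v poly_apply a q v - c \<cdot>\<^sub>v poly_apply a q v) $ i"
    using i pc by (metis carrier_vecD index_minus_vec(1) index_smult_vec(1) index_smult_vec(2))
qed

text \<open>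
  The n + 1 vectors v, a v, ..., a^n v are dependent.  Adding a zero row makes the matrix of this
  homogeneous system square, so that a nonzero solution comes from its vanishing determinant.
\<close>

lemma poly_annihilates_vector:
  fixes a :: "'k::field mat"
  assumes a: "a \<in> carrier_mat n n" and v: "v \<in> carrier_vec n"
  shows "\<exists>p. p \<noteq> 0 \<and> poly_apply a p v = 0\<^sub>v n"
proof -
  let ?u = "\<lambda>k. a ^\<^sub>m k *\<^sub>v v"
  define M where "M = mat (Suc n) (Suc n) (\<lambda>(i, k). if i < n then ?u k $ i else 0)"
  have M: "M \<in> carrier_mat (Suc n) (Suc n)" by (simp add: M_def)
  have "det M = (\<Sum>j<Suc n. M $$ (n, j) * cofactor M n j)"
    using laplace_expansion_row[OF M] by simp
  also have "\<dots> = 0" by (intro sum.neutral) (auto simp: M_def)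
  finally have "det M = 0" .
  then obtain c where c: "c \<in> carrier_vec (Suc n)" "c \<noteq> 0\<^sub>v (Suc n)" "M *\<^sub>v c = 0\<^sub>v (Suc n)"
    using det_0_iff_vec_prod_zero_field[OF M] by blast
  define p where "p = Poly (list_of_vec c)"
  have cp: "coeff p k = (if k < Suc n then c $ k else 0)" for k
    using c(1) by (auto simp: p_def nth_default_def list_of_vec_index)
  obtain k where k: "k < Suc n" "c $ k \<noteq> 0" using c by (metis carrier_vecD eq_vecI index_zero_vec)
  have "p \<noteq> 0" using cp[of k] k by auto
  moreover have deg: "degree p \<le> n" using cp by (intro degree_le) auto
  have "poly_apply a p v $ i = 0" if i: "i < n" for i
  proof -
    have "poly_apply a p v $ i = (\<Sum>k<Suc n. ?u k $ i * c $ k)"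
      unfolding poly_apply_index[OF v i deg] by (intro sum.cong) (auto simp: cp)
    also have "\<dots> = (M *\<^sub>v c) $ i"
      using i unfolding mult_mat_vec_index[OF M c(1) less_SucI[OF i]]
      by (intro sum.cong) (auto simp: M_def)
    finally show ?thesis using c i by simp
  qed
  then have "poly_apply a p v = 0\<^sub>v n" using poly_apply_carrier[OF v] by (intro eq_vecI) auto
  ultimately show ?thesis by blast
qed

text \<open>
  A nonzero polynomial p of least degree with p(a) v = 0 splits off a linear factor X - c, and the
  cofactor q does not annihilate v by minimality; so q(a) v is an eigenvector.
\<close>

lemma exists_eigenvector_in_orbit:
  fixes a :: "'k::alg_closed_field mat"
  assumes a: "a \<in> carrier_mat n n" and v: "v \<in> carrier_vec n" "v \<noteq> 0\<^sub>v n"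
  shows "\<exists>c q. poly_apply a q v \<noteq> 0\<^sub>v n \<and> a *\<^sub>v poly_apply a q v = c \<cdot>\<^sub>v poly_apply a q v"
proof -
  define P where "P p \<longleftrightarrow> p \<noteq> 0 \<and> poly_apply a p v = 0\<^sub>v n" for p
  obtain p where p: "P p" "\<And>q. P q \<Longrightarrow> degree p \<le> degree q"
    using ex_has_least_nat[of P _ degree] poly_annihilates_vector[OF a v(1)] unfolding P_def by metis
  have "degree p > 0"
  proof (rule ccontr)
    assume "\<not> degree p > 0"
    then obtain c where c: "p = [:c:]" by (metis degree_eq_zeroE not_gr_zero)
    have "poly_apply a p v = c \<cdot>\<^sub>v v"
      using v a c by (intro eq_vecI) (auto simp: poly_apply_def)
    moreover have "c \<noteq> 0" using p c by (auto simp: P_def)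
    ultimately have z: "c \<cdot>\<^sub>v v = 0\<^sub>v n" "c \<noteq> 0" using p by (auto simp: P_def)
    have "v $ i = 0" if "i < n" for i
      using arg_cong[OF z(1), of "\<lambda>w. w $ i"] z(2) that v by auto
    then have "v = 0\<^sub>v n" using v by (intro eq_vecI) auto
    then show False using v by simp
  qed
  then obtain c where "poly p c = 0" using alg_closed_imp_poly_has_root by blast
  then obtain q where q: "p = [:-c, 1:] * q" using poly_eq_0_iff_dvd by blast
  have "q \<noteq> 0" using q p by (auto simp: P_def)
  then have "degree p = Suc (degree q)" unfolding q by (subst degree_mult_eq) auto
  then have nz: "poly_apply a q v \<noteq> 0\<^sub>v n" using p(2)[of q] \<open>q \<noteq> 0\<close> by (auto simp: P_def)
  have z: "a *\<^sub>v poly_apply a q v - c \<cdot>\<^sub>v poly_apply a q v = 0\<^sub>v n"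
    using p(1) poly_apply_linear_factor[OF a v(1), of c q] q by (auto simp: P_def)
  have "a *\<^sub>v poly_apply a q v = c \<cdot>\<^sub>v poly_apply a q v"
  proof (rule eq_vecI)
    fix i assume "i < dim_vec (c \<cdot>\<^sub>v poly_apply a q v)"
    then have i: "i < n" using poly_apply_carrier[OF v(1), of a q] by auto
    show "(a *\<^sub>v poly_apply a q v) $ i = (c \<cdot>\<^sub>v poly_apply a q v) $ i"
      using arg_cong[OF z, of "\<lambda>w. w $ i"] i a poly_apply_carrier[OF v(1), of a q] by auto
  qed (use a poly_apply_carrier[OF v(1), of a q] in auto)
  then show ?thesis using nz by blast
qed

lemma poly_apply_image:
  fixes a :: "'k::field mat"
  assumes a: "a \<in> carrier_mat n n" and v: "v \<in> carrier_vec n"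
  shows "poly_apply a q (a *\<^sub>v v) = a *\<^sub>v poly_apply a q v"
proof (rule eq_vecI)
  note pc = poly_apply_carrier[OF v]
  have av: "a *\<^sub>v v \<in> carrier_vec n" using a v by simp
  fix i assume "i < dim_vec (a *\<^sub>v poly_apply a q v)"
  then have i: "i < n" using a by simp
  note assoc = assoc_mult_mat_vec[OF pow_carrier_mat[OF a] a v] assoc_mult_mat_vec[OF a pow_carrier_mat[OF a] v]
  have com: "a ^\<^sub>m k *\<^sub>v (a *\<^sub>v v) = a *\<^sub>v (a ^\<^sub>m k *\<^sub>v v)" for k
  proof -
    have "a ^\<^sub>m k *\<^sub>v (a *\<^sub>v v) = (a ^\<^sub>m Suc k) *\<^sub>v v"
      using assoc by simp
    then show ?thesis unfolding pow_mat_Suc_left[OF a] using assoc by simp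
  qed
  have uc: "a ^\<^sub>m k *\<^sub>v v \<in> carrier_vec n" for k using pow_carrier_mat[OF a, of k] v by auto
  have "poly_apply a q (a *\<^sub>v v) $ i = (\<Sum>k\<le>degree q. coeff q k * (\<Sum>j<n. a $$ (i, j) * (a ^\<^sub>m k *\<^sub>v v) $ j))"
    unfolding poly_apply_index[OF av i order_refl] com
    using mult_mat_vec_index[OF a uc i] by simp
  also have "\<dots> = (\<Sum>j<n. a $$ (i, j) * (\<Sum>k\<le>degree q. coeff q k * (a ^\<^sub>m k *\<^sub>v v) $ j))"
    by (simp add: sum_distrib_left, subst sum.swap, simp add: mult_ac)
  also have "\<dots> = (\<Sum>j<n. a $$ (i, j) * poly_apply a q v $ j)"
    using poly_apply_index[OF v _ order_refl] by (intro sum.cong refl) auto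
  also have "\<dots> = (a *\<^sub>v poly_apply a q v) $ i"
    using mult_mat_vec_index[OF a pc i] by simp
  finally show "poly_apply a q (a *\<^sub>v v) $ i = (a *\<^sub>v poly_apply a q v) $ i" .
qed (use a in \<open>simp add: poly_apply_def\<close>)

text \<open>
  An eigenvector in the image of a cannot belong to the eigenvalue 0 if a and its square have the same
  kernel.
\<close>

lemma exists_nonzero_eigenvalue:
  fixes a :: "'k::alg_closed_field mat"
  assumes a: "a \<in> carrier_mat n n" "a \<noteq> 0\<^sub>m n n" and ker: "mat_kernel (a * a) \<subseteq> mat_kernel a"
  shows "\<exists>c w. c \<noteq> 0 \<and> w \<in> carrier_vec n \<and> w \<noteq> 0\<^sub>v n \<and> a *\<^sub>v w = c \<cdot>\<^sub>v w"
proof -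
  obtain i j where ij: "i < n" "j < n" "a $$ (i, j) \<noteq> 0"
    using a by (metis (no_types, lifting) carrier_matD eq_matI index_zero_mat)
  let ?v = "unit_vec n j :: 'k vec"
  have v: "?v \<in> carrier_vec n" by simp
  have "(a *\<^sub>v ?v) $ i \<noteq> 0" using ij mult_unit_vec_index[OF a(1) ij(1,2)] by simp
  then have nz: "a *\<^sub>v ?v \<noteq> 0\<^sub>v n" using ij by auto
  have av: "a *\<^sub>v ?v \<in> carrier_vec n" using a by simp
  obtain c q where cq: "poly_apply a q (a *\<^sub>v ?v) \<noteq> 0\<^sub>v n"
      "a *\<^sub>v poly_apply a q (a *\<^sub>v ?v) = c \<cdot>\<^sub>v poly_apply a q (a *\<^sub>v ?v)"
    using exists_eigenvector_in_orbit[OF a(1) av nz] by blast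
  define y where "y = poly_apply a q ?v"
  have y: "y \<in> carrier_vec n" unfolding y_def by (rule poly_apply_carrier[OF v])
  have img: "poly_apply a q (a *\<^sub>v ?v) = a *\<^sub>v y" unfolding y_def by (rule poly_apply_image[OF a(1) v])
  have "c \<noteq> 0"
  proof
    assume "c = 0"
    then have "a *\<^sub>v (a *\<^sub>v y) = 0\<^sub>v n" using cq(2) y a unfolding img by (auto intro!: eq_vecI)
    then have "(a * a) *\<^sub>v y = 0\<^sub>v n" using a y by (simp add: assoc_mult_mat_vec[of _ n n _ n])
    then have "y \<in> mat_kernel (a * a)" using a y by (intro mat_kernelI[of _ n n]) auto
    then have "a *\<^sub>v y = 0\<^sub>v n" using ker mat_kernelD[OF a(1)] by blast
    then show False using cq img by simp
  qed
  then show ?thesis using cq img y a by (intro exI[of _ c] exI[of _ "a *\<^sub>v y"]) auto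
qed

section \<open>An idempotent with maximal kernel\<close>

lemma exists_positive_multiple_zero: "\<exists>k>0. (((+) t) ^^ k) 0 = (0 :: 'g::{ab_group_add,finite})"
proof -
  have shift: "(((+) t) ^^ k) x = (((+) t) ^^ k) 0 + x" for k and x :: 'g
    by (induction k) (auto simp: add.assoc)
  have "\<not> inj (\<lambda>k. (((+) t) ^^ k) (0 :: 'g))"
    using finite_imageD[of "\<lambda>k. (((+) t) ^^ k) (0 :: 'g)" UNIV] finite_subset[OF subset_UNIV finite_UNIV]
      infinite_UNIV_nat by blast
  then obtain i j where ij: "i < j" "(((+) t) ^^ i) (0 :: 'g) = (((+) t) ^^ j) 0"
    unfolding inj_def by (metis linorder_neqE_nat)
  have "(((+) t) ^^ j) (0 :: 'g) = (((+) t) ^^ (j - i)) 0 + (((+) t) ^^ i) 0"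
    using ij(1) shift[of "j - i" "(((+) t) ^^ i) 0"] by (metis comp_def funpow_add le_add_diff_inverse2 less_imp_le)
  then show ?thesis using ij by (intro exI[of _ "j - i"]) auto
qed

lemma one_smult_mat [simp]: "1 \<cdot>\<^sub>m A = (A :: 'k::field mat)"
  by (intro eq_matI) auto

lemma mat_kernel_everything:
  assumes "a \<in> carrier_mat n n" "carrier_vec n \<subseteq> mat_kernel a"
  shows "a = (0\<^sub>m n n :: 'k::field mat)"
proof (rule mat_eqI[OF assms(1)])
  fix i j assume ij: "i < n" "j < n"
  have "a *\<^sub>v unit_vec n j = 0\<^sub>v n" using assms mat_kernelD(2) by (metis subsetD unit_vec_carrier)
  then have "(a *\<^sub>v unit_vec n j) $ i = 0" using ij by simp
  then show "a $$ (i, j) = 0\<^sub>m n n $$ (i, j)" using ij mult_unit_vec_index[OF assms(1) ij] by simp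
qed simp

lemma mat_kernel_mono:
  assumes "a \<in> carrier_mat n n" "b \<in> carrier_mat n n"
  shows "mat_kernel b \<subseteq> mat_kernel (a * b)"
  using mat_kernel_mult_subset[OF assms(2,1)] .

lemma mat_kernel_mult_iff:
  assumes "a \<in> carrier_mat n n" "b \<in> carrier_mat n n" "v \<in> carrier_vec n"
  shows "v \<in> mat_kernel (a * b) \<longleftrightarrow> b *\<^sub>v v \<in> mat_kernel a"
  using assms by (simp add: mat_kernel[of _ n n] assoc_mult_mat_vec[of _ n n _ n])

lemma mult_zero_kernel:
  assumes "a \<in> carrier_mat n n" "b \<in> carrier_mat n n" "x \<in> carrier_mat n n"
    and "a * x = 0\<^sub>m n n" "mat_kernel a \<subseteq> mat_kernel b"
  shows "b * x = (0\<^sub>m n n :: 'k::field mat)"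
proof (rule mat_kernel_everything)
  show "carrier_vec n \<subseteq> mat_kernel (b * x)"
  proof
    fix v :: "'k vec" assume v: "v \<in> carrier_vec n"
    have "0\<^sub>m n n *\<^sub>v v = 0\<^sub>v n" using v by (auto intro!: eq_vecI)
    then have "v \<in> mat_kernel (a * x)" using assms v by (simp add: mat_kernel[of _ n n])
    then show "v \<in> mat_kernel (b * x)"
      using mat_kernel_mult_iff[OF assms(1,3) v] mat_kernel_mult_iff[OF assms(2,3) v] assms(5) by blast
  qed
qed (use assms in auto)

locale graded_matrix_ac = graded_matrix n \<Gamma>
  for n :: nat and \<Gamma> :: "'g::{ab_group_add,finite} \<Rightarrow> 'k::alg_closed_field mat set"
begin

text \<open>
  Homogeneous elements of maximal kernel play the role of generators of minimal graded left ideals: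
  the left ideal of a matrix is determined by its kernel.
\<close>

definition kernel_maximal :: "'k mat \<Rightarrow> bool" where
  "kernel_maximal a \<longleftrightarrow> (\<forall>g. \<forall>b\<in>\<Gamma> g. b \<noteq> 0\<^sub>m n n \<longrightarrow> mat_kernel a \<subseteq> mat_kernel b \<longrightarrow> mat_kernel b \<subseteq> mat_kernel a)"

lemma pow: "a \<in> \<Gamma> t \<Longrightarrow> a ^\<^sub>m k \<in> \<Gamma> ((((+) t) ^^ k) 0)"
proof (induction k)
  case 0
  then show ?case using one carrier by auto
next
  case (Suc k)
  then show ?case using mult[OF Suc.IH[OF Suc.prems] Suc.prems] by (simp add: add.commute)
qed

text \<open>
  For a nonzero eigenvalue c of d, the homogeneous element d d - c d kills the kernel of d and, in
  addition, an eigenvector for c.  As the kernel of d is maximal, this element vanishes.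
\<close>

lemma kernel_maximal_square:
  assumes d: "d \<in> \<Gamma> 0" "d \<noteq> 0\<^sub>m n n" and max: "kernel_maximal d" and ker: "mat_kernel (d * d) \<subseteq> mat_kernel d"
  shows "\<exists>c. c \<noteq> 0 \<and> d * d = c \<cdot>\<^sub>m d"
proof -
  note dc = carrier[OF d(1)]
  obtain c w where cw: "c \<noteq> 0" "w \<in> carrier_vec n" "w \<noteq> 0\<^sub>v n" "d *\<^sub>v w = c \<cdot>\<^sub>v w"
    using exists_nonzero_eigenvalue[OF dc d(2) ker] by blast
  define b where "b = (d - c \<cdot>\<^sub>m 1\<^sub>m n) * d"
  have cc: "d - c \<cdot>\<^sub>m 1\<^sub>m n \<in> \<Gamma> 0" using d one by (intro diff smult)
  have b: "b \<in> \<Gamma> 0" unfolding b_def using mult[OF cc d(1)] by simp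
  have bw: "b *\<^sub>v w = 0\<^sub>v n"
  proof -
    have "b *\<^sub>v w = (d - c \<cdot>\<^sub>m 1\<^sub>m n) *\<^sub>v (c \<cdot>\<^sub>v w)"
      unfolding b_def using cw carrier[OF cc] dc by (simp add: assoc_mult_mat_vec[of _ n n _ n])
    also have "\<dots> = c \<cdot>\<^sub>v ((d - c \<cdot>\<^sub>m 1\<^sub>m n) *\<^sub>v w)"
      using mult_mat_vec[OF carrier[OF cc] cw(2)] by simp
    also have "(d - c \<cdot>\<^sub>m 1\<^sub>m n) *\<^sub>v w = d *\<^sub>v w - (c \<cdot>\<^sub>m 1\<^sub>m n) *\<^sub>v w"
      using dc cw by (intro minus_mult_distrib_mat_vec) auto
    also have "(c \<cdot>\<^sub>m 1\<^sub>m n) *\<^sub>v w = c \<cdot>\<^sub>v w" using cw by auto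
    finally show ?thesis using cw by auto
  qed
  have "b = 0\<^sub>m n n"
  proof (rule ccontr)
    assume nz: "b \<noteq> 0\<^sub>m n n"
    have "mat_kernel d \<subseteq> mat_kernel b" unfolding b_def by (rule mat_kernel_mono[OF carrier[OF cc] dc])
    then have "mat_kernel b \<subseteq> mat_kernel d" using max b nz unfolding kernel_maximal_def by blast
    moreover have "w \<in> mat_kernel b" using mat_kernelI[OF carrier[OF b] cw(2) bw] .
    ultimately have "d *\<^sub>v w = 0\<^sub>v n" using mat_kernelD(2)[OF dc] by blast
    then have "c \<cdot>\<^sub>v w = 0\<^sub>v n" using cw by simp
    then have "(c \<cdot>\<^sub>v w) $ i = 0" if "i < n" for i using that by simp
    then have "w $ i = 0" if "i < n" for i using cw that by fastforce
    then have "w = 0\<^sub>v n" using cw by (intro eq_vecI) auto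
    then show False using cw by simp
  qed
  moreover have "b = d * d - c \<cdot>\<^sub>m d" unfolding b_def
    using dc by (subst minus_mult_distrib_mat[of _ n n _ _ n]) (auto simp: mult_smult_assoc_mat[of _ n n _ n])
  ultimately have z: "d * d - c \<cdot>\<^sub>m d = 0\<^sub>m n n" by simp
  have "d * d = c \<cdot>\<^sub>m d"
  proof (rule mat_eqI[of _ n n])
    fix i j assume "i < n" "j < n"
    then show "(d * d) $$ (i, j) = (c \<cdot>\<^sub>m d) $$ (i, j)"
      using arg_cong[OF z, of "\<lambda>x. x $$ (i, j)"] dc by auto
  qed (use dc in auto)
  then show ?thesis using cw by blast
qed

lemma pow_kernel:
  assumes b: "b \<in> carrier_mat n n" and a: "a \<in> carrier_mat n n"
    and ab: "mat_kernel b \<subseteq> mat_kernel a" "mat_kernel (a * b) \<subseteq> mat_kernel a"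
  shows "mat_kernel (b ^\<^sub>m Suc k) \<subseteq> mat_kernel a"
proof (induction k)
  case 0
  then show ?case using ab b by simp
next
  case (Suc k)
  have bk: "b ^\<^sub>m Suc k \<in> carrier_mat n n" by (rule pow_carrier_mat[OF b])
  show ?case
  proof
    fix v assume v: "v \<in> mat_kernel (b ^\<^sub>m Suc (Suc k))"
    then have v': "v \<in> mat_kernel (b ^\<^sub>m Suc k * b)" by simp
    have vc: "v \<in> carrier_vec n" using v' mat_kernelD(1)[of "b ^\<^sub>m Suc k * b" n n] b bk by auto
    have "b *\<^sub>v v \<in> mat_kernel (b ^\<^sub>m Suc k)" using mat_kernel_mult_iff[OF bk b vc] v' by blast
    then have "b *\<^sub>v v \<in> mat_kernel a" using Suc.IH by blast
    then show "v \<in> mat_kernel a" using mat_kernel_mult_iff[OF a b vc] ab by blast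
  qed
qed

lemma kernel_maximal_cong:
  "kernel_maximal a \<Longrightarrow> mat_kernel b = mat_kernel a \<Longrightarrow> kernel_maximal b"
  by (simp add: kernel_maximal_def)

text \<open>
  Let a be homogeneous with maximal kernel and b = c a with a c a \<noteq> 0.  Then b and a b have the kernel of
  a, and this persists for all powers of b.  As G is finite, some power d of b has degree 0.  By
  \<open>kernel_maximal_square\<close> d d = \<lambda> d with \<lambda> \<noteq> 0, and d divided by this scalar is idempotent.
\<close>

lemma exists_kernel_maximal_idempotent:
  "\<exists>e\<in>\<Gamma> 0. e \<noteq> 0\<^sub>m n n \<and> e * e = e \<and> kernel_maximal e"
proof -
  define S where "S = {a. a \<noteq> 0\<^sub>m n n \<and> (\<exists>g. a \<in> \<Gamma> g)}"
  have "1\<^sub>m n \<noteq> (0\<^sub>m n n :: 'k mat)" using n_pos by (metis index_one_mat(1) index_zero_mat(1) zero_neq_one)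
  then have "S \<noteq> {}" using one by (auto simp: S_def)
  moreover have "S \<subseteq> carrier_mat n n" using carrier by (auto simp: S_def)
  ultimately obtain a where a: "a \<in> S" "\<forall>b\<in>S. mat_kernel a \<subseteq> mat_kernel b \<longrightarrow> mat_kernel b \<subseteq> mat_kernel a"
    using exists_maximal_kernel by blast
  then obtain t where at: "a \<in> \<Gamma> t" "a \<noteq> 0\<^sub>m n n" by (auto simp: S_def)
  have max: "kernel_maximal a" using a(2) by (auto simp: kernel_maximal_def S_def)
  note ac = carrier[OF at(1)]
  obtain s c where c: "c \<in> \<Gamma> s" "a * c * a \<noteq> 0\<^sub>m n n" using graded_prime[OF at at] by blast
  define b where "b = c * a"
  have b: "b \<in> \<Gamma> (s + t)" unfolding b_def by (rule mult[OF c(1) at(1)])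
  note bc = carrier[OF b]
  have aca: "a * c * a = a * b" unfolding b_def using ac carrier[OF c(1)] by (rule assoc_mult_mat[of _ n n _ n]) (rule ac)
  have abG: "a * b \<in> \<Gamma> (t + (s + t))" by (rule mult[OF at(1) b])
  have ab: "a * b \<noteq> 0\<^sub>m n n" using c aca by simp
  have bnz: "b \<noteq> 0\<^sub>m n n" using ab ac by auto
  have kab: "mat_kernel a \<subseteq> mat_kernel b" unfolding b_def by (rule mat_kernel_mono[OF carrier[OF c(1)] ac])
  then have kba: "mat_kernel b \<subseteq> mat_kernel a" using max b bnz unfolding kernel_maximal_def by blast
  have "mat_kernel a \<subseteq> mat_kernel (a * b)" using kab mat_kernel_mono[OF ac bc] by blast
  then have kabb: "mat_kernel (a * b) \<subseteq> mat_kernel a" using max abG ab unfolding kernel_maximal_def by blast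
  obtain k where k: "k > 0" "(((+) (s + t)) ^^ k) 0 = (0 :: 'g)" using exists_positive_multiple_zero by blast
  obtain l where l: "k = Suc l" using k by (cases k) auto
  define d where "d = b ^\<^sub>m k"
  have d: "d \<in> \<Gamma> 0" using pow[OF b, of k] k unfolding d_def by simp
  note dc = carrier[OF d]
  have kd: "mat_kernel (b ^\<^sub>m Suc m) \<subseteq> mat_kernel a" for m by (rule pow_kernel[OF bc ac kba kabb])
  have kd': "mat_kernel a \<subseteq> mat_kernel d"
    using kab mat_kernel_mono[OF pow_carrier_mat[OF bc, of l] bc] unfolding d_def l by auto
  have kda: "mat_kernel d = mat_kernel a" using kd[of l] kd' unfolding d_def l by blast
  have dnz: "d \<noteq> 0\<^sub>m n n"
  proof
    assume "d = 0\<^sub>m n n"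
    then have "carrier_vec n \<subseteq> mat_kernel d" by (auto simp: mat_kernel[of _ n n])
    then show False using mat_kernel_everything[OF ac] kda at by auto
  qed
  have dd: "d * d = b ^\<^sub>m Suc (l + k)" unfolding d_def using pow_mat_add[OF bc, of k k] l by simp
  have "mat_kernel (d * d) \<subseteq> mat_kernel d" unfolding dd kda by (rule kd)
  then obtain c where c: "c \<noteq> 0" "d * d = c \<cdot>\<^sub>m d"
    using kernel_maximal_square[OF d dnz kernel_maximal_cong[OF max kda]] by blast
  define e where "e = inverse c \<cdot>\<^sub>m d"
  have "e \<in> \<Gamma> 0" unfolding e_def by (rule smult[OF d])
  moreover have "e \<noteq> 0\<^sub>m n n" unfolding e_def using dc dnz c by (simp add: smult_zero_iff_mat)
  moreover have "e * e = inverse c \<cdot>\<^sub>m (inverse c \<cdot>\<^sub>m (d * d))" unfolding e_def using dc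
    by (simp add: mult_smult_distrib[of _ n n _ n] mult_smult_assoc_mat[of _ n n _ n])
  then have "e * e = e" using c by (simp add: e_def smult_smult_mat)
  moreover have "mat_kernel e = mat_kernel d"
  proof -
    have "e *\<^sub>v v = 0\<^sub>v n \<longleftrightarrow> d *\<^sub>v v = 0\<^sub>v n" if v: "v \<in> carrier_vec n" for v
    proof -
      have ev: "e *\<^sub>v v = inverse c \<cdot>\<^sub>v (d *\<^sub>v v)" unfolding e_def using dc v by auto
      have "d *\<^sub>v v = c \<cdot>\<^sub>v (e *\<^sub>v v)" unfolding ev using c by (auto simp: smult_smult_assoc)
      moreover have "k \<cdot>\<^sub>v 0\<^sub>v n = 0\<^sub>v n" for k :: 'k by (auto intro!: eq_vecI)
      ultimately show ?thesis using ev by metis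
    qed
    then show ?thesis using dc by (auto simp: mat_kernel[of _ n n] e_def)
  qed
  ultimately show ?thesis using kernel_maximal_cong[OF max] kda by metis
qed

end

section \<open>The graded division algebra e A e\<close>

locale graded_corner = graded_matrix_ac n \<Gamma>
  for n :: nat and \<Gamma> :: "'g::{ab_group_add,finite} \<Rightarrow> 'k::alg_closed_field mat set" +
  fixes e :: "'k mat"
  assumes e: "e \<in> \<Gamma> 0" and e_nz: "e \<noteq> 0\<^sub>m n n" and ee: "e * e = e" and e_max: "kernel_maximal e"
begin

text \<open>
  As e has degree 0, the algebra e A e is graded; these are its homogeneous components.
\<close>

definition D :: "'g \<Rightarrow> 'k mat set" where
  "D g = {d \<in> \<Gamma> g. e * d = d \<and> d * e = d}"

lemma D_Gamma: "d \<in> D g \<Longrightarrow> d \<in> \<Gamma> g" and D_carrier: "d \<in> D g \<Longrightarrow> d \<in> carrier_mat n n"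
  and D_left: "d \<in> D g \<Longrightarrow> e * d = d" and D_right: "d \<in> D g \<Longrightarrow> d * e = d"
  using carrier by (auto simp: D_def)

lemma ec: "e \<in> carrier_mat n n" using carrier[OF e] .

lemma assoc: "a \<in> carrier_mat n n \<Longrightarrow> b \<in> carrier_mat n n \<Longrightarrow> c \<in> carrier_mat n n \<Longrightarrow> a * b * c = a * (b * c)"
  for a b c :: "'k mat" by (rule assoc_mult_mat)

lemma e_D: "e \<in> D 0" using e ee by (simp add: D_def)

lemma corner_D: "a \<in> \<Gamma> g \<Longrightarrow> e * a * e \<in> D g"
proof -
  assume a: "a \<in> \<Gamma> g"
  note ac = carrier[OF a]
  have "e * a * e \<in> \<Gamma> g" using mult[OF mult[OF e a] e] by simp
  moreover have "e * (e * a * e) = e * a * e"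
    using assoc[OF ec ec ac] assoc[OF ec mult_carrier_mat[OF ec ac] ec] ee ac ec by simp
  moreover have "e * a * e * e = e * a * e"
    using assoc[OF mult_carrier_mat[OF ec ac] ec ec] ee by simp
  ultimately show ?thesis by (simp add: D_def)
qed

lemma D_mult: "a \<in> D g \<Longrightarrow> b \<in> D h \<Longrightarrow> a * b \<in> D (g + h)"
proof -
  assume a: "a \<in> D g" and b: "b \<in> D h"
  have "a * b \<in> \<Gamma> (g + h)" using mult a b D_Gamma by blast
  moreover have "e * (a * b) = a * b"
    using assoc[OF ec D_carrier[OF a] D_carrier[OF b]] D_left[OF a] by simp
  moreover have "a * b * e = a * b"
    using assoc[OF D_carrier[OF a] D_carrier[OF b] ec] D_right[OF b] by simp
  ultimately show ?thesis by (simp add: D_def)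
qed

lemma D_smult: "a \<in> D g \<Longrightarrow> c \<cdot>\<^sub>m a \<in> D g"
  using ec carrier[of a g] by (auto simp: D_def smult mult_smult_distrib[of _ n n _ n] mult_smult_assoc_mat[of _ n n _ n])

text \<open>
  Every element of the corner is a left multiple of e, whose kernel is maximal.
\<close>

lemma D_kernel:
  assumes d: "d \<in> D g" "d \<noteq> 0\<^sub>m n n" shows "mat_kernel d = mat_kernel e"
proof -
  have "mat_kernel e \<subseteq> mat_kernel (d * e)" by (rule mat_kernel_mono[OF D_carrier[OF d(1)] ec])
  then have 1: "mat_kernel e \<subseteq> mat_kernel d" using D_right[OF d(1)] by simp
  then have "mat_kernel d \<subseteq> mat_kernel e" using e_max d D_Gamma[OF d(1)] unfolding kernel_maximal_def by blast
  then show ?thesis using 1 by blast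
qed

lemma D_no_zero_divisors:
  assumes a: "a \<in> D g" "a \<noteq> 0\<^sub>m n n" and b: "b \<in> D h" "b \<noteq> 0\<^sub>m n n"
  shows "a * b \<noteq> 0\<^sub>m n n"
proof
  assume "a * b = 0\<^sub>m n n"
  then have "e * b = 0\<^sub>m n n"
    using mult_zero_kernel[OF D_carrier[OF a(1)] ec D_carrier[OF b(1)]] D_kernel[OF a] by simp
  then show False using D_left[OF b(1)] b by simp
qed

text \<open>
  Here d d = c d, so the element d - c e is killed by d on the left and therefore, d having the kernel
  of e, by e; but e fixes it.
\<close>

lemma D_neutral:
  assumes d: "d \<in> D 0" shows "\<exists>c. d = c \<cdot>\<^sub>m e"
proof (cases "d = 0\<^sub>m n n")
  case True
  then show ?thesis using ec by (intro exI[of _ 0]) (auto intro!: eq_matI)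
next
  case False
  note dc = D_carrier[OF d]
  have dd: "d * d \<in> D 0" using D_mult[OF d d] by simp
  have "mat_kernel (d * d) = mat_kernel d"
    using D_kernel[OF dd D_no_zero_divisors[OF d False d False]] D_kernel[OF d False] by simp
  then obtain c where c: "c \<noteq> 0" "d * d = c \<cdot>\<^sub>m d"
    using kernel_maximal_square[OF D_Gamma[OF d] False kernel_maximal_cong[OF e_max D_kernel[OF d False]]] by blast
  define y where "y = d - c \<cdot>\<^sub>m e"
  have yc: "y \<in> carrier_mat n n" using dc ec by (auto simp: y_def)
  have "d * y = d * d - d * (c \<cdot>\<^sub>m e)" unfolding y_def using dc ec by (intro mult_minus_distrib_mat) auto
  also have "d * (c \<cdot>\<^sub>m e) = c \<cdot>\<^sub>m d" using dc ec D_right[OF d] by (simp add: mult_smult_distrib[of _ n n _ n])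
  finally have "d * y = 0\<^sub>m n n" using c dc by auto
  then have "e * y = 0\<^sub>m n n" using mult_zero_kernel[OF dc ec yc] D_kernel[OF d False] by simp
  moreover have "e * y = e * d - e * (c \<cdot>\<^sub>m e)" unfolding y_def using dc ec by (intro mult_minus_distrib_mat) auto
  moreover have "e * (c \<cdot>\<^sub>m e) = c \<cdot>\<^sub>m e" using ec ee by (simp add: mult_smult_distrib[of _ n n _ n])
  ultimately have z: "d - c \<cdot>\<^sub>m e = 0\<^sub>m n n" using D_left[OF d] by simp
  have "d = c \<cdot>\<^sub>m e"
  proof (rule mat_eqI[of _ n n])
    fix i j assume "i < n" "j < n"
    then show "d $$ (i, j) = (c \<cdot>\<^sub>m e) $$ (i, j)"
      using arg_cong[OF z, of "\<lambda>x. x $$ (i, j)"] dc ec by auto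
  qed (use dc ec in auto)
  then show ?thesis by blast
qed

lemma D_pow:
  assumes d: "d \<in> D g" "d \<noteq> 0\<^sub>m n n"
  shows "d ^\<^sub>m Suc k \<in> D ((((+) g) ^^ Suc k) 0) \<and> d ^\<^sub>m Suc k \<noteq> 0\<^sub>m n n"
proof (induction k)
  case 0
  then show ?case using d D_carrier[OF d(1)] by simp
next
  case (Suc k)
  then have 1: "d ^\<^sub>m Suc k \<in> D ((((+) g) ^^ Suc k) 0)" "d ^\<^sub>m Suc k \<noteq> 0\<^sub>m n n" by auto
  have "d ^\<^sub>m Suc k * d \<in> D ((((+) g) ^^ Suc k) 0 + g)" by (rule D_mult[OF 1(1) d(1)])
  moreover have "d ^\<^sub>m Suc k * d \<noteq> 0\<^sub>m n n" by (rule D_no_zero_divisors[OF 1 d])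
  moreover have "d ^\<^sub>m Suc (Suc k) = d ^\<^sub>m Suc k * d" by simp
  moreover have "(((+) g) ^^ Suc k) 0 + g = (((+) g) ^^ Suc (Suc k)) 0" by (simp add: add.commute)
  ultimately show ?case by metis
qed

text \<open>
  A power of d has degree 0, so it is a nonzero multiple of e; the preceding power of d is the inverse
  up to this factor.
\<close>

lemma D_inverse:
  assumes d: "d \<in> D g" "d \<noteq> 0\<^sub>m n n"
  shows "\<exists>d'\<in>D (- g). d * d' = e \<and> d' * d = e"
proof -
  note dc = D_carrier[OF d(1)]
  obtain k where k: "k > 0" "(((+) g) ^^ k) 0 = (0 :: 'g)" using exists_positive_multiple_zero by blast
  obtain l where l: "k = Suc l" using k by (cases k) auto
  have x: "d ^\<^sub>m k \<in> D 0" "d ^\<^sub>m k \<noteq> 0\<^sub>m n n" using D_pow[OF d, of l] k l by auto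
  obtain c where c: "d ^\<^sub>m k = c \<cdot>\<^sub>m e" using D_neutral[OF x(1)] by blast
  have cnz: "c \<noteq> 0" using x(2) ec unfolding c by (auto simp: smult_zero_iff_mat)
  have "g + (((+) g) ^^ l) 0 = 0" using k l by simp
  then have "(((+) g) ^^ l) 0 = - g" by (metis add_eq_0_iff)
  then have yG: "d ^\<^sub>m l \<in> \<Gamma> (- g)" using pow[OF D_Gamma[OF d(1)], of l] by simp
  note yc = carrier[OF yG]
  define d' where "d' = inverse c \<cdot>\<^sub>m (e * d ^\<^sub>m l * e)"
  have eyc: "e * d ^\<^sub>m l \<in> carrier_mat n n" "d ^\<^sub>m l * e \<in> carrier_mat n n" "e * d ^\<^sub>m l * e \<in> carrier_mat n n"
    using ec yc by auto
  have "d' \<in> D (- g)" unfolding d'_def by (intro D_smult corner_D yG)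
  moreover have "d * d' = e"
  proof -
    have "d * (e * d ^\<^sub>m l * e) = d * e * (d ^\<^sub>m l * e)"
      using assoc[OF dc ec eyc(2)] assoc[OF ec yc ec] by simp
    also have "\<dots> = d * d ^\<^sub>m l * e" using assoc[OF dc yc ec] D_right[OF d(1)] by simp
    also have "d * d ^\<^sub>m l = c \<cdot>\<^sub>m e" using pow_mat_Suc_left[OF dc, of l] c l by simp
    also have "(c \<cdot>\<^sub>m e) * e = c \<cdot>\<^sub>m e" using ec ee by (simp add: mult_smult_assoc_mat[of _ n n _ n])
    finally have "d * (e * d ^\<^sub>m l * e) = c \<cdot>\<^sub>m e" .
    then show ?thesis unfolding d'_def using dc eyc cnz by (simp add: mult_smult_distrib[of _ n n _ n] smult_smult_mat)
  qed
  moreover have "d' * d = e"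
  proof -
    have "e * d ^\<^sub>m l * e * d = e * d ^\<^sub>m l * (e * d)" using assoc[OF eyc(1) ec dc] .
    also have "\<dots> = e * (d ^\<^sub>m l * d)" using assoc[OF ec yc dc] D_left[OF d(1)] by simp
    also have "d ^\<^sub>m l * d = c \<cdot>\<^sub>m e" using c l by simp
    also have "e * (c \<cdot>\<^sub>m e) = c \<cdot>\<^sub>m e" using ec ee by (simp add: mult_smult_distrib[of _ n n _ n])
    finally have "e * d ^\<^sub>m l * e * d = c \<cdot>\<^sub>m e" .
    then show ?thesis unfolding d'_def using dc eyc cnz by (simp add: mult_smult_assoc_mat[of _ n n _ n] smult_smult_mat)
  qed
  ultimately show ?thesis by blast
qed

end

section \<open>Calculation in twisted matrix algebras\<close>

text \<open>
  An element of the tensor product is a function F from Q to r by r matrices; the following rules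
  express all operations by the entries F q $$ (i, j).
\<close>

lemma twisted_carrier:
  "F \<in> carrier (twisted_mat_alg Q \<alpha> r) \<longleftrightarrow>
     (\<forall>q\<in>Q. F q \<in> carrier_mat r r) \<and> (\<forall>q. q \<notin> Q \<longrightarrow> F q = 0\<^sub>m r r)"
  by (simp add: tensor_alg_def module_mat_simps)

lemma twisted_carrierD: "F \<in> carrier (twisted_mat_alg Q \<alpha> r) \<Longrightarrow> F q \<in> carrier_mat r r"
  by (cases "q \<in> Q") (auto simp: twisted_carrier)

lemma twisted_eqI:
  assumes "F \<in> carrier (twisted_mat_alg Q \<alpha> r)" "H \<in> carrier (twisted_mat_alg Q \<alpha> r)"
    and "\<And>q i j. q \<in> Q \<Longrightarrow> i < r \<Longrightarrow> j < r \<Longrightarrow> F q $$ (i, j) = H q $$ (i, j)"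
  shows "F = H"
proof
  fix q
  show "F q = H q"
  proof (cases "q \<in> Q")
    case True
    then show ?thesis using assms by (intro mat_eqI[of _ r r]) (auto simp: twisted_carrier)
  qed (use assms(1,2) in \<open>auto simp: twisted_carrier\<close>)
qed

lemma twisted_simps:
  "\<zero>\<^bsub>twisted_mat_alg Q \<alpha> r\<^esub> = (\<lambda>s. 0\<^sub>m r r)"
  "(F \<oplus>\<^bsub>twisted_mat_alg Q \<alpha> r\<^esub> H) = (\<lambda>s. F s + H s)"
  "(c \<odot>\<^bsub>twisted_mat_alg Q \<alpha> r\<^esub> F) = (\<lambda>s. c \<cdot>\<^sub>m F s)"
  "\<one>\<^bsub>twisted_mat_alg Q \<alpha> r\<^esub> = (\<lambda>s. (inverse (\<alpha> 0 0) * basis_fun 0 s) \<cdot>\<^sub>m 1\<^sub>m r)"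
  by (simp_all add: tensor_alg_def module_mat_simps pure_tensor_def twisted_group_alg_def)

lemma twisted_mult_msum:
  assumes F: "F \<in> carrier (twisted_mat_alg Q \<alpha> r)" and H: "H \<in> carrier (twisted_mat_alg Q \<alpha> r)"
  shows "(F \<otimes>\<^bsub>twisted_mat_alg Q \<alpha> r\<^esub> H) s =
    msum r (\<lambda>p. msum r (\<lambda>q. (if p + q = s then \<alpha> p q else 0) \<cdot>\<^sub>m (F p * H q)) Q) (Q :: 'g::{ab_group_add,finite} set)"
proof -
  have c: "c \<cdot>\<^sub>m (F p * H q) \<in> carrier_mat r r" for c p q
    by (rule smult_carrier_mat[OF mult_carrier_mat[OF twisted_carrierD[OF F] twisted_carrierD[OF H]]])
  have "(basis_fun p \<otimes>\<^bsub>twisted_group_alg Q \<alpha>\<^esub> basis_fun q) s = (if p + q = s then \<alpha> p q else 0)"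
    if "p \<in> Q" "q \<in> Q" for p q
    unfolding basis_fun_mult[OF that] by (auto simp: basis_fun_def)
  then have inner: "(\<Oplus>\<^bsub>mat_alg r\<^esub>q\<in>Q. (basis_fun p \<otimes>\<^bsub>twisted_group_alg Q \<alpha>\<^esub> basis_fun q) s \<cdot>\<^sub>m (F p * H q))
      = msum r (\<lambda>q. (if p + q = s then \<alpha> p q else 0) \<cdot>\<^sub>m (F p * H q)) Q" if "p \<in> Q" for p
    using that by (subst finsum_mat_alg[OF _ c]) (auto intro!: msum_cong simp del: if_distrib)
  have "(F \<otimes>\<^bsub>twisted_mat_alg Q \<alpha> r\<^esub> H) s = (\<Oplus>\<^bsub>mat_alg r\<^esub>p\<in>Q. \<Oplus>\<^bsub>mat_alg r\<^esub>q\<in>Q.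
      (basis_fun p \<otimes>\<^bsub>twisted_group_alg Q \<alpha>\<^esub> basis_fun q) s \<cdot>\<^sub>m (F p * H q))"
    by (simp add: tensor_alg_def module_mat_simps)
  also have "\<dots> = msum r (\<lambda>p. (\<Oplus>\<^bsub>mat_alg r\<^esub>q\<in>Q.
      (basis_fun p \<otimes>\<^bsub>twisted_group_alg Q \<alpha>\<^esub> basis_fun q) s \<cdot>\<^sub>m (F p * H q))) Q"
    by (rule finsum_mat_alg) (auto simp: inner)
  finally show ?thesis by (simp add: inner cong: msum_cong)
qed

lemma twisted_mult_index:
  assumes F: "F \<in> carrier (twisted_mat_alg Q \<alpha> r)" and H: "H \<in> carrier (twisted_mat_alg Q \<alpha> r)"
    and ij: "i < r" "j < r"
  shows "(F \<otimes>\<^bsub>twisted_mat_alg Q \<alpha> r\<^esub> H) s $$ (i, j) =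
    (\<Sum>p\<in>Q. \<Sum>q\<in>Q. if p + q = s then \<alpha> p q * (\<Sum>k<r. F p $$ (i, k) * H q $$ (k, j)) else 0)"
proof -
  have e: "((if p + q = s then \<alpha> p q else 0) \<cdot>\<^sub>m (F p * H q)) $$ (i, j)
      = (if p + q = s then \<alpha> p q * (\<Sum>k<r. F p $$ (i, k) * H q $$ (k, j)) else 0)" for p q
    using mat_mult_index[OF twisted_carrierD[OF F, of p] twisted_carrierD[OF H, of q] ij] ij
      twisted_carrierD[OF F, of p] twisted_carrierD[OF H, of q] by auto
  show ?thesis unfolding twisted_mult_msum[OF F H] using ij by (simp add: e)
qed

lemma twisted_mult_carrier:
  assumes Q: "add_subgroup Q"
    and F: "F \<in> carrier (twisted_mat_alg Q \<alpha> r)" and H: "H \<in> carrier (twisted_mat_alg Q \<alpha> r)"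
  shows "(F \<otimes>\<^bsub>twisted_mat_alg Q \<alpha> r\<^esub> H) \<in> carrier (twisted_mat_alg Q \<alpha> r)"
proof -
  have c: "(F \<otimes>\<^bsub>twisted_mat_alg Q \<alpha> r\<^esub> H) s \<in> carrier_mat r r" for s
    unfolding twisted_mult_msum[OF F H] by simp
  moreover have "(F \<otimes>\<^bsub>twisted_mat_alg Q \<alpha> r\<^esub> H) s = 0\<^sub>m r r" if s: "s \<notin> Q" for s
  proof (rule mat_eqI[OF c])
    fix i j assume ij: "i < r" "j < r"
    have "p + q \<noteq> s" if "p \<in> Q" "q \<in> Q" for p q using Q that s by (auto simp: add_subgroup_def)
    then show "(F \<otimes>\<^bsub>twisted_mat_alg Q \<alpha> r\<^esub> H) s $$ (i, j) = 0\<^sub>m r r $$ (i, j)"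
      unfolding twisted_mult_index[OF F H ij] using ij by (auto intro!: sum.neutral)
  qed simp
  ultimately show ?thesis by (simp add: twisted_carrier)
qed

lemma twisted_module:
  fixes \<alpha> :: "'g::{ab_group_add,finite} \<Rightarrow> 'g \<Rightarrow> 'k::field"
  shows "Module.module class_ring (twisted_mat_alg Q \<alpha> r)"
proof (rule moduleI)
  let ?T = "twisted_mat_alg Q \<alpha> r"
  note s = twisted_carrier twisted_simps
  show "cring (class_ring :: 'k ring)" by (rule class_cring.is_cring)
  show "abelian_group ?T"
  proof (rule abelian_groupI)
    fix x assume x: "x \<in> carrier ?T"
    show "\<exists>y\<in>carrier ?T. y \<oplus>\<^bsub>?T\<^esub> x = \<zero>\<^bsub>?T\<^esub>"
      using x twisted_carrierD[OF x]
      by (intro bexI[of _ "\<lambda>s. - x s"]) (auto simp: s intro!: uminus_l_inv_mat)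
  next
    fix x y assume x: "x \<in> carrier ?T" and y: "y \<in> carrier ?T"
    show "x \<oplus>\<^bsub>?T\<^esub> y \<in> carrier ?T" using x y by (auto simp: s)
    show "x \<oplus>\<^bsub>?T\<^esub> y = y \<oplus>\<^bsub>?T\<^esub> x"
      using twisted_carrierD[OF x] twisted_carrierD[OF y] by (auto simp: s intro!: comm_add_mat)
    fix z assume z: "z \<in> carrier ?T"
    show "x \<oplus>\<^bsub>?T\<^esub> y \<oplus>\<^bsub>?T\<^esub> z = x \<oplus>\<^bsub>?T\<^esub> (y \<oplus>\<^bsub>?T\<^esub> z)"
      using twisted_carrierD[OF x] twisted_carrierD[OF y] twisted_carrierD[OF z]
      by (auto simp: s intro!: assoc_add_mat)
  next
    show "\<zero>\<^bsub>?T\<^esub> \<in> carrier ?T" by (auto simp: s)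
  next
    fix x assume x: "x \<in> carrier ?T"
    show "\<zero>\<^bsub>?T\<^esub> \<oplus>\<^bsub>?T\<^esub> x = x" using twisted_carrierD[OF x] by (auto simp: s intro!: left_add_zero_mat)
  qed
  fix a b :: 'k and x assume x: "x \<in> carrier ?T"
  note xc = twisted_carrierD[OF x]
  show "a \<odot>\<^bsub>?T\<^esub> x \<in> carrier ?T" using x by (auto simp: s intro!: eq_matI)
  show "(a \<oplus>\<^bsub>class_ring\<^esub> b) \<odot>\<^bsub>?T\<^esub> x = a \<odot>\<^bsub>?T\<^esub> x \<oplus>\<^bsub>?T\<^esub> b \<odot>\<^bsub>?T\<^esub> x"
    using add_smult_distrib_right_mat[OF xc] by (auto simp: s)
  show "(a \<otimes>\<^bsub>class_ring\<^esub> b) \<odot>\<^bsub>?T\<^esub> x = a \<odot>\<^bsub>?T\<^esub> (b \<odot>\<^bsub>?T\<^esub> x)"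
    by (auto simp: s smult_smult_mat)
  show "\<one>\<^bsub>class_ring\<^esub> \<odot>\<^bsub>?T\<^esub> x = x"
    by (auto simp: s intro!: eq_matI)
  fix y assume y: "y \<in> carrier ?T"
  show "a \<odot>\<^bsub>?T\<^esub> (x \<oplus>\<^bsub>?T\<^esub> y) = a \<odot>\<^bsub>?T\<^esub> x \<oplus>\<^bsub>?T\<^esub> a \<odot>\<^bsub>?T\<^esub> y"
    using add_smult_distrib_left_mat[OF xc twisted_carrierD[OF y]] by (auto simp: s)
qed

lemma mat_module: "Module.module class_ring (mat_alg r :: ('k::field, 'k mat) module)"
  by (rule vectorspace.axioms(1)[OF matrix_vs])

lemma submodule_finsum:
  assumes "Module.module R M" "submodule R N M" "finite S" "\<And>s. s \<in> S \<Longrightarrow> f s \<in> N"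
  shows "finsum M f S \<in> N"
proof -
  interpret Module.module R M by fact
  show ?thesis using assms(3,4)
  proof (induction S)
    case empty
    then show ?case using submodule.zero_closed[OF assms(2)] by simp
  next
    case (insert x S)
    then have "f \<in> insert x S \<rightarrow> carrier M" using submodule.subset[OF assms(2)] by blast
    then show ?case using insert submodule.m_closed[OF assms(2)] by (subst finsum_insert) auto
  qed
qed

text \<open>
  The summands may be indexed by any finite set and may repeat elements of S, unlike those of the
  linear combinations in the definition of the span.
\<close>

lemma span_eqI:
  assumes M: "Module.module R M" and N: "submodule R N M" and S: "S \<subseteq> N"
    and gen: "\<And>x. x \<in> N \<Longrightarrow> \<exists>I f. finite I \<and> (\<forall>i\<in>I. \<exists>c\<in>carrier R. \<exists>s\<in>S. f i = c \<odot>\<^bsub>M\<^esub> s) \<and> x = finsum M f (I :: 'i set)"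
  shows "LinearCombinations.module.span R M S = N"
proof
  show "LinearCombinations.module.span R M S \<subseteq> N" by (rule module.span_is_subset[OF M S N])
  have Sc: "S \<subseteq> carrier M" using S submodule.subset[OF N] by blast
  have sp: "submodule R (LinearCombinations.module.span R M S) M" by (rule module.span_is_submodule[OF M Sc])
  show "N \<subseteq> LinearCombinations.module.span R M S"
  proof
    fix x assume "x \<in> N"
    then obtain I :: "'i set" and f where I: "finite I" "\<forall>i\<in>I. \<exists>c\<in>carrier R. \<exists>s\<in>S. f i = c \<odot>\<^bsub>M\<^esub> s" "x = finsum M f I"
      using gen by blast
    have "f i \<in> LinearCombinations.module.span R M S" if "i \<in> I" for i
      using I(2) that submodule.smult_closed[OF sp] module.in_own_span[OF M Sc] by fastforce
    then show "x \<in> LinearCombinations.module.span R M S" unfolding I(3) by (rule submodule_finsum[OF M sp I(1)])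
  qed
qed

lemma finsum_twisted:
  assumes "finite S" "\<And>x. x \<in> S \<Longrightarrow> f x \<in> carrier (twisted_mat_alg Q \<alpha> r)"
  shows "finsum (twisted_mat_alg Q \<alpha> r) f S = (\<lambda>q. msum r (\<lambda>x. f x q) S)"
proof -
  interpret T: Module.module class_ring "twisted_mat_alg Q \<alpha> r" by (rule twisted_module)
  show ?thesis using assms
  proof (induction S)
    case empty
    show ?case by (auto simp: twisted_simps intro!: eq_matI)
  next
    case (insert x S)
    have "(\<lambda>q. f x q + msum r (\<lambda>x. f x q) S) = (\<lambda>q. msum r (\<lambda>x. f x q) (insert x S))"
    proof
      fix q
      have "f x q \<in> carrier_mat r r" using insert.prems[of x] twisted_carrierD by blast
      then show "f x q + msum r (\<lambda>x. f x q) S = msum r (\<lambda>x. f x q) (insert x S)"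
        using insert.hyps by (intro mat_eqI[of _ r r]) auto
    qed
    then show ?case using insert by (subst T.finsum_insert) (auto simp: twisted_simps)
  qed
qed

lemma pure_tensor_unit_carrier:
  "h \<in> Q \<Longrightarrow> pure_tensor (mat_alg r) (basis_fun h) (A :: 'k::field mat) \<in> carrier (twisted_mat_alg Q \<alpha> r)" if "A \<in> carrier_mat r r"
  using that by (auto simp: twisted_carrier pure_tensor_def module_mat_simps basis_fun_def intro!: eq_matI)

text \<open>
  The generators are part of the basis X_h \<otimes> e_ij of the whole algebra, so that membership in their
  span is a condition on the support.
\<close>

lemma twisted_mat_grading_eq:
  fixes \<alpha> :: "'g::{ab_group_add,finite} \<Rightarrow> 'g \<Rightarrow> 'k::field"
  shows "twisted_mat_grading Q \<alpha> gs g = {F \<in> carrier (twisted_mat_alg Q \<alpha> (length gs)).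
     \<forall>h\<in>Q. \<forall>i<length gs. \<forall>j<length gs. F h $$ (i, j) \<noteq> 0 \<longrightarrow> g = - (gs ! j) + h + gs ! i}"
  (is "_ = ?N")
proof -
  let ?r = "length gs"
  let ?T = "twisted_mat_alg Q \<alpha> (length gs)"
  let ?p = "\<lambda>h i j. pure_tensor (mat_alg ?r) (basis_fun h) (mat_unit ?r i j :: 'k mat)"
  let ?S = "{?p h i j | h i j. h \<in> Q \<and> i < ?r \<and> j < ?r \<and> g = - (gs ! j) + h + gs ! i}"
  have pix: "?p h i j q $$ (a, b) = (if q = h \<and> a = i \<and> b = j then 1 else 0)" if "a < ?r" "b < ?r" for h i j q a b
    using that by (simp add: pure_tensor_def module_mat_simps basis_fun_def mat_unit_index mat_unit_def)
  have pc: "h \<in> Q \<Longrightarrow> ?p h i j \<in> carrier ?T" for h i j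
    by (rule pure_tensor_unit_carrier) auto
  have "LinearCombinations.module.span class_ring ?T ?S = ?N"
  proof (rule span_eqI[OF twisted_module])
    interpret T: Module.module class_ring ?T by (rule twisted_module)
    show "submodule class_ring ?N ?T"
    proof (unfold_locales)
      fix v w assume "v \<in> ?N" "w \<in> ?N"
      then have vw: "v \<in> carrier ?T" "w \<in> carrier ?T"
        "\<forall>h\<in>Q. \<forall>i<?r. \<forall>j<?r. v h $$ (i, j) \<noteq> 0 \<longrightarrow> g = - (gs ! j) + h + gs ! i"
        "\<forall>h\<in>Q. \<forall>i<?r. \<forall>j<?r. w h $$ (i, j) \<noteq> 0 \<longrightarrow> g = - (gs ! j) + h + gs ! i" by auto
      have "(v h + w h) $$ (i, j) = v h $$ (i, j) + w h $$ (i, j)" if "i < ?r" "j < ?r" for h i j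
        using that twisted_carrierD[OF vw(1), of h] twisted_carrierD[OF vw(2), of h] by auto
      then show "v \<oplus>\<^bsub>?T\<^esub> w \<in> ?N" using vw T.a_closed[OF vw(1,2)] by (fastforce simp: twisted_simps)
    next
      fix c v assume "v \<in> ?N"
      then have v: "v \<in> carrier ?T"
        "\<forall>h\<in>Q. \<forall>i<?r. \<forall>j<?r. v h $$ (i, j) \<noteq> 0 \<longrightarrow> g = - (gs ! j) + h + gs ! i" by auto
      have "(c \<cdot>\<^sub>m v h) $$ (i, j) = c * v h $$ (i, j)" if "i < ?r" "j < ?r" for h i j
        using that twisted_carrierD[OF v(1), of h] by auto
      then show "c \<odot>\<^bsub>?T\<^esub> v \<in> ?N" using v T.smult_closed[OF _ v(1), of c] by (auto simp: twisted_simps)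
    next
      show "\<zero>\<^bsub>?T\<^esub> \<in> ?N" using T.zero_closed by (auto simp: twisted_simps)
    qed auto
    show "?S \<subseteq> ?N"
    proof
      fix x assume "x \<in> ?S"
      then obtain h i j where x: "x = ?p h i j" "h \<in> Q" "g = - (gs ! j) + h + gs ! i" by blast
      have "q = h \<and> a = i \<and> b = j" if "a < ?r" "b < ?r" "x q $$ (a, b) \<noteq> 0" for q a b
        using pix[OF that(1,2), of h i j q] that(3) unfolding x(1) by (simp split: if_splits)
      then show "x \<in> ?N" using pc[OF x(2), of i j] x by blast
    qed
    fix F assume F: "F \<in> ?N"
    then have Fc: "F \<in> carrier ?T" by simp
    define I where "I = {(h, i, j). h \<in> Q \<and> i < ?r \<and> j < ?r \<and> F h $$ (i, j) \<noteq> 0}"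
    have "I \<subseteq> Q \<times> {..<?r} \<times> {..<?r}" by (auto simp: I_def)
    then have fin: "finite I" by (rule finite_subset) auto
    define f where "f = (\<lambda>(h, i, j). F h $$ (i, j) \<odot>\<^bsub>?T\<^esub> ?p h i j)"
    have fc: "f x \<in> carrier ?T" if "x \<in> I" for x
      using that pc T.smult_closed unfolding f_def I_def by (auto simp: class_ring_simps)
    have ft: "finsum ?T f I = (\<lambda>q. msum ?r (\<lambda>x. f x q) I)"
      using fin fc by (rule finsum_twisted)
    have "F = finsum ?T f I"
    proof (rule twisted_eqI[OF Fc])
      show "finsum ?T f I \<in> carrier ?T" using fc by (intro T.finsum_closed) auto
      fix q a b assume qab: "q \<in> Q" "a < ?r" "b < ?r"
      have "finsum ?T f I q $$ (a, b) = (\<Sum>x\<in>I. f x q $$ (a, b))"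
        using qab by (simp add: ft)
      also have "\<dots> = (\<Sum>x\<in>I. if x = (q, a, b) then F q $$ (a, b) else 0)"
      proof (intro sum.cong refl)
        fix x assume "x \<in> I"
        then obtain h i j where x: "x = (h, i, j)" "h \<in> Q" by (auto simp: I_def)
        have "f x q $$ (a, b) = F h $$ (i, j) * ?p h i j q $$ (a, b)"
          using qab twisted_carrierD[OF pc[OF x(2), of i j], of q] by (simp add: f_def x twisted_simps)
        then show "f x q $$ (a, b) = (if x = (q, a, b) then F q $$ (a, b) else 0)"
          unfolding pix[OF qab(2,3)] by (auto simp: x)
      qed
      also have "\<dots> = F q $$ (a, b)" using fin qab by (auto simp: I_def)
      finally show "F q $$ (a, b) = finsum ?T f I q $$ (a, b)" by simp
    qed
    moreover have "\<forall>x\<in>I. \<exists>c\<in>carrier class_ring. \<exists>s\<in>?S. f x = c \<odot>\<^bsub>?T\<^esub> s"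
    proof
      fix x assume "x \<in> I"
      then obtain h i j where x: "x = (h, i, j)" "h \<in> Q" "i < ?r" "j < ?r" "F h $$ (i, j) \<noteq> 0"
        by (auto simp: I_def)
      then have "g = - (gs ! j) + h + gs ! i" using F by blast
      then have "?p h i j \<in> ?S" using x by blast
      moreover have "f x = F h $$ (i, j) \<odot>\<^bsub>?T\<^esub> ?p h i j" by (simp add: f_def x)
      ultimately show "\<exists>c\<in>carrier class_ring. \<exists>s\<in>?S. f x = c \<odot>\<^bsub>?T\<^esub> s"
        by (intro bexI[of _ "F h $$ (i, j)"] bexI[of _ "?p h i j"]) (simp_all add: class_ring_simps)
    qed
    ultimately show "\<exists>I f. finite I \<and> (\<forall>x\<in>I. \<exists>c\<in>carrier class_ring. \<exists>s\<in>?S. f x = c \<odot>\<^bsub>?T\<^esub> s) \<and>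
        F = finsum ?T f (I :: ('g \<times> nat \<times> nat) set)"
      using fin by (intro exI[of _ I] exI[of _ f] conjI)
  qed
  then show ?thesis unfolding twisted_mat_grading_def kspan_def Let_def .
qed

lemma elementary_grading_eq:
  "elementary_grading gs g = {A \<in> carrier_mat (length gs) (length gs).
     \<forall>i<length gs. \<forall>j<length gs. (A :: 'k::field mat) $$ (i, j) \<noteq> 0 \<longrightarrow> gs ! j - gs ! i = g}"
  (is "_ = ?N")
proof -
  let ?r = "length gs"
  let ?T = "mat_alg ?r :: ('k, 'k mat) module"
  let ?S = "{mat_unit ?r i j | i j. i < ?r \<and> j < ?r \<and> gs ! j - gs ! i = g} :: 'k mat set"
  have "LinearCombinations.module.span class_ring ?T ?S = ?N"
  proof (rule span_eqI[OF mat_module])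
    interpret T: Module.module class_ring ?T by (rule mat_module)
    show "submodule class_ring ?N ?T"
    proof (unfold_locales)
      fix v w assume "v \<in> ?N" "w \<in> ?N"
      then have vw: "v \<in> carrier_mat ?r ?r" "w \<in> carrier_mat ?r ?r"
        "\<forall>i<?r. \<forall>j<?r. v $$ (i, j) \<noteq> 0 \<longrightarrow> gs ! j - gs ! i = g"
        "\<forall>i<?r. \<forall>j<?r. w $$ (i, j) \<noteq> 0 \<longrightarrow> gs ! j - gs ! i = g" by blast+
      have k: "gs ! j - gs ! i = g" if "i < ?r" "j < ?r" "(v + w) $$ (i, j) \<noteq> 0" for i j
      proof -
        have "v $$ (i, j) \<noteq> 0 \<or> w $$ (i, j) \<noteq> 0" using that vw(1,2) by auto
        then show ?thesis using vw(3,4) that(1,2) by blast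
      qed
      have "v + w \<in> carrier_mat ?r ?r" using vw(1,2) by simp
      then have "v + w \<in> ?N" by (intro CollectI conjI allI impI k)
      then show "v \<oplus>\<^bsub>?T\<^esub> w \<in> ?N" unfolding module_mat_simps .
    next
      fix c v assume "v \<in> ?N"
      then have v: "v \<in> carrier_mat ?r ?r"
        "\<forall>i<?r. \<forall>j<?r. v $$ (i, j) \<noteq> 0 \<longrightarrow> gs ! j - gs ! i = g" by blast+
      have k: "gs ! j - gs ! i = g" if "i < ?r" "j < ?r" "(c \<cdot>\<^sub>m v) $$ (i, j) \<noteq> 0" for i j
      proof -
        have "v $$ (i, j) \<noteq> 0" using that v(1) by auto
        then show ?thesis using v(2) that(1,2) by blast
      qed
      have "c \<cdot>\<^sub>m v \<in> carrier_mat ?r ?r" using v(1) by simp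
      then have "c \<cdot>\<^sub>m v \<in> ?N" by (intro CollectI conjI allI impI k)
      then show "c \<odot>\<^bsub>?T\<^esub> v \<in> ?N" unfolding module_mat_simps .
    next
      show "\<zero>\<^bsub>?T\<^esub> \<in> ?N" by (simp add: module_mat_simps)
      show "?N \<subseteq> carrier ?T" by (simp add: module_mat_simps subset_iff)
    qed
    show "?S \<subseteq> ?N"
    proof
      fix x :: "'k mat" assume "x \<in> ?S"
      then obtain i j where x: "x = mat_unit ?r i j" "gs ! j - gs ! i = g" by blast
      have ab: "a = i \<and> b = j" if "a < ?r" "b < ?r" "x $$ (a, b) \<noteq> 0" for a b
        using that unfolding x(1) mat_unit_index[OF that(1,2)] by (simp split: if_splits)
      have "x \<in> carrier_mat ?r ?r" by (simp add: x)
      moreover have "gs ! b - gs ! a = g" if "a < ?r" "b < ?r" "x $$ (a, b) \<noteq> 0" for a b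
        using ab[OF that] x(2) by simp
      ultimately show "x \<in> ?N" by (intro CollectI conjI allI impI)
    qed
    fix F assume F: "F \<in> ?N"
    then have Fc: "F \<in> carrier_mat ?r ?r" by simp
    define I where "I = {(i, j). i < ?r \<and> j < ?r \<and> F $$ (i, j) \<noteq> 0}"
    have "I \<subseteq> {..<?r} \<times> {..<?r}" by (auto simp: I_def)
    then have fin: "finite I" by (rule finite_subset) auto
    define f where "f = (\<lambda>(i, j). F $$ (i, j) \<cdot>\<^sub>m mat_unit ?r i j)"
    have fc: "f x \<in> carrier_mat ?r ?r" for x by (cases x) (simp add: f_def)
    have ft: "finsum ?T f I = msum ?r f I" using fin fc by (rule finsum_mat_alg)
    have "F = finsum ?T f I"
      unfolding ft
    proof (rule mat_eqI[OF Fc])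
      fix a b assume qab: "a < ?r" "b < ?r"
      have fx: "f (i, j) $$ (a, b) = (if a = i \<and> b = j then F $$ (i, j) else 0)" for i j
        using qab by (simp add: f_def mat_unit_def)
      have "(\<Sum>x\<in>I. f x $$ (a, b)) = (\<Sum>x\<in>I. if x = (a, b) then F $$ (a, b) else 0)"
        by (intro sum.cong refl) (clarsimp simp: fx split: if_splits)
      also have "\<dots> = F $$ (a, b)" using fin qab by (auto simp: I_def)
      finally show "F $$ (a, b) = msum ?r f I $$ (a, b)" using qab by simp
    qed simp
    moreover have "\<forall>x\<in>I. \<exists>c\<in>carrier class_ring. \<exists>s\<in>?S. f x = c \<odot>\<^bsub>?T\<^esub> s"
    proof
      fix x assume "x \<in> I"
      then obtain i j where x: "x = (i, j)" "i < ?r" "j < ?r" "F $$ (i, j) \<noteq> 0"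
        by (auto simp: I_def)
      then have "gs ! j - gs ! i = g" using F by blast
      then have "mat_unit ?r i j \<in> ?S" using x by blast
      moreover have "f x = F $$ (i, j) \<odot>\<^bsub>?T\<^esub> mat_unit ?r i j" by (simp add: f_def x module_mat_simps)
      ultimately show "\<exists>c\<in>carrier class_ring. \<exists>s\<in>?S. f x = c \<odot>\<^bsub>?T\<^esub> s"
        by (intro bexI[of _ "F $$ (i, j)"] bexI[of _ "mat_unit ?r i j"]) (simp_all add: class_ring_simps)
    qed
    ultimately show "\<exists>I f. finite I \<and> (\<forall>x\<in>I. \<exists>c\<in>carrier class_ring. \<exists>s\<in>?S. f x = c \<odot>\<^bsub>?T\<^esub> s) \<and>
        F = finsum ?T f (I :: (nat \<times> nat) set)"
      using fin by (intro exI[of _ I] exI[of _ f] conjI)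
  qed
  then show ?thesis unfolding elementary_grading_def kspan_def Let_def .
qed

lemma mult_carrier_square [simp, intro]:
  "a \<in> carrier_mat n n \<Longrightarrow> b \<in> carrier_mat n n \<Longrightarrow> a * b \<in> carrier_mat n n"
  by (rule mult_carrier_mat)

lemma smult_index:
  "A \<in> carrier_mat n m \<Longrightarrow> i < n \<Longrightarrow> j < m \<Longrightarrow> (c \<cdot>\<^sub>m A) $$ (i, j) = c * A $$ (i, j)"
  by auto

lemma zero_smult_mat: "A \<in> carrier_mat n m \<Longrightarrow> 0 \<cdot>\<^sub>m A = (0\<^sub>m n m :: 'k::field mat)"
  by (intro eq_matI) auto

lemma sandwich_msum:
  assumes "A \<in> carrier_mat n n" "B \<in> carrier_mat n n" "\<And>s. s \<in> S \<Longrightarrow> f s \<in> carrier_mat n n"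
  shows "A * msum n f S * B = msum n (\<lambda>s. A * f s * B) S"
  using assms by (subst mult_msum) (auto intro!: msum_mult)

context graded_corner begin

text \<open>
  One nonzero element in each degree of the support is a basis of e A e, because the components are
  lines (\<open>D_line\<close>).
\<close>

definition Q :: "'g set" where "Q = {q. \<exists>d\<in>D q. d \<noteq> 0\<^sub>m n n}"

definition X :: "'g \<Rightarrow> 'k mat" where "X q = (SOME d. d \<in> D q \<and> d \<noteq> 0\<^sub>m n n)"

lemma X: assumes "q \<in> Q" shows "X q \<in> D q" "X q \<noteq> 0\<^sub>m n n"
proof -
  have "\<exists>d. d \<in> D q \<and> d \<noteq> 0\<^sub>m n n" using assms by (auto simp: Q_def)
  then have "X q \<in> D q \<and> X q \<noteq> 0\<^sub>m n n" unfolding X_def by (rule someI_ex)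
  then show "X q \<in> D q" "X q \<noteq> 0\<^sub>m n n" by auto
qed

lemma Q_subgroup: "add_subgroup Q"
  unfolding add_subgroup_def
proof (intro conjI ballI)
  show "0 \<in> Q" using e_D e_nz by (auto simp: Q_def)
  fix p q assume p: "p \<in> Q" and q: "q \<in> Q"
  show "p + q \<in> Q" using D_mult[OF X(1)[OF p] X(1)[OF q]] D_no_zero_divisors[OF X[OF p] X[OF q]] by (auto simp: Q_def)
next
  fix q assume q: "q \<in> Q"
  obtain d where d: "d \<in> D (- q)" "X q * d = e" using D_inverse[OF X[OF q]] by blast
  then have "d \<noteq> 0\<^sub>m n n" using e_nz D_carrier[OF X(1)[OF q]] by auto
  then show "- q \<in> Q" using d by (auto simp: Q_def)
qed

lemma Q_add: "p \<in> Q \<Longrightarrow> q \<in> Q \<Longrightarrow> p + q \<in> Q" and Q_zero: "0 \<in> Q"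
  using Q_subgroup by (auto simp: add_subgroup_def)

text \<open>
  If y is the inverse of X q, then d y has degree 0 and is a multiple of e.
\<close>

lemma D_line:
  assumes d: "d \<in> D q" and q: "q \<in> Q" shows "\<exists>c. d = c \<cdot>\<^sub>m X q"
proof -
  note Xc = D_carrier[OF X(1)[OF q]] and dc = D_carrier[OF d]
  obtain y where y: "y \<in> D (- q)" "y * X q = e" using D_inverse[OF X[OF q]] by blast
  have "d * y \<in> D 0" using D_mult[OF d y(1)] by simp
  then obtain c where c: "d * y = c \<cdot>\<^sub>m e" using D_neutral by blast
  have "d = d * (y * X q)" using D_right[OF d] y by simp
  also have "\<dots> = d * y * X q" using assoc[OF dc D_carrier[OF y(1)] Xc] by simp
  also have "\<dots> = c \<cdot>\<^sub>m X q" unfolding c using ec Xc D_left[OF X(1)[OF q]] by (simp add: mult_smult_assoc_mat[of _ n n _ n])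
  finally show ?thesis by blast
qed

definition coef :: "'g \<Rightarrow> 'k mat \<Rightarrow> 'k" where "coef q d = (SOME c. d = c \<cdot>\<^sub>m X q)"

lemma coef: "d \<in> D q \<Longrightarrow> q \<in> Q \<Longrightarrow> d = coef q d \<cdot>\<^sub>m X q"
  unfolding coef_def using D_line[of d q] by (rule someI_ex)

lemma coef_unique: "q \<in> Q \<Longrightarrow> coef q (c \<cdot>\<^sub>m X q) = c"
  using coef[OF D_smult[OF X(1)]] mat_smult_left_cancel[OF D_carrier[OF X(1)] X(2)] by metis

definition cocycle :: "'g \<Rightarrow> 'g \<Rightarrow> 'k" where "cocycle p q = coef (p + q) (X p * X q)"

lemma X_mult: "p \<in> Q \<Longrightarrow> q \<in> Q \<Longrightarrow> X p * X q = cocycle p q \<cdot>\<^sub>m X (p + q)"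
  unfolding cocycle_def by (rule coef) (auto intro: D_mult X Q_add)

lemma cocycle: "two_cocycle Q cocycle"
  unfolding two_cocycle_def
proof (intro conjI ballI)
  fix p q assume pq: "p \<in> Q" "q \<in> Q"
  have "cocycle p q \<cdot>\<^sub>m X (p + q) \<noteq> 0\<^sub>m n n"
    using D_no_zero_divisors[OF X[OF pq(1)] X[OF pq(2)]] X_mult[OF pq] by simp
  then show "cocycle p q \<noteq> 0" using D_carrier[OF X(1)[OF Q_add[OF pq]]] by (auto simp: smult_zero_iff_mat)
  fix s assume s: "s \<in> Q"
  note c = D_carrier[OF X(1)]
  have "X p * X q * X s = (cocycle p q * cocycle (p + q) s) \<cdot>\<^sub>m X (p + q + s)"
    using pq s Q_add c[OF pq(1)] c[OF s] c[OF Q_add[OF pq]]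
    by (simp add: X_mult mult_smult_assoc_mat[of _ n n _ n] smult_smult_mat)
  moreover have "X p * (X q * X s) = (cocycle q s * cocycle p (q + s)) \<cdot>\<^sub>m X (p + (q + s))"
    using pq s Q_add c[OF pq(1)] c[OF s] c[OF Q_add[OF pq(2) s]]
    by (simp add: X_mult mult_smult_distrib[of _ n n _ n] smult_smult_mat)
  ultimately have eq: "(cocycle p q * cocycle (p + q) s) \<cdot>\<^sub>m X (p + q + s) = (cocycle q s * cocycle p (q + s)) \<cdot>\<^sub>m X (p + q + s)"
    using assoc[OF c[OF pq(1)] c[OF pq(2)] c[OF s]] by (simp add: add.assoc)
  have "p + q + s \<in> Q" using pq s Q_add by blast
  then show "cocycle p q * cocycle (p + q) s = cocycle q s * cocycle p (q + s)"
    using mat_smult_left_cancel[OF c X(2) eq] by blast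
qed

text \<open>
  The cocycle is not normalised: X 0 is the multiple \<alpha>(0, 0) e of the unit of the corner.
\<close>

lemma e_X: "e = inverse (cocycle 0 0) \<cdot>\<^sub>m X 0"
proof -
  obtain c where c: "X 0 = c \<cdot>\<^sub>m e" using D_neutral X(1)[OF Q_zero] by blast
  have nz: "c \<noteq> 0" using X(2)[OF Q_zero] ec unfolding c by (auto simp: smult_zero_iff_mat)
  have "(c * c) \<cdot>\<^sub>m e = (cocycle 0 0 * c) \<cdot>\<^sub>m e"
    using X_mult[OF Q_zero Q_zero] ec ee unfolding c
    by (simp add: c mult_smult_assoc_mat[of _ n n _ n] mult_smult_distrib[of _ n n _ n] smult_smult_mat)
  then have "c * c = cocycle 0 0 * c" using mat_smult_left_cancel[OF ec e_nz] by blast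
  then have "cocycle 0 0 = c" using nz by simp
  then show ?thesis using nz unfolding c by (simp add: smult_smult_mat)
qed

section \<open>A complete system of orthogonal idempotents\<close>

text \<open>
  The products v i * w i are orthogonal idempotents of degree 0, each isomorphic to e up to a shift of
  degrees by \<gamma> i.
\<close>

definition system :: "nat \<Rightarrow> (nat \<Rightarrow> 'g) \<Rightarrow> (nat \<Rightarrow> 'k mat) \<Rightarrow> (nat \<Rightarrow> 'k mat) \<Rightarrow> bool" where
  "system r \<gamma> v w \<longleftrightarrow> (\<forall>i<r. v i \<in> \<Gamma> (\<gamma> i) \<and> w i \<in> \<Gamma> (- \<gamma> i) \<and> v i * e = v i \<and> e * w i = w i) \<and>
     (\<forall>i<r. \<forall>j<r. w i * v j = (if i = j then e else 0\<^sub>m n n))"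

abbreviation covered :: "nat \<Rightarrow> (nat \<Rightarrow> 'k mat) \<Rightarrow> (nat \<Rightarrow> 'k mat) \<Rightarrow> 'k mat" where
  "covered r v w \<equiv> msum n (\<lambda>i. v i * w i) {..<r}"

text \<open>
  Let f = 1 - \<Sum>_i v_i w_i be nonzero.  Graded primeness gives homogeneous b in e A f and c' with
  b c' e \<noteq> 0; as this product is invertible in the corner, correcting c' by the inverse yields a in
  f A e with b a = e.  The kernel of f - a b contains that of f and, in addition, the image of a.
\<close>

lemma system_extend:
  assumes s: "system r \<gamma> v w" and nz: "1\<^sub>m n - covered r v w \<noteq> 0\<^sub>m n n"
  shows "\<exists>g a b. system (Suc r) (\<gamma>(r := g)) (v(r := a)) (w(r := b)) \<and>
     mat_kernel (1\<^sub>m n - covered r v w) \<subset> mat_kernel (1\<^sub>m n - covered (Suc r) (v(r := a)) (w(r := b)))"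
proof -
  define f where "f = 1\<^sub>m n - covered r v w"
  have v_degree: "v i \<in> \<Gamma> (\<gamma> i)" and w_degree: "w i \<in> \<Gamma> (- \<gamma> i)" and ve: "v i * e = v i" and ew: "e * w i = w i" if "i < r" for i
    using s that by (auto simp: system_def)
  have wv: "w i * v j = (if i = j then e else 0\<^sub>m n n)" if "i < r" "j < r" for i j
    using s that by (auto simp: system_def)
  have vc: "v i \<in> carrier_mat n n" and wc: "w i \<in> carrier_mat n n" if "i < r" for i
    using v_degree w_degree carrier that by blast+
  have complete: "covered r v w \<in> \<Gamma> 0"
  proof (rule msum)
    fix i assume "i \<in> {..<r}"
    then show "v i * w i \<in> \<Gamma> 0" using mult[OF v_degree w_degree, of i i] by simp
  qed simp
  have f: "f \<in> \<Gamma> 0" unfolding f_def by (rule diff[OF one complete])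
  note fc = carrier[OF f]
  have sel: "msum n (\<lambda>i. if i = j then A else 0\<^sub>m n n) {..<r} = A" if "j < r" "A \<in> carrier_mat n n" for j and A :: "'k mat"
  proof (rule mat_eqI[of _ n n])
    fix a b assume ab: "a < n" "b < n"
    have "(\<Sum>i<r. (if i = j then A else 0\<^sub>m n n) $$ (a, b)) = (\<Sum>i<r. if i = j then A $$ (a, b) else 0)"
      using ab by (intro sum.cong) auto
    then show "msum n (\<lambda>i. if i = j then A else 0\<^sub>m n n) {..<r} $$ (a, b) = A $$ (a, b)"
      using ab that by simp
  qed (use that in auto)
  have fv: "f * v j = 0\<^sub>m n n" if j: "j < r" for j
  proof -
    have "covered r v w * v j = msum n (\<lambda>i. v i * w i * v j) {..<r}"
      using vc wc j by (intro msum_mult) auto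
    also have "\<dots> = msum n (\<lambda>i. if i = j then v j else 0\<^sub>m n n) {..<r}"
    proof (intro msum_cong refl)
      fix i assume "i \<in> {..<r}"
      then have i: "i < r" by simp
      show "v i * w i * v j = (if i = j then v j else 0\<^sub>m n n)"
        using assoc[OF vc[OF i] wc[OF i] vc[OF j]] wv[OF i j] ve[OF i] vc[OF i] by auto
    qed
    also have "\<dots> = v j" using sel vc j by simp
    finally show ?thesis unfolding f_def using vc[OF j] by (simp add: minus_mult_distrib_mat[of _ n n _ _ n])
  qed
  have wf: "w j * f = 0\<^sub>m n n" if j: "j < r" for j
  proof -
    have "w j * covered r v w = msum n (\<lambda>i. w j * (v i * w i)) {..<r}"
      using vc wc j by (intro mult_msum) auto
    also have "\<dots> = msum n (\<lambda>i. if i = j then w j else 0\<^sub>m n n) {..<r}"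
    proof (intro msum_cong refl)
      fix i assume "i \<in> {..<r}"
      then have i: "i < r" by simp
      have "w j * (v i * w i) = w j * v i * w i" using assoc[OF wc[OF j] vc[OF i] wc[OF i]] by simp
      then show "w j * (v i * w i) = (if i = j then w j else 0\<^sub>m n n)"
        using wv[OF j i] ew[OF j] wc[OF i] by auto
    qed
    also have "\<dots> = w j" using sel wc j by simp
    finally show ?thesis unfolding f_def using wc[OF j] by (simp add: mult_minus_distrib_mat[of _ n n _ n])
  qed
  have ff: "f * f = f"
  proof -
    have "f * covered r v w = msum n (\<lambda>i. f * (v i * w i)) {..<r}"
      using vc wc fc by (intro mult_msum) auto
    also have "\<dots> = msum n (\<lambda>i. 0\<^sub>m n n) {..<r}"
    proof (intro msum_cong refl)
      fix i assume "i \<in> {..<r}"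
      then have i: "i < r" by simp
      show "f * (v i * w i) = 0\<^sub>m n n" using assoc[OF fc vc[OF i] wc[OF i]] fv[OF i] wc[OF i] by simp
    qed
    also have "\<dots> = 0\<^sub>m n n" by (auto intro!: mat_eqI)
    finally have z: "f * covered r v w = 0\<^sub>m n n" .
    have "f * (1\<^sub>m n - covered r v w) = f * 1\<^sub>m n - f * covered r v w"
      by (rule mult_minus_distrib_mat[OF fc one_carrier_mat msum_carrier])
    then have "f * f = f * 1\<^sub>m n - f * covered r v w" unfolding f_def[symmetric] .
    moreover have "f - 0\<^sub>m n n = f" using fc by (intro eq_matI) auto
    ultimately show ?thesis using z fc by simp
  qed
  have fnz: "f \<noteq> 0\<^sub>m n n" using nz by (simp add: f_def)
  obtain t c where c: "c \<in> \<Gamma> t" "e * c * f \<noteq> 0\<^sub>m n n" using graded_prime[OF e e_nz f fnz] by blast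
  note cc = carrier[OF c(1)]
  define b where "b = e * c * f"
  have bG: "b \<in> \<Gamma> t" using mult[OF mult[OF e c(1)] f] by (simp add: b_def)
  note bc = carrier[OF bG]
  obtain t' c' where c': "c' \<in> \<Gamma> t'" "b * c' * e \<noteq> 0\<^sub>m n n"
    using graded_prime[OF bG _ e e_nz] c(2) unfolding b_def by blast
  note c'c = carrier[OF c'(1)]
  have bf: "b * f = b" unfolding b_def using assoc[OF mult_carrier_mat[OF ec cc] fc fc] ff by simp
  have eb: "e * b = b" unfolding b_def
    using assoc[OF ec mult_carrier_mat[OF ec cc] fc] assoc[OF ec ec cc] ee by simp
  define d where "d = b * c' * e"
  have dG: "d \<in> \<Gamma> (t + t')" using mult[OF mult[OF bG c'(1)] e] by (simp add: d_def)
  have d: "d \<in> D (t + t')"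
    using dG assoc[OF ec mult_carrier_mat[OF bc c'c] ec] assoc[OF ec bc c'c] eb
      assoc[OF mult_carrier_mat[OF bc c'c] ec ec] ee by (simp add: D_def d_def)
  obtain d' where d': "d' \<in> D (- (t + t'))" "d * d' = e"
    using D_inverse[OF d] c'(2) unfolding d_def by blast
  note d'c = D_carrier[OF d'(1)]
  define a where "a = f * (c' * d')"
  have aG: "a \<in> \<Gamma> (- t)" using mult[OF f mult[OF c'(1) D_Gamma[OF d'(1)]]] by (simp add: a_def)
  note ac = carrier[OF aG]
  have c'd': "c' * d' \<in> carrier_mat n n" using c'c d'c by simp
  have ba: "b * a = e"
  proof -
    have "b * a = b * (c' * d')" unfolding a_def using assoc[OF bc fc c'd'] bf by simp
    also have "\<dots> = b * (c' * (e * d'))" using D_left[OF d'(1)] by simp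
    also have "\<dots> = b * (c' * e * d')" using assoc[OF c'c ec d'c] by simp
    also have "\<dots> = b * (c' * e) * d'" using assoc[OF bc mult_carrier_mat[OF c'c ec] d'c] by simp
    also have "\<dots> = d * d'" unfolding d_def using assoc[OF bc c'c ec] by simp
    finally show ?thesis using d' by simp
  qed
  have ae: "a * e = a" unfolding a_def
    using assoc[OF fc c'd' ec] assoc[OF c'c d'c ec] D_right[OF d'(1)] by simp
  have fa: "f * a = a" unfolding a_def using assoc[OF fc fc c'd'] ff by simp
  have wa: "w j * a = 0\<^sub>m n n" if "j < r" for j
    unfolding a_def using assoc[OF wc[OF that] fc c'd'] wf[OF that] left_mult_zero_mat[OF c'd', of n] by simp
  have bv: "b * v j = 0\<^sub>m n n" if "j < r" for j
    using assoc[OF bc fc vc[OF that]] bf fv[OF that] bc by simp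
  let ?v = "v(r := a)" and ?w = "w(r := b)"
  have sys: "system (Suc r) (\<gamma>(r := - t)) ?v ?w"
    unfolding system_def
  proof (intro conjI allI impI)
    fix i assume "i < Suc r"
    then show "?v i \<in> \<Gamma> ((\<gamma>(r := - t)) i)" "?w i \<in> \<Gamma> (- (\<gamma>(r := - t)) i)"
      "?v i * e = ?v i" "e * ?w i = ?w i"
      using v_degree w_degree ve ew aG bG ae eb by auto
    fix j assume "j < Suc r"
    then show "?w i * ?v j = (if i = j then e else 0\<^sub>m n n)"
      using \<open>i < Suc r\<close> wv wa bv ba by (auto simp: less_Suc_eq)
  qed
  have f': "1\<^sub>m n - covered (Suc r) ?v ?w = f - a * b"
  proof (rule mat_eqI[of _ n n])
    fix i j assume ij: "i < n" "j < n"
    have "(\<Sum>k<Suc r. (?v k * ?w k) $$ (i, j)) = (\<Sum>k<r. (v k * w k) $$ (i, j)) + (a * b) $$ (i, j)"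
      by simp
    then show "(1\<^sub>m n - covered (Suc r) ?v ?w) $$ (i, j) = (f - a * b) $$ (i, j)"
      unfolding f_def using ij ac bc by (simp add: algebra_simps)
  qed (use ac bc in \<open>auto simp: f_def\<close>)
  have abc: "a * b \<in> carrier_mat n n" using ac bc by simp
  have "(1\<^sub>m n - a * b) * f = f - a * b"
    using assoc[OF ac bc fc] bf fc abc by (simp add: minus_mult_distrib_mat[of _ n n _ _ n])
  then have sub: "mat_kernel f \<subseteq> mat_kernel (f - a * b)"
    using mat_kernel_mono[OF minus_carrier_mat[OF abc] fc, of "1\<^sub>m n"] by simp
  have f'a: "(f - a * b) * a = 0\<^sub>m n n"
    using assoc[OF ac bc ac] fa ba ae fc abc ac by (simp add: minus_mult_distrib_mat[of _ n n _ _ n])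
  have "\<not> mat_kernel (f - a * b) \<subseteq> mat_kernel f"
  proof
    assume "mat_kernel (f - a * b) \<subseteq> mat_kernel f"
    then have "f * a = 0\<^sub>m n n" using mult_zero_kernel[OF minus_carrier_mat[OF abc] fc ac f'a] by simp
    then have "a = 0\<^sub>m n n" using fa by simp
    then show False using ba e_nz bc by simp
  qed
  then have "mat_kernel f \<subset> mat_kernel (f - a * b)" using sub by blast
  then have "mat_kernel (1\<^sub>m n - covered r v w) \<subset> mat_kernel (1\<^sub>m n - covered (Suc r) ?v ?w)"
    unfolding f' f_def[symmetric] .
  then show ?thesis using sys by (intro exI[of _ "- t"] exI[of _ a] exI[of _ b] conjI)
qed

text \<open>
  A system whose remainder 1 - \<Sum>_i v_i w_i has maximal kernel cannot be extended, so its remainder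
  vanishes.
\<close>

lemma exists_complete_system: "\<exists>r \<gamma> v w. system r \<gamma> v w \<and> covered r v w = 1\<^sub>m n"
proof -
  define S where "S = {1\<^sub>m n - covered r v w | r \<gamma> v w. system r \<gamma> v w}"
  have "system 0 \<gamma> v w" for \<gamma> v w by (simp add: system_def)
  then have "S \<noteq> {}" unfolding S_def by blast
  moreover have "S \<subseteq> carrier_mat n n" by (auto simp: S_def)
  ultimately obtain f where f: "f \<in> S" "\<forall>b\<in>S. mat_kernel f \<subseteq> mat_kernel b \<longrightarrow> mat_kernel b \<subseteq> mat_kernel f"
    using exists_maximal_kernel by blast
  then obtain r \<gamma> v w where s: "system r \<gamma> v w" "f = 1\<^sub>m n - covered r v w" unfolding S_def by blast
  have "f = 0\<^sub>m n n"
  proof (rule ccontr)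
    assume "f \<noteq> 0\<^sub>m n n"
    then obtain g a b where x: "system (Suc r) (\<gamma>(r := g)) (v(r := a)) (w(r := b))"
      "mat_kernel f \<subset> mat_kernel (1\<^sub>m n - covered (Suc r) (v(r := a)) (w(r := b)))"
      using system_extend[OF s(1)] s(2) by blast
    then have "1\<^sub>m n - covered (Suc r) (v(r := a)) (w(r := b)) \<in> S" unfolding S_def by blast
    then show False using f(2) x(2) by blast
  qed
  then have z: "1\<^sub>m n - covered r v w = 0\<^sub>m n n" using s by simp
  have "covered r v w = 1\<^sub>m n"
  proof (rule mat_eqI[of _ n n])
    fix i j assume "i < n" "j < n"
    then show "covered r v w $$ (i, j) = 1\<^sub>m n $$ (i, j)" using arg_cong[OF z, of "\<lambda>x. x $$ (i, j)"] by simp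
  qed auto
  then show ?thesis using s by blast
qed

end

section \<open>The isomorphism with a twisted matrix algebra\<close>

lemma msum_swap_smult:
  assumes "\<And>q. q \<in> Q \<Longrightarrow> Y q \<in> carrier_mat n n"
  shows "msum n (\<lambda>k. msum n (\<lambda>q. f k q \<cdot>\<^sub>m Y q) Q) S = msum n (\<lambda>q. (\<Sum>k\<in>S. f k q) \<cdot>\<^sub>m (Y q :: 'k::field mat)) Q"
proof (rule mat_eqI[of _ n n])
  fix i j assume ij: "i < n" "j < n"
  have "(\<Sum>k\<in>S. \<Sum>q\<in>Q. (f k q \<cdot>\<^sub>m Y q) $$ (i, j)) = (\<Sum>q\<in>Q. \<Sum>k\<in>S. (f k q \<cdot>\<^sub>m Y q) $$ (i, j))"
    by (rule sum.swap)
  also have "\<dots> = (\<Sum>q\<in>Q. ((\<Sum>k\<in>S. f k q) \<cdot>\<^sub>m Y q) $$ (i, j))"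
  proof (intro sum.cong refl)
    fix q assume "q \<in> Q"
    then have "Y q \<in> carrier_mat n n" by (rule assms)
    then show "(\<Sum>k\<in>S. (f k q \<cdot>\<^sub>m Y q) $$ (i, j)) = ((\<Sum>k\<in>S. f k q) \<cdot>\<^sub>m Y q) $$ (i, j)"
      using ij by (simp add: sum_distrib_right)
  qed
  finally show "msum n (\<lambda>k. msum n (\<lambda>q. f k q \<cdot>\<^sub>m Y q) Q) S $$ (i, j) = msum n (\<lambda>q. (\<Sum>k\<in>S. f k q) \<cdot>\<^sub>m Y q) Q $$ (i, j)"
    using ij by simp
qed auto

locale complete_system = graded_corner n \<Gamma> e
  for n :: nat and \<Gamma> :: "'g::{ab_group_add,finite} \<Rightarrow> 'k::alg_closed_field mat set" and e :: "'k mat" +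
  fixes r :: nat and \<gamma> :: "nat \<Rightarrow> 'g" and v w :: "nat \<Rightarrow> 'k mat"
  assumes sys: "system r \<gamma> v w" and complete: "msum n (\<lambda>i. v i * w i) {..<r} = 1\<^sub>m n"
begin

lemma v_degree: "i < r \<Longrightarrow> v i \<in> \<Gamma> (\<gamma> i)" and w_degree: "i < r \<Longrightarrow> w i \<in> \<Gamma> (- \<gamma> i)"
  and ve: "i < r \<Longrightarrow> v i * e = v i" and ew: "i < r \<Longrightarrow> e * w i = w i"
  and wv: "i < r \<Longrightarrow> j < r \<Longrightarrow> w i * v j = (if i = j then e else 0\<^sub>m n n)"
  using sys by (auto simp: system_def)

lemma vc [simp]: "i < r \<Longrightarrow> v i \<in> carrier_mat n n" and wc [simp]: "i < r \<Longrightarrow> w i \<in> carrier_mat n n"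
  using v_degree w_degree carrier by blast+

lemma Xc [simp]: "q \<in> Q \<Longrightarrow> X q \<in> carrier_mat n n"
  using D_carrier X by blast

lemma r_pos: "1 \<le> r"
proof (rule ccontr)
  assume "\<not> 1 \<le> r"
  then have "r = 0" by simp
  then have "msum n (\<lambda>i. v i * w i) {..<r} = 0\<^sub>m n n" by (auto intro!: mat_eqI)
  then have "1\<^sub>m n = (0\<^sub>m n n :: 'k mat)" using complete by simp
  then show False using n_pos by (metis index_one_mat(1) index_zero_mat(1) zero_neq_one)
qed

text \<open>
  The block w_i a v_j of a matrix a lies in e A e; its expansion in the X_q gives the entries (i, j)
  of the image of a in the tensor product.
\<close>

definition block :: "nat \<Rightarrow> nat \<Rightarrow> 'k mat \<Rightarrow> 'k mat" where "block i j a = w i * a * v j"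

lemma block_carrier: "i < r \<Longrightarrow> j < r \<Longrightarrow> a \<in> carrier_mat n n \<Longrightarrow> block i j a \<in> carrier_mat n n"
  by (simp add: block_def)

lemma block_corner:
  assumes "i < r" "j < r" "a \<in> carrier_mat n n"
  shows "e * block i j a = block i j a" "block i j a * e = block i j a"
proof -
  note c = wc[OF assms(1)] vc[OF assms(2)]
  show "e * block i j a = block i j a"
    using assoc[OF ec mult_carrier_square[OF c(1) assms(3)] c(2)] assoc[OF ec c(1) assms(3)] ew[OF assms(1)]
    by (simp add: block_def)
  show "block i j a * e = block i j a"
    using assoc[OF mult_carrier_square[OF c(1) assms(3)] c(2) ec] ve[OF assms(2)] by (simp add: block_def)
qed

lemma component_corner:
  assumes "a \<in> carrier_mat n n" "e * a = a" "a * e = a" shows "component a q \<in> D q"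
  using component_mult_left[OF e assms(1), of q] component_mult_right[OF e assms(1), of q] component(1)[OF assms(1), of q] assms
  by (simp add: D_def)

definition entry :: "'k mat \<Rightarrow> 'g \<Rightarrow> nat \<Rightarrow> nat \<Rightarrow> 'k" where
  "entry a q i j = coef q (component (block i j a) q)"

lemma block_expand:
  assumes "i < r" "j < r" "a \<in> carrier_mat n n"
  shows "block i j a = msum n (\<lambda>q. entry a q i j \<cdot>\<^sub>m X q) Q"
proof -
  let ?b = "block i j a"
  note bc = block_carrier[OF assms]
  have cD: "component ?b q \<in> D q" for q using component_corner[OF bc] block_corner[OF assms] by blast
  have out: "component ?b q = 0\<^sub>m n n" if "q \<notin> Q" for q using cD[of q] that unfolding Q_def by blast
  have "?b = msum n (component ?b) UNIV" by (rule component(2)[OF bc])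
  also have "\<dots> = msum n (component ?b) Q"
  proof (rule mat_eqI[of _ n n])
    fix a b assume ab: "a < n" "b < n"
    have "(\<Sum>s\<in>UNIV. component ?b s $$ (a, b)) = (\<Sum>s\<in>Q. component ?b s $$ (a, b))"
      using out ab by (intro sum.mono_neutral_right) auto
    then show "msum n (component ?b) UNIV $$ (a, b) = msum n (component ?b) Q $$ (a, b)" using ab by simp
  qed auto
  also have "\<dots> = msum n (\<lambda>q. entry a q i j \<cdot>\<^sub>m X q) Q"
    using coef[OF cD] by (intro msum_cong) (auto simp: entry_def)
  finally show ?thesis .
qed

lemma entry_unique:
  assumes "block i j a = msum n (\<lambda>q. F q \<cdot>\<^sub>m X q) Q" and q: "q \<in> Q"
  shows "entry a q i j = F q"
proof -
  have "component (block i j a) = (\<lambda>q. if q \<in> Q then F q \<cdot>\<^sub>m X q else 0\<^sub>m n n)"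
  proof (rule component_unique)
    show "(if q \<in> Q then F q \<cdot>\<^sub>m X q else 0\<^sub>m n n) \<in> \<Gamma> q" for q
      using D_Gamma[OF X(1)] smult zero by auto
    show "block i j a = msum n (\<lambda>q. if q \<in> Q then F q \<cdot>\<^sub>m X q else 0\<^sub>m n n) UNIV"
      unfolding assms(1)
    proof (rule mat_eqI[of _ n n])
      fix a b assume ab: "a < n" "b < n"
      have "(\<Sum>s\<in>Q. (F s \<cdot>\<^sub>m X s) $$ (a, b)) = (\<Sum>s\<in>UNIV. (if s \<in> Q then F s \<cdot>\<^sub>m X s else 0\<^sub>m n n) $$ (a, b))"
        using ab by (intro sum.mono_neutral_cong_left) auto
      then show "msum n (\<lambda>q. F q \<cdot>\<^sub>m X q) Q $$ (a, b) = msum n (\<lambda>q. if q \<in> Q then F q \<cdot>\<^sub>m X q else 0\<^sub>m n n) UNIV $$ (a, b)"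
        using ab by simp
    qed auto
  qed
  then show ?thesis using q coef_unique by (simp add: entry_def)
qed

lemma matrix_from_blocks:
  assumes a: "a \<in> carrier_mat n n"
  shows "a = msum n (\<lambda>i. msum n (\<lambda>j. v i * block i j a * w j) {..<r}) {..<r}"
proof -
  have "a = 1\<^sub>m n * a" using a by simp
  also have "\<dots> = msum n (\<lambda>i. v i * w i * a) {..<r}"
    unfolding complete[symmetric] using a by (intro msum_mult) auto
  also have "\<dots> = msum n (\<lambda>i. msum n (\<lambda>j. v i * block i j a * w j) {..<r}) {..<r}"
  proof (intro msum_cong refl)
    fix i assume "i \<in> {..<r}"
    then have i: "i < r" by simp
    note c = vc[OF i] wc[OF i]
    have "v i * w i * a = v i * w i * a * 1\<^sub>m n" using a c by simp
    also have "\<dots> = msum n (\<lambda>j. v i * w i * a * (v j * w j)) {..<r}"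
      unfolding complete[symmetric] using a c by (intro mult_msum) auto
    also have "\<dots> = msum n (\<lambda>j. v i * block i j a * w j) {..<r}"
    proof (intro msum_cong refl)
      fix j assume "j \<in> {..<r}"
      then have j: "j < r" by simp
      have "v i * w i * a * (v j * w j) = v i * w i * a * v j * w j"
        using assoc[of "v i * w i * a" "v j" "w j"] a c j by simp
      also have "v i * w i * a * v j = v i * block i j a"
        unfolding block_def using assoc[OF c a] assoc[of "v i" "w i * a" "v j"] a c j by simp
      finally show "v i * w i * a * (v j * w j) = v i * block i j a * w j" .
    qed
    finally show "v i * w i * a = msum n (\<lambda>j. v i * block i j a * w j) {..<r}" .
  qed
  finally show ?thesis .
qed

lemma entry_add:
  assumes "a \<in> carrier_mat n n" "b \<in> carrier_mat n n" "i < r" "j < r" "q \<in> Q"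
  shows "entry (a + b) q i j = entry a q i j + entry b q i j"
proof (rule entry_unique[OF _ assms(5)])
  have "block i j (a + b) = block i j a + block i j b"
    unfolding block_def using assms
    by (simp add: mult_add_distrib_mat[of _ n n _ n] add_mult_distrib_mat[of _ n n _ _ n])
  also have "\<dots> = msum n (\<lambda>q. (entry a q i j + entry b q i j) \<cdot>\<^sub>m X q) Q"
    unfolding block_expand[OF assms(3,4,1)] block_expand[OF assms(3,4,2)]
  proof (rule mat_eqI[of _ n n])
    fix x y assume xy: "x < n" "y < n"
    have "((entry a q i j + entry b q i j) \<cdot>\<^sub>m X q) $$ (x, y) = (entry a q i j \<cdot>\<^sub>m X q) $$ (x, y) + (entry b q i j \<cdot>\<^sub>m X q) $$ (x, y)"
      if "q \<in> Q" for q using Xc[OF that] xy by (simp add: algebra_simps)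
    then show "(msum n (\<lambda>q. entry a q i j \<cdot>\<^sub>m X q) Q + msum n (\<lambda>q. entry b q i j \<cdot>\<^sub>m X q) Q) $$ (x, y)
      = msum n (\<lambda>q. (entry a q i j + entry b q i j) \<cdot>\<^sub>m X q) Q $$ (x, y)"
      using xy by (simp add: sum.distrib)
  qed auto
  finally show "block i j (a + b) = msum n (\<lambda>q. (entry a q i j + entry b q i j) \<cdot>\<^sub>m X q) Q" .
qed

lemma entry_smult:
  assumes "a \<in> carrier_mat n n" "i < r" "j < r" "q \<in> Q"
  shows "entry (c \<cdot>\<^sub>m a) q i j = c * entry a q i j"
proof (rule entry_unique[OF _ assms(4)])
  have "block i j (c \<cdot>\<^sub>m a) = c \<cdot>\<^sub>m block i j a"
    unfolding block_def using assms
    by (simp add: mult_smult_distrib[of _ n n _ n] mult_smult_assoc_mat[of _ n n _ n])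
  also have "\<dots> = msum n (\<lambda>q. (c * entry a q i j) \<cdot>\<^sub>m X q) Q"
    unfolding block_expand[OF assms(2,3,1)]
  proof (rule mat_eqI[of _ n n])
    fix x y assume xy: "x < n" "y < n"
    have "((c * entry a q i j) \<cdot>\<^sub>m X q) $$ (x, y) = c * (entry a q i j \<cdot>\<^sub>m X q) $$ (x, y)"
      if "q \<in> Q" for q using Xc[OF that] xy by (simp add: algebra_simps)
    then show "(c \<cdot>\<^sub>m msum n (\<lambda>q. entry a q i j \<cdot>\<^sub>m X q) Q) $$ (x, y) = msum n (\<lambda>q. (c * entry a q i j) \<cdot>\<^sub>m X q) Q $$ (x, y)"
      using xy by (simp add: sum_distrib_left)
  qed auto
  finally show "block i j (c \<cdot>\<^sub>m a) = msum n (\<lambda>q. (c * entry a q i j) \<cdot>\<^sub>m X q) Q" .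
qed

lemma entry_one:
  assumes "i < r" "j < r" "q \<in> Q"
  shows "entry (1\<^sub>m n) q i j = (if q = 0 \<and> i = j then inverse (cocycle 0 0) else 0)"
proof (rule entry_unique[OF _ assms(3)])
  have "block i j (1\<^sub>m n) = (if i = j then e else 0\<^sub>m n n)"
    unfolding block_def right_mult_one_mat[OF wc[OF assms(1)]] by (rule wv[OF assms(1,2)])
  also have "\<dots> = msum n (\<lambda>q. (if q = 0 \<and> i = j then inverse (cocycle 0 0) else 0) \<cdot>\<^sub>m X q) Q"
  proof (rule mat_eqI[of _ n n])
    fix x y assume xy: "x < n" "y < n"
    have "(\<Sum>q\<in>Q. ((if q = 0 \<and> i = j then inverse (cocycle 0 0) else 0) \<cdot>\<^sub>m X q) $$ (x, y))
      = (\<Sum>q\<in>Q. if q = 0 then (if i = j then e $$ (x, y) else 0) else 0)"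
    proof (intro sum.cong refl)
      fix q assume q: "q \<in> Q"
      show "((if q = 0 \<and> i = j then inverse (cocycle 0 0) else 0) \<cdot>\<^sub>m X q) $$ (x, y) = (if q = 0 then (if i = j then e $$ (x, y) else 0) else 0)"
        using smult_index[OF Xc[OF q] xy] arg_cong[OF e_X, of "\<lambda>A. A $$ (x, y)"] by auto
    qed
    then show "(if i = j then e else 0\<^sub>m n n) $$ (x, y) = msum n (\<lambda>q. (if q = 0 \<and> i = j then inverse (cocycle 0 0) else 0) \<cdot>\<^sub>m X q) Q $$ (x, y)"
      using xy Q_zero by simp
  qed (use ec in auto)
  finally show "block i j (1\<^sub>m n) = msum n (\<lambda>q. (if q = 0 \<and> i = j then inverse (cocycle 0 0) else 0) \<cdot>\<^sub>m X q) Q" .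
qed

text \<open>
  Insert 1 = \<Sum>_k v_k w_k between the factors.
\<close>

lemma block_mult:
  assumes a: "a \<in> carrier_mat n n" and b: "b \<in> carrier_mat n n" and ij: "i < r" "j < r"
  shows "block i j (a * b) = msum n (\<lambda>k. block i k a * block k j b) {..<r}"
proof -
  note c = wc[OF ij(1)] vc[OF ij(2)]
  have "block i j (a * b) = w i * a * 1\<^sub>m n * (b * v j)"
    unfolding block_def using assoc[of "w i" "a * b" "v j"] assoc[of a b "v j"] assoc[of "w i" a "b * v j"] a b c by simp
  also have "w i * a * 1\<^sub>m n = msum n (\<lambda>k. w i * a * (v k * w k)) {..<r}"
    unfolding complete[symmetric] using a c by (intro mult_msum) auto
  also have "\<dots> * (b * v j) = msum n (\<lambda>k. w i * a * (v k * w k) * (b * v j)) {..<r}"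
    using a b c by (intro msum_mult) auto
  also have "\<dots> = msum n (\<lambda>k. block i k a * block k j b) {..<r}"
  proof (intro msum_cong refl)
    fix k assume "k \<in> {..<r}"
    then have k: "v k \<in> carrier_mat n n" "w k \<in> carrier_mat n n" by auto
    have "w i * a * (v k * w k) = block i k a * w k"
      unfolding block_def using assoc[of "w i * a" "v k" "w k"] a c k by simp
    then show "w i * a * (v k * w k) * (b * v j) = block i k a * block k j b"
      unfolding block_def using assoc[of "w i * a * v k" "w k" "b * v j"] assoc[of "w k" b "v j"] a b c k by simp
  qed
  finally show ?thesis .
qed

lemma X_expansion_mult:
  "msum n (\<lambda>p. f p \<cdot>\<^sub>m X p) Q * msum n (\<lambda>q. h q \<cdot>\<^sub>m X q) Q
    = msum n (\<lambda>s. (\<Sum>p\<in>Q. \<Sum>q\<in>Q. if p + q = s then cocycle p q * (f p * h q) else 0) \<cdot>\<^sub>m X s) Q"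
proof -
  let ?H = "msum n (\<lambda>q. h q \<cdot>\<^sub>m X q) Q"
  have "msum n (\<lambda>p. f p \<cdot>\<^sub>m X p) Q * ?H = msum n (\<lambda>p. (f p \<cdot>\<^sub>m X p) * ?H) Q"
    by (rule msum_mult) auto
  also have "\<dots> = msum n (\<lambda>p. msum n (\<lambda>s. (\<Sum>q\<in>Q. if p + q = s then cocycle p q * (f p * h q) else 0) \<cdot>\<^sub>m X s) Q) Q"
  proof (intro msum_cong refl)
    fix p assume p: "p \<in> Q"
    have "(f p \<cdot>\<^sub>m X p) * ?H = msum n (\<lambda>q. (f p \<cdot>\<^sub>m X p) * (h q \<cdot>\<^sub>m X q)) Q"
      using p by (intro mult_msum) auto
    also have "\<dots> = msum n (\<lambda>q. msum n (\<lambda>s. (if p + q = s then cocycle p q * (f p * h q) else 0) \<cdot>\<^sub>m X s) Q) Q"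
    proof (intro msum_cong refl)
      fix q assume q: "q \<in> Q"
      have pq: "p + q \<in> Q" using Q_add p q by blast
      have "(f p \<cdot>\<^sub>m X p) * (h q \<cdot>\<^sub>m X q) = (cocycle p q * (f p * h q)) \<cdot>\<^sub>m X (p + q)"
        using p q by (simp add: mult_smult_assoc_mat[of _ n n _ n] mult_smult_distrib[of _ n n _ n] X_mult smult_smult_mat mult_ac)
      also have "\<dots> = msum n (\<lambda>s. (if p + q = s then cocycle p q * (f p * h q) else 0) \<cdot>\<^sub>m X s) Q"
      proof (rule mat_eqI[of _ n n])
        fix x y assume xy: "x < n" "y < n"
        have "(\<Sum>s\<in>Q. ((if p + q = s then cocycle p q * (f p * h q) else 0) \<cdot>\<^sub>m X s) $$ (x, y))
          = (\<Sum>s\<in>Q. if s = p + q then cocycle p q * (f p * h q) * X (p + q) $$ (x, y) else 0)"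
        proof (intro sum.cong refl)
          fix s assume "s \<in> Q"
          from Xc[OF this] show "((if p + q = s then cocycle p q * (f p * h q) else 0) \<cdot>\<^sub>m X s) $$ (x, y)
            = (if s = p + q then cocycle p q * (f p * h q) * X (p + q) $$ (x, y) else 0)"
            using xy by auto
        qed
        also have "\<dots> = ((cocycle p q * (f p * h q)) \<cdot>\<^sub>m X (p + q)) $$ (x, y)"
          using pq unfolding smult_index[OF Xc[OF pq] xy] by simp
        finally show "((cocycle p q * (f p * h q)) \<cdot>\<^sub>m X (p + q)) $$ (x, y) = msum n (\<lambda>s. (if p + q = s then cocycle p q * (f p * h q) else 0) \<cdot>\<^sub>m X s) Q $$ (x, y)"
          using xy by simp
      qed (use pq in auto)
      finally show "(f p \<cdot>\<^sub>m X p) * (h q \<cdot>\<^sub>m X q) = msum n (\<lambda>s. (if p + q = s then cocycle p q * (f p * h q) else 0) \<cdot>\<^sub>m X s) Q" .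
    qed
    also have "\<dots> = msum n (\<lambda>s. (\<Sum>q\<in>Q. if p + q = s then cocycle p q * (f p * h q) else 0) \<cdot>\<^sub>m X s) Q"
      by (rule msum_swap_smult) auto
    finally show "(f p \<cdot>\<^sub>m X p) * ?H = msum n (\<lambda>s. (\<Sum>q\<in>Q. if p + q = s then cocycle p q * (f p * h q) else 0) \<cdot>\<^sub>m X s) Q" .
  qed
  also have "\<dots> = msum n (\<lambda>s. (\<Sum>p\<in>Q. \<Sum>q\<in>Q. if p + q = s then cocycle p q * (f p * h q) else 0) \<cdot>\<^sub>m X s) Q"
    by (rule msum_swap_smult) auto
  finally show ?thesis .
qed

lemma entry_mult:
  assumes a: "a \<in> carrier_mat n n" and b: "b \<in> carrier_mat n n" and ij: "i < r" "j < r" and s: "s \<in> Q"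
  shows "entry (a * b) s i j = (\<Sum>p\<in>Q. \<Sum>q\<in>Q. if p + q = s then cocycle p q * (\<Sum>k<r. entry a p i k * entry b q k j) else 0)"
proof (rule entry_unique[OF _ s])
  have "block i j (a * b) = msum n (\<lambda>k. msum n (\<lambda>s. (\<Sum>p\<in>Q. \<Sum>q\<in>Q. if p + q = s then cocycle p q * (entry a p i k * entry b q k j) else 0) \<cdot>\<^sub>m X s) Q) {..<r}"
    unfolding block_mult[OF a b ij] using a b ij
    by (intro msum_cong refl) (simp add: block_expand X_expansion_mult)
  also have "\<dots> = msum n (\<lambda>s. (\<Sum>k<r. \<Sum>p\<in>Q. \<Sum>q\<in>Q. if p + q = s then cocycle p q * (entry a p i k * entry b q k j) else 0) \<cdot>\<^sub>m X s) Q"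
    by (rule msum_swap_smult) auto
  also have "\<dots> = msum n (\<lambda>s. (\<Sum>p\<in>Q. \<Sum>q\<in>Q. if p + q = s then cocycle p q * (\<Sum>k<r. entry a p i k * entry b q k j) else 0) \<cdot>\<^sub>m X s) Q"
  proof (intro msum_cong refl arg_cong2[where f = "(\<cdot>\<^sub>m)"])
    fix s
    have "(\<Sum>k<r. \<Sum>p\<in>Q. \<Sum>q\<in>Q. if p + q = s then cocycle p q * (entry a p i k * entry b q k j) else 0)
      = (\<Sum>p\<in>Q. \<Sum>k<r. \<Sum>q\<in>Q. if p + q = s then cocycle p q * (entry a p i k * entry b q k j) else 0)"
      by (rule sum.swap)
    also have "\<dots> = (\<Sum>p\<in>Q. \<Sum>q\<in>Q. \<Sum>k<r. if p + q = s then cocycle p q * (entry a p i k * entry b q k j) else 0)"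
      by (intro sum.cong refl sum.swap)
    also have "\<dots> = (\<Sum>p\<in>Q. \<Sum>q\<in>Q. if p + q = s then cocycle p q * (\<Sum>k<r. entry a p i k * entry b q k j) else 0)"
      by (intro sum.cong refl) (simp add: sum_distrib_left)
    finally show "(\<Sum>k<r. \<Sum>p\<in>Q. \<Sum>q\<in>Q. if p + q = s then cocycle p q * (entry a p i k * entry b q k j) else 0)
      = (\<Sum>p\<in>Q. \<Sum>q\<in>Q. if p + q = s then cocycle p q * (\<Sum>k<r. entry a p i k * entry b q k j) else 0)" .
  qed
  finally show "block i j (a * b) = msum n (\<lambda>s. (\<Sum>p\<in>Q. \<Sum>q\<in>Q. if p + q = s then cocycle p q * (\<Sum>k<r. entry a p i k * entry b q k j) else 0) \<cdot>\<^sub>m X s) Q" .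
qed

lemma entry_inj:
  assumes a: "a \<in> carrier_mat n n" and b: "b \<in> carrier_mat n n"
    and eq: "\<And>q i j. q \<in> Q \<Longrightarrow> i < r \<Longrightarrow> j < r \<Longrightarrow> entry a q i j = entry b q i j"
  shows "a = b"
proof -
  have "block i j a = block i j b" if "i < r" "j < r" for i j
    unfolding block_expand[OF that a] block_expand[OF that b] using eq that by (intro msum_cong) auto
  then have "msum n (\<lambda>i. msum n (\<lambda>j. v i * block i j a * w j) {..<r}) {..<r} = msum n (\<lambda>i. msum n (\<lambda>j. v i * block i j b * w j) {..<r}) {..<r}"
    by (intro msum_cong) auto
  then show ?thesis using matrix_from_blocks[OF a] matrix_from_blocks[OF b] by simp
qed

text \<open>
  The inverse map, sending X_q \<otimes> e_ij to v_i X_q w_j.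
\<close>

definition assemble :: "('g \<Rightarrow> nat \<Rightarrow> nat \<Rightarrow> 'k) \<Rightarrow> 'k mat" where
  "assemble F = msum n (\<lambda>i. msum n (\<lambda>j. msum n (\<lambda>q. F q i j \<cdot>\<^sub>m (v i * X q * w j)) Q) {..<r}) {..<r}"

lemma assemble_carrier [simp]: "assemble F \<in> carrier_mat n n"
  by (simp add: assemble_def)

lemma block_assemble:
  assumes kl: "k < r" "l < r"
  shows "block k l (assemble F) = msum n (\<lambda>q. F q k l \<cdot>\<^sub>m X q) Q"
proof -
  note c = wc[OF kl(1)] vc[OF kl(2)]
  have t: "w k * (c \<cdot>\<^sub>m (v i * X q * w j)) * v l = (if i = k \<and> j = l then c \<cdot>\<^sub>m X q else 0\<^sub>m n n)"
    if ij: "i < r" "j < r" and q: "q \<in> Q" for c i j q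
  proof -
    note ic = vc[OF ij(1)] wc[OF ij(2)] Xc[OF q]
    have "w k * (v i * X q * w j) * v l = w k * v i * X q * (w j * v l)"
      using assoc[of "w k" "v i * X q * w j" "v l"] assoc[of "v i * X q" "w j" "v l"]
        assoc[of "v i" "X q" "w j * v l"] assoc[of "w k" "v i" "X q * (w j * v l)"] assoc[of "w k * v i" "X q" "w j * v l"] c ic by simp
    also have "\<dots> = (if i = k \<and> j = l then X q else 0\<^sub>m n n)"
      using wv[OF kl(1) ij(1)] wv[OF ij(2) kl(2)] D_left[OF X(1)[OF q]] D_right[OF X(1)[OF q]] ic ec by auto
    finally have "w k * (v i * X q * w j) * v l = (if i = k \<and> j = l then X q else 0\<^sub>m n n)" .
    moreover have "w k * (c \<cdot>\<^sub>m (v i * X q * w j)) * v l = c \<cdot>\<^sub>m (w k * (v i * X q * w j) * v l)"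
      using c ic by (simp add: mult_smult_assoc_mat[of _ n n _ n] mult_smult_distrib[of _ n n _ n])
    ultimately show ?thesis by (auto intro!: eq_matI)
  qed
  have "block k l (assemble F) = msum n (\<lambda>i. msum n (\<lambda>j. msum n (\<lambda>q. w k * (F q i j \<cdot>\<^sub>m (v i * X q * w j)) * v l) Q) {..<r}) {..<r}"
    unfolding block_def assemble_def sandwich_msum[OF c msum_carrier]
    by (intro msum_cong refl sandwich_msum[OF c]) auto
  also have "\<dots> = msum n (\<lambda>i. msum n (\<lambda>j. msum n (\<lambda>q. (if i = k \<and> j = l then F q k l else 0) \<cdot>\<^sub>m X q) Q) {..<r}) {..<r}"
  proof (intro msum_cong refl)
    fix i j q assume x: "i \<in> {..<r}" "j \<in> {..<r}" "q \<in> Q"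
    then show "w k * (F q i j \<cdot>\<^sub>m (v i * X q * w j)) * v l = (if i = k \<and> j = l then F q k l else 0) \<cdot>\<^sub>m X q"
      using t[of i j q "F q i j"] zero_smult_mat[OF Xc[OF x(3)]] by auto
  qed
  also have "\<dots> = msum n (\<lambda>i. msum n (\<lambda>q. (\<Sum>j<r. if i = k \<and> j = l then F q k l else 0) \<cdot>\<^sub>m X q) Q) {..<r}"
    by (intro msum_cong refl msum_swap_smult) auto
  also have "\<dots> = msum n (\<lambda>q. (\<Sum>i<r. \<Sum>j<r. if i = k \<and> j = l then F q k l else 0) \<cdot>\<^sub>m X q) Q"
    by (intro msum_swap_smult) auto
  also have "\<dots> = msum n (\<lambda>q. F q k l \<cdot>\<^sub>m X q) Q"
  proof (intro msum_cong refl arg_cong2[where f = "(\<cdot>\<^sub>m)"])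
    fix q
    have "(\<Sum>i<r. \<Sum>j<r. if i = k \<and> j = l then F q k l else 0) = (\<Sum>i<r. if i = k then (\<Sum>j<r. if j = l then F q k l else 0) else 0)"
      by (intro sum.cong refl) auto
    then show "(\<Sum>i<r. \<Sum>j<r. if i = k \<and> j = l then F q k l else 0) = F q k l" using kl by simp
  qed
  finally show ?thesis .
qed

lemma entry_assemble: "k < r \<Longrightarrow> l < r \<Longrightarrow> q \<in> Q \<Longrightarrow> entry (assemble F) q k l = F q k l"
  by (rule entry_unique[OF block_assemble])

lemma entry_degree:
  assumes a: "a \<in> \<Gamma> g" and ij: "i < r" "j < r" and q: "q \<in> Q" and nz: "entry a q i j \<noteq> 0"
  shows "g = - \<gamma> j + q + \<gamma> i"
proof -
  have b: "block i j a \<in> \<Gamma> (- \<gamma> i + g + \<gamma> j)"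
    unfolding block_def using mult[OF mult[OF w_degree[OF ij(1)] a] v_degree[OF ij(2)]] .
  have "q = - \<gamma> i + g + \<gamma> j"
  proof (rule ccontr)
    assume "q \<noteq> - \<gamma> i + g + \<gamma> j"
    then have "component (block i j a) q = 0\<^sub>m n n" using component_homogeneous[OF b] by simp
    then have "entry a q i j = coef q (0 \<cdot>\<^sub>m X q)" using Xc[OF q] by (auto simp: entry_def intro!: arg_cong[where f = "coef q"] eq_matI)
    then show False using nz coef_unique[OF q] by simp
  qed
  then show ?thesis by (simp add: algebra_simps)
qed

lemma assemble_degree:
  assumes "\<And>q i j. q \<in> Q \<Longrightarrow> i < r \<Longrightarrow> j < r \<Longrightarrow> F q i j \<noteq> 0 \<Longrightarrow> g = - \<gamma> j + q + \<gamma> i"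
  shows "assemble F \<in> \<Gamma> g"
  unfolding assemble_def
proof (intro msum)
  fix i j q assume x: "i \<in> {..<r}" "j \<in> {..<r}" "q \<in> Q"
  have d: "v i * X q * w j \<in> \<Gamma> (\<gamma> i + q + - \<gamma> j)"
    using mult[OF mult[OF v_degree D_Gamma[OF X(1)]] w_degree] x by auto
  show "F q i j \<cdot>\<^sub>m (v i * X q * w j) \<in> \<Gamma> g"
  proof (cases "F q i j = 0")
    case True
    then have "F q i j \<cdot>\<^sub>m (v i * X q * w j) = 0\<^sub>m n n" using zero_smult_mat[OF carrier[OF d]] by simp
    then show ?thesis using zero by simp
  next
    case False
    then have "g = \<gamma> i + q + - \<gamma> j" using assms[of q i j] x by (simp add: algebra_simps)
    then show ?thesis using smult[OF d] by simp
  qed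
qed auto

definition to_twisted :: "'k mat \<Rightarrow> 'g \<Rightarrow> 'k mat" where
  "to_twisted a q = (if q \<in> Q then mat r r (\<lambda>(i, j). entry a q i j) else 0\<^sub>m r r)"

lemma to_twisted_carrier: "to_twisted a \<in> carrier (twisted_mat_alg Q cocycle r)"
  by (simp add: twisted_carrier to_twisted_def)

lemma to_twisted_index: "q \<in> Q \<Longrightarrow> i < r \<Longrightarrow> j < r \<Longrightarrow> to_twisted a q $$ (i, j) = entry a q i j"
  by (simp add: to_twisted_def)

lemma to_twisted_assemble:
  assumes F: "F \<in> carrier (twisted_mat_alg Q cocycle r)"
  shows "to_twisted (assemble (\<lambda>q i j. F q $$ (i, j))) = F"
  by (rule twisted_eqI[OF to_twisted_carrier F]) (simp add: to_twisted_index entry_assemble)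

lemma to_twisted_isomorphism: "to_twisted \<in> ring_iso (mat_alg n) (twisted_mat_alg Q cocycle r)"
  unfolding ring_iso_def
proof (intro CollectI conjI)
  let ?T = "twisted_mat_alg Q cocycle r"
  interpret T: Module.module class_ring ?T by (rule twisted_module)
  note s = to_twisted_index
  show "to_twisted \<in> Ring.ring_hom (mat_alg n) ?T"
  proof (rule ring_hom_memI)
    fix a b assume "a \<in> Congruence.carrier (mat_alg n :: ('k, 'k mat) module)" "b \<in> Congruence.carrier (mat_alg n :: ('k, 'k mat) module)"
    then have ab: "a \<in> carrier_mat n n" "b \<in> carrier_mat n n" by (auto simp: module_mat_simps)
    show "to_twisted (a \<otimes>\<^bsub>mat_alg n\<^esub> b) = to_twisted a \<otimes>\<^bsub>?T\<^esub> to_twisted b"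
    proof (rule twisted_eqI[OF to_twisted_carrier twisted_mult_carrier[OF Q_subgroup to_twisted_carrier to_twisted_carrier]])
      fix q i j assume x: "q \<in> Q" "i < r" "j < r"
      show "to_twisted (a \<otimes>\<^bsub>mat_alg n\<^esub> b) q $$ (i, j) = (to_twisted a \<otimes>\<^bsub>?T\<^esub> to_twisted b) q $$ (i, j)"
        unfolding twisted_mult_index[OF to_twisted_carrier to_twisted_carrier x(2,3)] module_mat_simps s[OF x] entry_mult[OF ab x(2,3,1)]
        using x by (intro sum.cong refl if_cong arg_cong2[where f = "(*)"]) (simp_all add: s)
    qed
    show "to_twisted (a \<oplus>\<^bsub>mat_alg n\<^esub> b) = to_twisted a \<oplus>\<^bsub>?T\<^esub> to_twisted b"
    proof (rule twisted_eqI[OF to_twisted_carrier T.a_closed[OF to_twisted_carrier to_twisted_carrier]])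
      fix q i j assume x: "q \<in> Q" "i < r" "j < r"
      show "to_twisted (a \<oplus>\<^bsub>mat_alg n\<^esub> b) q $$ (i, j) = (to_twisted a \<oplus>\<^bsub>?T\<^esub> to_twisted b) q $$ (i, j)"
        using x ab by (simp add: twisted_simps module_mat_simps s entry_add to_twisted_def)
    qed
  next
    have "\<one>\<^bsub>?T\<^esub> \<in> carrier ?T" using Q_zero by (auto simp: twisted_simps twisted_carrier basis_fun_def intro!: eq_matI)
    then show "to_twisted \<one>\<^bsub>mat_alg n\<^esub> = \<one>\<^bsub>?T\<^esub>"
    proof (rule twisted_eqI[OF to_twisted_carrier])
      fix q i j assume x: "q \<in> Q" "i < r" "j < r"
      show "to_twisted \<one>\<^bsub>mat_alg n\<^esub> q $$ (i, j) = \<one>\<^bsub>?T\<^esub> q $$ (i, j)"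
        using x by (simp add: twisted_simps module_mat_simps s entry_one basis_fun_def)
    qed
  qed (rule to_twisted_carrier)
  show "bij_betw to_twisted (Congruence.carrier (mat_alg n)) (Congruence.carrier ?T)"
  proof (rule bij_betwI')
    fix a b assume "a \<in> Congruence.carrier (mat_alg n :: ('k, 'k mat) module)" "b \<in> Congruence.carrier (mat_alg n :: ('k, 'k mat) module)"
    then have ab: "a \<in> carrier_mat n n" "b \<in> carrier_mat n n" by (auto simp: module_mat_simps)
    show "to_twisted a = to_twisted b \<longleftrightarrow> a = b" using entry_inj[OF ab] s by metis
  next
    fix F assume "F \<in> Congruence.carrier ?T"
    then show "\<exists>a\<in>Congruence.carrier (mat_alg n). F = to_twisted a"
      using to_twisted_assemble by (intro bexI[of _ "assemble (\<lambda>q i j. F q $$ (i, j))"]) (simp_all add: module_mat_simps)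
  qed (rule to_twisted_carrier)
qed

theorem decomposition: "is_decomposition n \<Gamma> r Q cocycle (map \<gamma> [0..<r])"
  unfolding is_decomposition_def graded_isomorphic_def
proof (intro conjI bexI[OF _ to_twisted_isomorphism] allI ballI)
  let ?T = "twisted_mat_alg Q cocycle r"
  let ?gs = "map \<gamma> [0..<r]"
  interpret T: Module.module class_ring ?T by (rule twisted_module)
  show "1 \<le> r" "add_subgroup Q" "two_cocycle Q cocycle" "length ?gs = r"
    using r_pos Q_subgroup cocycle by auto
  fix c :: 'k and a assume "a \<in> Congruence.carrier (mat_alg n :: ('k, 'k mat) module)"
  then have a: "a \<in> carrier_mat n n" by (auto simp: module_mat_simps)
  have cc: "c \<odot>\<^bsub>?T\<^esub> to_twisted a \<in> carrier ?T" by (rule T.smult_closed[OF _ to_twisted_carrier]) simp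
  show "to_twisted (c \<odot>\<^bsub>mat_alg n\<^esub> a) = c \<odot>\<^bsub>?T\<^esub> to_twisted a"
  proof (rule twisted_eqI[OF to_twisted_carrier cc])
    fix q i j assume x: "q \<in> Q" "i < r" "j < r"
    show "to_twisted (c \<odot>\<^bsub>mat_alg n\<^esub> a) q $$ (i, j) = (c \<odot>\<^bsub>?T\<^esub> to_twisted a) q $$ (i, j)"
      using x a by (simp add: twisted_simps module_mat_simps to_twisted_index entry_smult to_twisted_def)
  qed
next
  let ?T = "twisted_mat_alg Q cocycle r"
  let ?gs = "map \<gamma> [0..<r]"
  fix g
  have gr': "twisted_mat_grading Q cocycle ?gs g = {F \<in> Congruence.carrier ?T.
     \<forall>h\<in>Q. \<forall>i<r. \<forall>j<r. F h $$ (i, j) \<noteq> 0 \<longrightarrow> g = - \<gamma> j + h + \<gamma> i}"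
    unfolding twisted_mat_grading_eq by (auto simp: cong: conj_cong)
  show "to_twisted ` \<Gamma> g = twisted_mat_grading Q cocycle ?gs g"
    unfolding gr'
  proof (intro equalityI subsetI)
    fix F assume "F \<in> to_twisted ` \<Gamma> g"
    then obtain a where a: "a \<in> \<Gamma> g" "F = to_twisted a" by blast
    have "g = - \<gamma> j + q + \<gamma> i" if "q \<in> Q" "i < r" "j < r" "F q $$ (i, j) \<noteq> 0" for q i j
      using entry_degree[OF a(1) that(2,3,1)] that(4) unfolding a(2) to_twisted_index[OF that(1-3)] .
    then show "F \<in> {F \<in> Congruence.carrier ?T. \<forall>h\<in>Q. \<forall>i<r. \<forall>j<r. F h $$ (i, j) \<noteq> 0 \<longrightarrow> g = - \<gamma> j + h + \<gamma> i}"
      using to_twisted_carrier[of a] unfolding a(2) by (intro CollectI conjI ballI allI impI)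
  next
    fix F assume F: "F \<in> {F \<in> Congruence.carrier ?T. \<forall>h\<in>Q. \<forall>i<r. \<forall>j<r. F h $$ (i, j) \<noteq> 0 \<longrightarrow> g = - \<gamma> j + h + \<gamma> i}"
    have "assemble (\<lambda>q i j. F q $$ (i, j)) \<in> \<Gamma> g"
      using F by (intro assemble_degree) blast
    then show "F \<in> to_twisted ` \<Gamma> g" using to_twisted_assemble[of F] F by (metis (no_types, lifting) imageI mem_Collect_eq)
  qed
qed

end

theorem (in graded_matrix_ac) exists_decomposition: "\<exists>r Q \<alpha> gs. is_decomposition n \<Gamma> r Q \<alpha> gs"
proof -
  obtain e where e: "e \<in> \<Gamma> 0" "e \<noteq> 0\<^sub>m n n" "e * e = e" "kernel_maximal e"
    using exists_kernel_maximal_idempotent by blast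
  interpret C: graded_corner n \<Gamma> e by unfold_locales (fact e)+
  obtain r \<gamma> v w where s: "C.system r \<gamma> v w" "C.covered r v w = 1\<^sub>m n" using C.exists_complete_system by blast
  interpret S: complete_system n \<Gamma> e r \<gamma> v w by unfold_locales (fact s)+
  show ?thesis using S.decomposition by blast
qed

section \<open>Evaluation of graded polynomials\<close>

lemma msum_insert:
  assumes "finite S" "x \<notin> S" "f x \<in> carrier_mat n n"
  shows "msum n f (insert x S) = f x + msum n f S"
  using assms by (intro mat_eqI[of _ n n]) auto

lemma msum_trivial: "S = {} \<or> infinite S \<Longrightarrow> msum n f S = 0\<^sub>m n n"
  by (intro mat_eqI[of _ n n]) auto

lemma eval_fmon_carrier [simp]:
  assumes "\<And>x. \<sigma> x \<in> carrier_mat n n"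
  shows "eval_fmon (mat_alg n) \<sigma> w \<in> carrier_mat n n"
proof -
  have "foldr (\<lambda>x a. \<sigma> x * a) xs (1\<^sub>m n) \<in> carrier_mat n n" for xs
    by (induction xs) (auto intro: mult_carrier_mat assms)
  then show ?thesis by (simp add: eval_fmon_def module_mat_simps)
qed

lemma eval_fmon_Nil: "eval_fmon (mat_alg n) \<sigma> (FMon []) = 1\<^sub>m n"
  and eval_fmon_Cons: "eval_fmon (mat_alg n) \<sigma> (FMon (x # xs)) = \<sigma> x * eval_fmon (mat_alg n) \<sigma> (FMon xs)"
  by (simp_all add: eval_fmon_def module_mat_simps)

lemma eval_fmon_append:
  assumes s: "\<And>x. \<sigma> x \<in> carrier_mat n n"
  shows "eval_fmon (mat_alg n) \<sigma> (FMon (xs @ ys)) = eval_fmon (mat_alg n) \<sigma> (FMon xs) * eval_fmon (mat_alg n) \<sigma> (FMon ys)"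
proof (induction xs)
  case Nil
  show ?case using eval_fmon_carrier[of \<sigma>, OF s, of "FMon ys"] by (simp add: eval_fmon_Nil)
next
  case (Cons x xs)
  then show ?case
    using assoc_mult_mat[OF s eval_fmon_carrier[of \<sigma>, OF s] eval_fmon_carrier[of \<sigma>, OF s]] by (simp add: eval_fmon_Cons)
qed

lemma eval_fmon_plus:
  assumes "\<And>x. \<sigma> x \<in> carrier_mat n n"
  shows "eval_fmon (mat_alg n) \<sigma> (v + w) = eval_fmon (mat_alg n) \<sigma> v * eval_fmon (mat_alg n) \<sigma> w"
  using eval_fmon_append[of \<sigma>, OF assms, of "letters v" "letters w"] by (simp add: plus_fmon_def)

lemma eval_poly_msum:
  assumes "\<And>x. \<sigma> x \<in> carrier_mat n n"
  shows "eval_poly (mat_alg n) \<sigma> f = msum n (\<lambda>w. Poly_Mapping.lookup f w \<cdot>\<^sub>m eval_fmon (mat_alg n) \<sigma> w) (Poly_Mapping.keys f)"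
  unfolding eval_poly_def by (subst finsum_mat_alg) (auto simp: module_mat_simps eval_fmon_carrier[of \<sigma>, OF assms])

lemma eval_poly_carrier [simp]:
  assumes "\<And>x. \<sigma> x \<in> carrier_mat n n"
  shows "eval_poly (mat_alg n) \<sigma> f \<in> carrier_mat n n"
  unfolding eval_poly_msum[of \<sigma>, OF assms] by simp

lemma eval_poly_index:
  assumes s: "\<And>x. \<sigma> x \<in> carrier_mat n n" and S: "finite S" "Poly_Mapping.keys f \<subseteq> S" and ij: "i < n" "j < n"
  shows "eval_poly (mat_alg n) \<sigma> f $$ (i, j) = (\<Sum>w\<in>S. Poly_Mapping.lookup f w * eval_fmon (mat_alg n) \<sigma> w $$ (i, j))"
proof -
  have "eval_poly (mat_alg n) \<sigma> f $$ (i, j) = (\<Sum>w\<in>Poly_Mapping.keys f. Poly_Mapping.lookup f w * eval_fmon (mat_alg n) \<sigma> w $$ (i, j))"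
    unfolding eval_poly_msum[of \<sigma>, OF s] using ij by (simp add: smult_index[OF eval_fmon_carrier[of \<sigma>, OF s]])
  also have "\<dots> = (\<Sum>w\<in>S. Poly_Mapping.lookup f w * eval_fmon (mat_alg n) \<sigma> w $$ (i, j))"
    using S by (intro sum.mono_neutral_left) (auto simp: in_keys_iff)
  finally show ?thesis .
qed

lemma eval_poly_add:
  fixes f g :: "('g, 'k::field) gr_poly"
  assumes s: "\<And>x. \<sigma> x \<in> carrier_mat n n"
  shows "eval_poly (mat_alg n) \<sigma> (f + g) = eval_poly (mat_alg n) \<sigma> f + eval_poly (mat_alg n) \<sigma> g"
proof (rule mat_eqI[of _ n n])
  let ?S = "Poly_Mapping.keys f \<union> Poly_Mapping.keys g"
  fix i j assume ij: "i < n" "j < n"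
  have S: "finite ?S" by simp
  let ?e = "\<lambda>w. eval_fmon (mat_alg n) \<sigma> w $$ (i, j)"
  have "eval_poly (mat_alg n) \<sigma> (f + g) $$ (i, j) = (\<Sum>w\<in>?S. Poly_Mapping.lookup (f + g) w * ?e w)"
    by (rule eval_poly_index[of \<sigma>, OF s S keys_add ij])
  also have "\<dots> = (\<Sum>w\<in>?S. Poly_Mapping.lookup f w * ?e w) + (\<Sum>w\<in>?S. Poly_Mapping.lookup g w * ?e w)"
    by (simp only: lookup_add distrib_right sum.distrib)
  also have "\<dots> = eval_poly (mat_alg n) \<sigma> f $$ (i, j) + eval_poly (mat_alg n) \<sigma> g $$ (i, j)"
    unfolding eval_poly_index[of \<sigma>, OF s S Un_upper1 ij] eval_poly_index[of \<sigma>, OF s S Un_upper2 ij] ..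
  also have "\<dots> = (eval_poly (mat_alg n) \<sigma> f + eval_poly (mat_alg n) \<sigma> g) $$ (i, j)"
    using carrier_matD[OF eval_poly_carrier[of \<sigma>, OF s, of g]] ij by simp
  finally show "eval_poly (mat_alg n) \<sigma> (f + g) $$ (i, j) = (eval_poly (mat_alg n) \<sigma> f + eval_poly (mat_alg n) \<sigma> g) $$ (i, j)" .
qed (simp_all add: eval_poly_carrier[of \<sigma>, OF s])

lemma eval_poly_single:
  assumes s: "\<And>x. \<sigma> x \<in> carrier_mat n n"
  shows "eval_poly (mat_alg n) \<sigma> (Poly_Mapping.single w c) = (c :: 'k::field) \<cdot>\<^sub>m eval_fmon (mat_alg n) \<sigma> w"
proof (rule mat_eqI[of _ n n])
  fix i j assume ij: "i < n" "j < n"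
  have "finite {w}" "Poly_Mapping.keys (Poly_Mapping.single w c) \<subseteq> {w}" by auto
  from eval_poly_index[OF s this ij]
  show "eval_poly (mat_alg n) \<sigma> (Poly_Mapping.single w c) $$ (i, j) = (c \<cdot>\<^sub>m eval_fmon (mat_alg n) \<sigma> w) $$ (i, j)"
    using carrier_matD[OF eval_fmon_carrier[of \<sigma>, OF s, of w]] ij by simp
qed (use eval_poly_carrier[of \<sigma>, OF s] eval_fmon_carrier[of \<sigma>, OF s] in auto)

lemma eval_poly_sum:
  fixes F :: "'s \<Rightarrow> ('g, 'k::field) gr_poly"
  assumes s: "\<And>x. \<sigma> x \<in> carrier_mat n n"
  shows "eval_poly (mat_alg n) \<sigma> (\<Sum>x\<in>S. F x) = msum n (\<lambda>x. eval_poly (mat_alg n) \<sigma> (F x)) S"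
proof -
  have z: "eval_poly (mat_alg n) \<sigma> 0 = 0\<^sub>m n n"
    using eval_poly_msum[of \<sigma> n 0, OF s] by (simp add: msum_trivial)
  show ?thesis
  proof (induction S rule: infinite_finite_induct)
    case (insert x S)
    have "msum n (\<lambda>x. eval_poly (mat_alg n) \<sigma> (F x)) (insert x S)
      = eval_poly (mat_alg n) \<sigma> (F x) + msum n (\<lambda>x. eval_poly (mat_alg n) \<sigma> (F x)) S"
      by (rule msum_insert[OF insert.hyps eval_poly_carrier[OF s]])
    then show ?case
      unfolding sum.insert[OF insert.hyps] eval_poly_add[of \<sigma>, OF s] insert.IH by simp
  qed (simp_all add: z msum_trivial)
qed

lemma poly_as_sum: fixes f :: "'a \<Rightarrow>\<^sub>0 'b::comm_monoid_add" shows "f = (\<Sum>w\<in>Poly_Mapping.keys f. Poly_Mapping.single w (Poly_Mapping.lookup f w))"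
proof (rule poly_mapping_eqI)
  fix k
  have 1: "Poly_Mapping.lookup (Poly_Mapping.single w (Poly_Mapping.lookup f w)) k = (if w = k then Poly_Mapping.lookup f k else 0)" for w
    by (simp only: lookup_single when_def) auto
  show "Poly_Mapping.lookup f k = Poly_Mapping.lookup (\<Sum>w\<in>Poly_Mapping.keys f. Poly_Mapping.single w (Poly_Mapping.lookup f w)) k"
    unfolding lookup_sum 1 by (simp add: in_keys_iff)
qed

lemma eval_poly_mult:
  fixes f g :: "('g, 'k::field) gr_poly"
  assumes s: "\<And>x. \<sigma> x \<in> carrier_mat n n"
  shows "eval_poly (mat_alg n) \<sigma> (f * g) = eval_poly (mat_alg n) \<sigma> f * eval_poly (mat_alg n) \<sigma> g"
proof -
  let ?E = "eval_fmon (mat_alg n) \<sigma>"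
  let ?a = "Poly_Mapping.lookup f" and ?b = "Poly_Mapping.lookup g"
  note Ec = eval_fmon_carrier[of \<sigma>, OF s]
  have "f * g = (\<Sum>v\<in>Poly_Mapping.keys f. \<Sum>w\<in>Poly_Mapping.keys g. Poly_Mapping.single (v + w) (?a v * ?b w))"
    using arg_cong2[OF poly_as_sum[of f] poly_as_sum[of g], of "(*)"] unfolding sum_product mult_single .
  then have "eval_poly (mat_alg n) \<sigma> (f * g) = msum n (\<lambda>v. msum n (\<lambda>w. (?a v * ?b w) \<cdot>\<^sub>m (?E v * ?E w)) (Poly_Mapping.keys g)) (Poly_Mapping.keys f)"
    by (simp add: eval_poly_sum[of \<sigma>, OF s] eval_poly_single[of \<sigma>, OF s] eval_fmon_plus[of \<sigma>, OF s])
  also have "\<dots> = msum n (\<lambda>v. (?a v \<cdot>\<^sub>m ?E v) * eval_poly (mat_alg n) \<sigma> g) (Poly_Mapping.keys f)"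
  proof (intro msum_cong refl)
    fix v
    have "(?a v \<cdot>\<^sub>m ?E v) * eval_poly (mat_alg n) \<sigma> g = msum n (\<lambda>w. (?a v \<cdot>\<^sub>m ?E v) * (?b w \<cdot>\<^sub>m ?E w)) (Poly_Mapping.keys g)"
      unfolding eval_poly_msum[of \<sigma>, OF s] by (rule mult_msum) (use Ec in auto)
    moreover have "(?a v \<cdot>\<^sub>m ?E v) * (?b w \<cdot>\<^sub>m ?E w) = (?a v * ?b w) \<cdot>\<^sub>m (?E v * ?E w)" for w
      using Ec[of v] Ec[of w]
      by (simp add: mult_smult_assoc_mat[of _ n n _ n] mult_smult_distrib[of _ n n _ n] smult_smult_mat mult.commute)
    ultimately show "msum n (\<lambda>w. (?a v * ?b w) \<cdot>\<^sub>m (?E v * ?E w)) (Poly_Mapping.keys g) = (?a v \<cdot>\<^sub>m ?E v) * eval_poly (mat_alg n) \<sigma> g"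
      by simp
  qed
  also have "\<dots> = eval_poly (mat_alg n) \<sigma> f * eval_poly (mat_alg n) \<sigma> g"
    unfolding eval_poly_msum[of \<sigma>, OF s, of f] by (rule msum_mult[symmetric]) (use Ec eval_poly_carrier[of \<sigma>, OF s] in auto)
  finally show ?thesis .
qed

section \<open>Invariance of the primeness property\<close>

lemma eval_poly_isomorphic:
  assumes phi: "\<phi> \<in> ring_iso (mat_alg n) (mat_alg m)"
    and lin: "\<And>c x. x \<in> carrier_mat n n \<Longrightarrow> \<phi> (c \<cdot>\<^sub>m x) = (c :: 'k::field) \<cdot>\<^sub>m \<phi> x"
    and s: "\<And>x. \<sigma> x \<in> carrier_mat n n"
  shows "\<phi> (eval_poly (mat_alg n) \<sigma> f) = eval_poly (mat_alg m) (\<lambda>x. \<phi> (\<sigma> x)) f"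
proof -
  have hom: "\<phi> \<in> Ring.ring_hom (mat_alg n) (mat_alg m)" using phi by (simp add: ring_iso_def)
  note h = ring_hom_memE[OF hom, unfolded module_mat_simps]
  have pc: "\<phi> x \<in> carrier_mat m m" if "x \<in> carrier_mat n n" for x using h(1) that .
  have E: "\<phi> (eval_fmon (mat_alg n) \<sigma> (FMon xs)) = eval_fmon (mat_alg m) (\<lambda>x. \<phi> (\<sigma> x)) (FMon xs)" for xs
    by (induction xs) (simp_all add: eval_fmon_Nil eval_fmon_Cons h(2,4) s)
  have z: "\<phi> (0\<^sub>m n n) = 0\<^sub>m m m"
    using lin[of "0\<^sub>m n n" 0] zero_smult_mat[OF h(1)[OF zero_carrier_mat]] zero_smult_mat[OF zero_carrier_mat[of n n]] by simp
  have sum: "\<phi> (msum n F S) = msum m (\<lambda>x. \<phi> (F x)) S" if "finite S" "\<And>x. x \<in> S \<Longrightarrow> F x \<in> carrier_mat n n" for F and S :: "('g \<times> nat) fmon set"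
    using that
  proof (induction S)
    case empty
    have "msum n F {} = 0\<^sub>m n n" "msum m (\<lambda>x. \<phi> (F x)) {} = 0\<^sub>m m m" by (auto intro!: eq_matI)
    then show ?case using z by simp
  next
    case (insert x S)
    have i: "msum k G (insert x S) = G x + msum k G S" if "G x \<in> carrier_mat k k" for k and G :: "_ \<Rightarrow> 'k mat"
      using that insert.hyps by (intro mat_eqI[of _ k k]) auto
    show ?case using insert by (simp add: i pc h(3))
  qed
  have E': "\<phi> (eval_fmon (mat_alg n) \<sigma> w) = eval_fmon (mat_alg m) (\<lambda>x. \<phi> (\<sigma> x)) w" for w
    using E[of "letters w"] by simp
  have "\<phi> (eval_poly (mat_alg n) \<sigma> f) = msum m (\<lambda>w. \<phi> (Poly_Mapping.lookup f w \<cdot>\<^sub>m eval_fmon (mat_alg n) \<sigma> w)) (Poly_Mapping.keys f)"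
    unfolding eval_poly_msum[of \<sigma>, OF s] by (rule sum) (use eval_fmon_carrier[of \<sigma>, OF s] in auto)
  also have "\<dots> = eval_poly (mat_alg m) (\<lambda>x. \<phi> (\<sigma> x)) f"
    unfolding eval_poly_msum[of "\<lambda>x. \<phi> (\<sigma> x)", OF pc[OF s]] using eval_fmon_carrier[of \<sigma>, OF s] by (intro msum_cong) (auto simp: lin E')
  finally show ?thesis .
qed

text \<open>
  Graded substitutions, values and centres correspond to each other, so the two algebras have the same
  graded identities and the same graded central polynomials.
\<close>

lemma primeness_graded_isomorphic:
  fixes \<Gamma> \<Delta> :: "'g \<Rightarrow> 'k::field mat set"
  assumes iso: "graded_isomorphic (mat_alg n) \<Gamma> (mat_alg m) \<Delta>" and G: "\<And>g. \<Gamma> g \<subseteq> carrier_mat n n"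
  shows "primeness_property (mat_alg n) \<Gamma> \<longleftrightarrow> primeness_property (mat_alg m) \<Delta>"
proof -
  obtain \<phi> where phi: "\<phi> \<in> ring_iso (mat_alg n) (mat_alg m)"
    and lin: "\<And>c x. x \<in> carrier_mat n n \<Longrightarrow> \<phi> (c \<cdot>\<^sub>m x) = (c :: 'k) \<cdot>\<^sub>m \<phi> x"
    and gr: "\<And>g. \<phi> ` \<Gamma> g = \<Delta> g"
    using iso unfolding graded_isomorphic_def module_mat_simps by blast
  have hom: "\<phi> \<in> Ring.ring_hom (mat_alg n) (mat_alg m)" and bij: "bij_betw \<phi> (carrier_mat n n) (carrier_mat m m)"
    using phi by (simp_all add: ring_iso_def module_mat_simps)
  note h = ring_hom_memE[OF hom, unfolded module_mat_simps]
  have inj: "\<phi> x = \<phi> y \<longleftrightarrow> x = y" if "x \<in> carrier_mat n n" "y \<in> carrier_mat n n" for x y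
    using bij that by (auto simp: bij_betw_def inj_on_def)
  have surj: "\<exists>x\<in>carrier_mat n n. y = \<phi> x" if "y \<in> carrier_mat m m" for y
    using bij that by (auto simp: bij_betw_def)
  have z: "\<phi> (0\<^sub>m n n) = 0\<^sub>m m m"
    using lin[of "0\<^sub>m n n" 0] zero_smult_mat[OF h(1)[OF zero_carrier_mat]] zero_smult_mat[OF zero_carrier_mat[of n n]] by simp
  have cen: "\<phi> x \<in> alg_center (mat_alg m) \<longleftrightarrow> x \<in> alg_center (mat_alg n)" if x: "x \<in> carrier_mat n n" for x
  proof -
    have "x * a = a * x \<longleftrightarrow> \<phi> x * \<phi> a = \<phi> a * \<phi> x" if a: "a \<in> carrier_mat n n" for a
      using inj[OF mult_carrier_mat[OF x a] mult_carrier_mat[OF a x]] h(2)[OF x a] h(2)[OF a x] by simp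
    moreover have "(\<forall>b\<in>carrier_mat m m. P b) \<longleftrightarrow> (\<forall>a\<in>carrier_mat n n. P (\<phi> a))" for P
      using h(1) surj by metis
    ultimately have "(\<forall>b\<in>carrier_mat m m. \<phi> x * b = b * \<phi> x) \<longleftrightarrow> (\<forall>a\<in>carrier_mat n n. x * a = a * x)"
      by simp
    then show ?thesis unfolding alg_center_def module_mat_simps using x h(1)[OF x] by simp
  qed
  have sc: "\<sigma> x \<in> carrier_mat n n" if "graded_subst \<Gamma> \<sigma>" for \<sigma> x
    using that G unfolding graded_subst_def by (cases x) blast
  have fwd: "graded_subst \<Delta> (\<lambda>x. \<phi> (\<sigma> x))" if "graded_subst \<Gamma> \<sigma>" for \<sigma>
    using that gr unfolding graded_subst_def by blast
  have bwd: "\<exists>\<sigma>. graded_subst \<Gamma> \<sigma> \<and> \<tau> = (\<lambda>x. \<phi> (\<sigma> x))" if t: "graded_subst \<Delta> \<tau>" for \<tau>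
  proof -
    have "\<exists>a. a \<in> \<Gamma> (fst x) \<and> \<tau> x = \<phi> a" for x
      using t gr[of "fst x"] unfolding graded_subst_def by (metis image_iff prod.collapse)
    then obtain \<sigma> where "\<And>x. \<sigma> x \<in> \<Gamma> (fst x) \<and> \<tau> x = \<phi> (\<sigma> x)" by metis
    then show ?thesis by (intro exI[of _ \<sigma>]) (auto simp: graded_subst_def)
  qed
  have ev: "\<phi> (eval_poly (mat_alg n) \<sigma> f) = eval_poly (mat_alg m) (\<lambda>x. \<phi> (\<sigma> x)) f" if "graded_subst \<Gamma> \<sigma>" for \<sigma> and f :: "('g, 'k) gr_poly"
    by (rule eval_poly_isomorphic[OF phi lin sc[OF that]])
  have "graded_identity (mat_alg n) \<Gamma> f \<longleftrightarrow> graded_identity (mat_alg m) \<Delta> f" for f :: "('g, 'k) gr_poly"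
  proof -
    have "eval_poly (mat_alg n) \<sigma> f = 0\<^sub>m n n \<longleftrightarrow> eval_poly (mat_alg m) (\<lambda>x. \<phi> (\<sigma> x)) f = 0\<^sub>m m m" if "graded_subst \<Gamma> \<sigma>" for \<sigma>
      using inj[OF eval_poly_carrier[of \<sigma>, OF sc[OF that]] zero_carrier_mat] ev[OF that] z by metis
    then show ?thesis unfolding graded_identity_def module_mat_simps using fwd bwd by metis
  qed
  moreover have "graded_central (mat_alg n) \<Gamma> f \<longleftrightarrow> graded_central (mat_alg m) \<Delta> f" for f :: "('g, 'k) gr_poly"
  proof -
    have "eval_poly (mat_alg n) \<sigma> f \<in> alg_center (mat_alg n) \<longleftrightarrow> eval_poly (mat_alg m) (\<lambda>x. \<phi> (\<sigma> x)) f \<in> alg_center (mat_alg m)" if "graded_subst \<Gamma> \<sigma>" for \<sigma>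
      using cen[OF eval_poly_carrier[of \<sigma>, OF sc[OF that]]] ev[OF that] by metis
    then show ?thesis unfolding graded_central_def using fwd bwd by metis
  qed
  ultimately show ?thesis unfolding primeness_property_def proper_graded_central_def by simp
qed

text \<open>
  Renaming the variables of degree g to variables of degree -g is an automorphism of the free algebra.
  It turns identities and central polynomials for one grading into those for the grading with negated
  degrees.
\<close>

definition neg_var :: "'g::ab_group_add \<times> nat \<Rightarrow> 'g \<times> nat" where "neg_var x = (- fst x, snd x)"

definition neg_word :: "('g::ab_group_add \<times> nat) fmon \<Rightarrow> ('g \<times> nat) fmon" where
  "neg_word w = FMon (map neg_var (letters w))"

lemma neg_var_neg_var [simp]: "neg_var (neg_var x) = x" by (simp add: neg_var_def)

lemma neg_word_neg_word [simp]: "neg_word (neg_word w) = w"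
  by (cases w) (simp add: neg_word_def comp_def)

lemma inj_neg_var: "inj neg_var" by (rule inj_on_inverseI[of _ neg_var]) simp

lemma inj_neg_word: "inj neg_word" by (rule inj_on_inverseI[of _ neg_word]) simp

definition neg_poly :: "('g::ab_group_add, 'k::field) gr_poly \<Rightarrow> ('g, 'k) gr_poly" where
  "neg_poly f = Poly_Mapping.map_key neg_word f"

lemma lookup_neg_poly: "Poly_Mapping.lookup (neg_poly f) w = Poly_Mapping.lookup f (neg_word w)"
  by (simp add: neg_poly_def map_key.rep_eq[OF inj_neg_word])

lemma neg_poly_neg_poly [simp]: "neg_poly (neg_poly f) = f"
  by (rule poly_mapping_eqI) (simp add: lookup_neg_poly)

lemma keys_neg_poly: "Poly_Mapping.keys (neg_poly f) = neg_word ` Poly_Mapping.keys f"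
proof (intro equalityI subsetI)
  fix w assume "w \<in> Poly_Mapping.keys (neg_poly f)"
  then have "neg_word w \<in> Poly_Mapping.keys f" by (simp add: in_keys_iff lookup_neg_poly)
  then show "w \<in> neg_word ` Poly_Mapping.keys f" by (metis image_eqI neg_word_neg_word)
qed (auto simp: in_keys_iff lookup_neg_poly)

lemma neg_poly_mult: "neg_poly (f * g) = neg_poly f * neg_poly g"
proof -
  have add: "neg_poly (a + b) = neg_poly a + neg_poly b" for a b :: "('a, 'b) gr_poly"
    by (rule poly_mapping_eqI) (simp add: lookup_neg_poly lookup_add)
  have z: "neg_poly 0 = (0 :: ('a, 'b) gr_poly)" by (rule poly_mapping_eqI) (simp add: lookup_neg_poly)
  have sum: "neg_poly (\<Sum>x\<in>S. F x) = (\<Sum>x\<in>S. neg_poly (F x))" for F :: "'c \<Rightarrow> ('a, 'b) gr_poly" and S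
    by (induction S rule: infinite_finite_induct) (simp_all add: add z)
  have sg: "neg_poly (Poly_Mapping.single w c) = Poly_Mapping.single (neg_word w) c" for w :: "('a \<times> nat) fmon" and c :: 'b
    by (rule poly_mapping_eqI) (auto simp: lookup_neg_poly lookup_single when_def)
  have pl: "neg_word (v + w) = neg_word v + neg_word w" for v w :: "('a \<times> nat) fmon"
    by (simp add: neg_word_def plus_fmon_def)
  have "neg_poly (f * g) = (\<Sum>v\<in>Poly_Mapping.keys f. \<Sum>w\<in>Poly_Mapping.keys g. neg_poly (Poly_Mapping.single (v + w) (Poly_Mapping.lookup f v * Poly_Mapping.lookup g w)))"
    by (subst poly_as_sum[of f], subst poly_as_sum[of g]) (simp add: sum_product mult_single sum)
  also have "\<dots> = neg_poly (\<Sum>v\<in>Poly_Mapping.keys f. Poly_Mapping.single v (Poly_Mapping.lookup f v)) * neg_poly (\<Sum>w\<in>Poly_Mapping.keys g. Poly_Mapping.single w (Poly_Mapping.lookup g w))"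
    by (simp add: sum sg pl sum_product mult_single)
  finally show ?thesis by (simp flip: poly_as_sum)
qed

lemma poly_vars_neg_poly: "poly_vars (neg_poly f) = neg_var ` poly_vars f"
  by (auto simp: poly_vars_def keys_neg_poly neg_word_def)

lemma eval_neg_poly:
  assumes s: "\<And>x. \<sigma> x \<in> carrier_mat n n"
  shows "eval_poly (mat_alg n) \<sigma> (neg_poly f) = eval_poly (mat_alg n) (\<lambda>x. \<sigma> (neg_var x)) f"
proof (rule mat_eqI[of _ n n])
  have s': "\<And>x. \<sigma> (neg_var x) \<in> carrier_mat n n" by (rule s)
  fix i j assume ij: "i < n" "j < n"
  have fin: "finite (neg_word ` Poly_Mapping.keys f)" by simp
  have e: "eval_fmon (mat_alg n) \<sigma> (neg_word w) = eval_fmon (mat_alg n) (\<lambda>x. \<sigma> (neg_var x)) w" for w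
    by (simp add: eval_fmon_def neg_word_def foldr_map comp_def)
  show "eval_poly (mat_alg n) \<sigma> (neg_poly f) $$ (i, j) = eval_poly (mat_alg n) (\<lambda>x. \<sigma> (neg_var x)) f $$ (i, j)"
    unfolding eval_poly_index[OF s fin equalityD1[OF keys_neg_poly] ij] eval_poly_index[of "\<lambda>x. \<sigma> (neg_var x)", OF s' finite_keys order_refl ij]
    by (subst sum.reindex) (auto intro: inj_on_subset[OF inj_neg_word] simp: lookup_neg_poly e)
qed (rule eval_poly_carrier, rule s)+

lemma primeness_neg_degree:
  fixes \<Delta> :: "'g::ab_group_add \<Rightarrow> 'k::field mat set"
  assumes D: "\<And>g. \<Delta> g \<subseteq> carrier_mat n n" and prim: "primeness_property (mat_alg n) \<Delta>"
  shows "primeness_property (mat_alg n) (\<lambda>g. \<Delta> (- g))"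
proof -
  let ?D = "\<lambda>g. \<Delta> (- g)"
  have sub: "graded_subst ?D \<sigma> \<longleftrightarrow> graded_subst \<Delta> (\<lambda>x. \<sigma> (neg_var x))" for \<sigma> :: "'g \<times> nat \<Rightarrow> 'k mat"
    unfolding graded_subst_def neg_var_def by simp (metis minus_minus)
  have sub': "graded_subst \<Delta> \<sigma> \<longleftrightarrow> graded_subst ?D (\<lambda>x. \<sigma> (neg_var x))" for \<sigma> :: "'g \<times> nat \<Rightarrow> 'k mat"
    by (simp add: sub)
  have sc: "\<sigma> x \<in> carrier_mat n n" if "graded_subst \<Delta> \<sigma>" for \<sigma> x
    using that D unfolding graded_subst_def by (cases x) blast
  have pc: "proper_graded_central (mat_alg n) ?D f \<longleftrightarrow> proper_graded_central (mat_alg n) \<Delta> (neg_poly f)" for f :: "('g, 'k) gr_poly"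
  proof -
    have ev: "eval_poly (mat_alg n) \<sigma> (neg_poly f) = eval_poly (mat_alg n) (\<lambda>x. \<sigma> (neg_var x)) f" if "graded_subst \<Delta> \<sigma>" for \<sigma>
      by (rule eval_neg_poly[of \<sigma>, OF sc[OF that]])
    have all: "(\<forall>\<sigma>. graded_subst ?D \<sigma> \<longrightarrow> P (eval_poly (mat_alg n) \<sigma> f)) \<longleftrightarrow> (\<forall>\<sigma>. graded_subst \<Delta> \<sigma> \<longrightarrow> P (eval_poly (mat_alg n) \<sigma> (neg_poly f)))" for P
    proof (intro iffI allI impI)
      fix \<sigma> :: "'g \<times> nat \<Rightarrow> 'k mat" assume "\<forall>\<sigma>. graded_subst ?D \<sigma> \<longrightarrow> P (eval_poly (mat_alg n) \<sigma> f)" "graded_subst \<Delta> \<sigma>"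
      then show "P (eval_poly (mat_alg n) \<sigma> (neg_poly f))" using ev sub'[of \<sigma>] by metis
    next
      fix \<sigma> :: "'g \<times> nat \<Rightarrow> 'k mat" assume a: "\<forall>\<sigma>. graded_subst \<Delta> \<sigma> \<longrightarrow> P (eval_poly (mat_alg n) \<sigma> (neg_poly f))" "graded_subst ?D \<sigma>"
      then have s: "graded_subst \<Delta> (\<lambda>x. \<sigma> (neg_var x))" using sub[of \<sigma>] by simp
      show "P (eval_poly (mat_alg n) \<sigma> f)" using a(1)[rule_format, OF s] ev[OF s] by simp
    qed
    show ?thesis unfolding proper_graded_central_def graded_central_def graded_identity_def
      using all[of "\<lambda>a. a \<in> alg_center (mat_alg n)"] all[of "\<lambda>a. a = \<zero>\<^bsub>mat_alg n\<^esub>"] by simp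
  qed
  show ?thesis unfolding primeness_property_def
  proof (intro allI impI)
    fix f g :: "('g, 'k) gr_poly"
    assume dis: "poly_vars f \<inter> poly_vars g = {}" and fg: "proper_graded_central (mat_alg n) ?D (f * g)"
    have "poly_vars (neg_poly f) \<inter> poly_vars (neg_poly g) = {}"
      unfolding poly_vars_neg_poly image_Int[OF inj_neg_var, symmetric] dis by simp
    moreover have "proper_graded_central (mat_alg n) \<Delta> (neg_poly f * neg_poly g)"
      using fg unfolding pc neg_poly_mult .
    ultimately show "proper_graded_central (mat_alg n) ?D f \<and> proper_graded_central (mat_alg n) ?D g"
      using prim[unfolded primeness_property_def, rule_format, of "neg_poly f" "neg_poly g"] unfolding pc by simp
  qed
qed

section \<open>Traces, words and coordinates\<close>

definition mat_trace :: "'k::field mat \<Rightarrow> 'k" where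
  "mat_trace A = (\<Sum>i<dim_row A. A $$ (i, i))"

lemma mat_trace: "A \<in> carrier_mat n n \<Longrightarrow> mat_trace A = (\<Sum>i<n. A $$ (i, i))"
  by (auto simp: mat_trace_def)

lemma mat_trace_comm:
  assumes "A \<in> carrier_mat n n" "B \<in> carrier_mat n n"
  shows "mat_trace (A * B) = mat_trace (B * A)"
proof -
  have "mat_trace (A * B) = (\<Sum>i<n. \<Sum>j<n. A $$ (i, j) * B $$ (j, i))"
    unfolding mat_trace[OF mult_carrier_square[OF assms]]
    by (intro sum.cong refl) (simp add: mat_mult_index[OF assms])
  also have "\<dots> = (\<Sum>j<n. \<Sum>i<n. A $$ (i, j) * B $$ (j, i))" by (rule sum.swap)
  also have "\<dots> = mat_trace (B * A)"
    unfolding mat_trace[OF mult_carrier_square[OF assms(2,1)]]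
    by (intro sum.cong refl) (simp add: mat_mult_index[OF assms(2,1)] mult.commute)
  finally show ?thesis .
qed

lemma mat_trace_smult: "A \<in> carrier_mat n n \<Longrightarrow> mat_trace (c \<cdot>\<^sub>m A) = c * mat_trace A"
  by (simp add: mat_trace[of _ n] sum_distrib_left smult_index[of A n n])

lemma mat_trace_msum:
  assumes "\<And>s. s \<in> S \<Longrightarrow> f s \<in> carrier_mat n n"
  shows "mat_trace (msum n f S) = (\<Sum>s\<in>S. mat_trace (f s))"
proof -
  have "mat_trace (msum n f S) = (\<Sum>i<n. \<Sum>s\<in>S. f s $$ (i, i))"
    by (simp add: mat_trace[OF msum_carrier])
  also have "\<dots> = (\<Sum>s\<in>S. \<Sum>i<n. f s $$ (i, i))" by (rule sum.swap)
  also have "\<dots> = (\<Sum>s\<in>S. mat_trace (f s))" using mat_trace[OF assms] by (intro sum.cong refl) simp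
  finally show ?thesis .
qed

lemma mat_unit_mult_index:
  assumes "A \<in> carrier_mat n n" "a < n" "b < n" "j < n"
  shows "(mat_unit n i j * A) $$ (a, b) = (if a = i then A $$ (j, b) else (0 :: 'k::field))"
proof -
  have "(mat_unit n i j * A) $$ (a, b) = (\<Sum>k<n. if k = j then (if a = i then A $$ (j, b) else 0) else 0)"
    unfolding mat_mult_index[OF mat_unit_carrier assms(1,2,3)]
    using assms(2) by (intro sum.cong refl) (simp add: mat_unit_index)
  then show ?thesis using assms(4) by simp
qed

lemma mat_trace_unit_mult:
  assumes "A \<in> carrier_mat n n" "i < n" "j < n"
  shows "mat_trace (mat_unit n i j * A) = (A $$ (j, i) :: 'k::field)"
proof -
  have "mat_trace (mat_unit n i j * A) = (\<Sum>a<n. if a = i then A $$ (j, i) else 0)"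
    unfolding mat_trace[OF mult_carrier_square[OF mat_unit_carrier assms(1)]]
    using assms by (intro sum.cong refl) (simp add: mat_unit_mult_index)
  then show ?thesis using assms by simp
qed

lemma mat_trace_nondegenerate:
  assumes A: "A \<in> carrier_mat n n" and B: "B \<in> carrier_mat n n"
    and eq: "\<And>Z. Z \<in> carrier_mat n n \<Longrightarrow> mat_trace (Z * A) = mat_trace (Z * (B :: 'k::field mat))"
  shows "A = B"
proof (rule mat_eqI[OF A B])
  fix i j assume "i < n" "j < n"
  then show "A $$ (i, j) = B $$ (i, j)"
    using eq[of "mat_unit n j i"] mat_trace_unit_mult[OF A] mat_trace_unit_mult[OF B] by simp
qed

definition mprod :: "nat \<Rightarrow> 'k::field mat list \<Rightarrow> 'k mat" where
  "mprod n As = foldr (*) As (1\<^sub>m n)"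

lemma mprod_simps [simp]: "mprod n [] = 1\<^sub>m n" "mprod n (A # As) = A * mprod n As"
  by (simp_all add: mprod_def)

lemma mprod_carrier: "set As \<subseteq> carrier_mat n n \<Longrightarrow> mprod n As \<in> carrier_mat n n"
  by (induction As) auto

lemma mprod_append:
  "set As \<subseteq> carrier_mat n n \<Longrightarrow> set Bs \<subseteq> carrier_mat n n \<Longrightarrow> mprod n (As @ Bs) = mprod n As * mprod n Bs"
proof (induction As)
  case Nil
  then show ?case using mprod_carrier[of Bs n] by simp
next
  case (Cons A As)
  then show ?case using mprod_carrier[of Bs n] mprod_carrier[of As n] assoc_mult_mat[of A n n "mprod n As" n "mprod n Bs" n] by simp
qed

lemma eval_fmon_mprod: "eval_fmon (mat_alg n) \<sigma> (FMon xs) = mprod n (map \<sigma> xs)"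
  by (induction xs) (simp_all add: eval_fmon_Nil eval_fmon_Cons)

text \<open>
  An n by n matrix is read as a vector of length n^2, row after row.
\<close>

definition coord :: "nat \<Rightarrow> 'k::field mat \<Rightarrow> nat \<Rightarrow> 'k" where
  "coord n A m = A $$ (m div n, m mod n)"

lemma div_less_square: "m < n * n \<Longrightarrow> m div n < (n::nat)"
  by (simp add: less_mult_imp_div_less)

lemma mod_less_square: "m < n * n \<Longrightarrow> m mod n < (n::nat)"
  by (cases "n = 0") auto

lemma sum_square_index:
  "(\<Sum>m<n * n. f (m div n) (m mod n)) = (\<Sum>p<n. \<Sum>q<n. f p (q :: nat))"
proof -
  have lt: "a * n + b < n * n" if "a < n" "b < n" for a b :: nat
  proof -
    have "a * n + b < Suc a * n" using that by simp
    also have "\<dots> \<le> n * n" using that by (intro mult_le_mono1) simp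
    finally show ?thesis .
  qed
  have "(\<Sum>p<n. \<Sum>q<n. f p q) = (\<Sum>(p, q)\<in>{..<n} \<times> {..<n}. f p q)"
    by (simp add: sum.cartesian_product)
  also have "\<dots> = (\<Sum>m<n * n. f (m div n) (m mod n))"
    by (rule sum.reindex_bij_witness[of _ "\<lambda>m. (m div n, m mod n)" "\<lambda>(p, q). p * n + q"])
      (auto simp: div_less_square mod_less_square lt)
  finally show ?thesis by simp
qed

definition index_lists :: "nat \<Rightarrow> nat \<Rightarrow> nat list set" where
  "index_lists N K = {ms. set ms \<subseteq> {..<N} \<and> length ms = K}"

lemma sum_index_lists_Suc:
  "(\<Sum>ms\<in>index_lists N (Suc K). f ms) = (\<Sum>m<N. \<Sum>ms\<in>index_lists N K. f (m # ms))"
proof -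
  have "(\<Sum>m<N. \<Sum>ms\<in>index_lists N K. f (m # ms)) = (\<Sum>(m, ms)\<in>{..<N} \<times> index_lists N K. f (m # ms))"
    by (simp add: sum.cartesian_product)
  also have "\<dots> = (\<Sum>ms\<in>index_lists N (Suc K). f ms)"
    by (rule sum.reindex_bij_witness[of _ "\<lambda>ms. (hd ms, tl ms)" "\<lambda>(m, ms). m # ms"])
      (auto simp: index_lists_def length_Suc_conv)
  finally show ?thesis by simp
qed

text \<open>
  A word that contains each of the matrices a_k once is a multilinear function of their coordinates,
  whose coefficients depend on the y_k only.
\<close>

lemma mprod_multilinear:
  fixes y :: "nat \<Rightarrow> 'k::field mat"
  assumes y: "\<And>k. y k \<in> carrier_mat n n"
  shows "\<exists>c. \<forall>a. (\<forall>k. a k \<in> carrier_mat n n) \<longrightarrow> (\<forall>p<n. \<forall>q<n.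
     mprod n (concat (map (\<lambda>k. [a k, y k]) ks)) $$ (p, q) =
     (\<Sum>ms\<in>index_lists (n * n) (length ks). c ms p q * (\<Prod>t<length ks. coord n (a (ks ! t)) (ms ! t))))"
proof (induction ks)
  case Nil
  have "index_lists (n * n) 0 = {[]}" by (auto simp: index_lists_def)
  then show ?case by (intro exI[of _ "\<lambda>ms p q. if p = q then 1 else 0"]) simp
next
  case (Cons k ks)
  then obtain c where c: "\<And>a p q. (\<forall>k. a k \<in> carrier_mat n n) \<Longrightarrow> p < n \<Longrightarrow> q < n \<Longrightarrow>
     mprod n (concat (map (\<lambda>k. [a k, y k]) ks)) $$ (p, q) =
     (\<Sum>ms\<in>index_lists (n * n) (length ks). c ms p q * (\<Prod>t<length ks. coord n (a (ks ! t)) (ms ! t)))"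
    by blast
  define c' where "c' ms p q = (if hd ms div n = p then \<Sum>r<n. y k $$ (hd ms mod n, r) * c (tl ms) r q else 0)" for ms p q
  show ?case
  proof (intro exI[of _ c'] allI impI)
    fix a :: "nat \<Rightarrow> 'k mat" and p q
    assume a: "\<forall>k. a k \<in> carrier_mat n n" and p: "p < n" and q: "q < n"
    let ?R = "mprod n (concat (map (\<lambda>k. [a k, y k]) ks))"
    let ?P = "\<lambda>ms. \<Prod>t<length ks. coord n (a (ks ! t)) (ms ! t)"
    let ?L = "index_lists (n * n) (length ks)"
    have ac: "a k \<in> carrier_mat n n" using a by blast
    have Rc: "?R \<in> carrier_mat n n" by (rule mprod_carrier) (use a y in auto)
    have yR: "y k * ?R \<in> carrier_mat n n" using y Rc by auto
    have "mprod n (concat (map (\<lambda>k. [a k, y k]) (k # ks))) $$ (p, q) = (a k * (y k * ?R)) $$ (p, q)"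
      by simp
    also have "\<dots> = (\<Sum>s<n. a k $$ (p, s) * (y k * ?R) $$ (s, q))"
      by (rule mat_mult_index[OF ac yR p q])
    also have "\<dots> = (\<Sum>p'<n. \<Sum>s<n. if p' = p then a k $$ (p', s) * (y k * ?R) $$ (s, q) else 0)"
      using p by (subst sum.swap) simp
    also have "\<dots> = (\<Sum>m<n * n. if m div n = p then coord n (a k) m * (y k * ?R) $$ (m mod n, q) else 0)"
      unfolding coord_def
      using sum_square_index[of "\<lambda>p' s. if p' = p then a k $$ (p', s) * (y k * ?R) $$ (s, q) else 0" n] by simp
    also have "\<dots> = (\<Sum>m<n * n. \<Sum>ms\<in>?L. c' (m # ms) p q * (coord n (a k) m * ?P ms))"
    proof (intro sum.cong refl)
      fix m assume "m \<in> {..<n * n}"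
      then have m: "m mod n < n" by (auto simp: mod_less_square)
      have "(y k * ?R) $$ (m mod n, q) = (\<Sum>r<n. y k $$ (m mod n, r) * (\<Sum>ms\<in>?L. c ms r q * ?P ms))"
        unfolding mat_mult_index[OF y Rc m q] using c[OF a _ q] by (intro sum.cong refl) simp
      also have "\<dots> = (\<Sum>ms\<in>?L. (\<Sum>r<n. y k $$ (m mod n, r) * c ms r q) * ?P ms)"
        by (simp add: sum_distrib_left sum_distrib_right, subst sum.swap, simp add: mult.assoc)
      finally have yr: "(y k * ?R) $$ (m mod n, q) = (\<Sum>ms\<in>?L. (\<Sum>r<n. y k $$ (m mod n, r) * c ms r q) * ?P ms)" .
      show "(if m div n = p then coord n (a k) m * (y k * ?R) $$ (m mod n, q) else 0)
        = (\<Sum>ms\<in>?L. c' (m # ms) p q * (coord n (a k) m * ?P ms))"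
      proof (cases "m div n = p")
        case True
        have "coord n (a k) m * (y k * ?R) $$ (m mod n, q) = (\<Sum>ms\<in>?L. (\<Sum>r<n. y k $$ (m mod n, r) * c ms r q) * (coord n (a k) m * ?P ms))"
          unfolding yr sum_distrib_left by (intro sum.cong refl) (simp only: mult_ac)
        then show ?thesis using True by (simp add: c'_def)
      qed (simp add: c'_def)
    qed
    also have "\<dots> = (\<Sum>ms\<in>index_lists (n * n) (length (k # ks)). c' ms p q * (\<Prod>t<length (k # ks). coord n (a ((k # ks) ! t)) (ms ! t)))"
      by (simp add: sum_index_lists_Suc prod.lessThan_Suc_shift del: prod.lessThan_Suc)
    finally show "mprod n (concat (map (\<lambda>k. [a k, y k]) (k # ks))) $$ (p, q) =
       (\<Sum>ms\<in>index_lists (n * n) (length (k # ks)). c' ms p q * (\<Prod>t<length (k # ks). coord n (a ((k # ks) ! t)) (ms ! t)))" .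
  qed
qed

section \<open>A derivation property of determinants\<close>

text \<open>
  Replacing the columns of A by those of S A, one at a time: Laplace expansion along the replaced column
  gives the entries of S against the product of A with its adjugate, which is det A times the unit
  matrix.
\<close>

lemma sum_det_replace_columns:
  fixes A S :: "'k::field mat"
  assumes A: "A \<in> carrier_mat N N" and S: "S \<in> carrier_mat N N"
  shows "(\<Sum>i<N. det (mat N N (\<lambda>(t, j). if j = i then (S * A) $$ (t, j) else A $$ (t, j)))) = mat_trace S * det A"
proof -
  let ?B = "\<lambda>i. mat N N (\<lambda>(t, j). if j = i then (S * A) $$ (t, j) else A $$ (t, j))"
  have "det (?B i) = (\<Sum>t<N. \<Sum>u<N. S $$ (t, u) * A $$ (u, i) * cofactor A t i)" if i: "i < N" for i
  proof -
    have "det (?B i) = (\<Sum>t<N. ?B i $$ (t, i) * cofactor (?B i) t i)"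
      by (rule laplace_expansion_column[OF _ i]) simp
    also have "\<dots> = (\<Sum>t<N. \<Sum>u<N. S $$ (t, u) * A $$ (u, i) * cofactor A t i)"
    proof (intro sum.cong refl)
      fix t assume "t \<in> {..<N}"
      then have t: "t < N" by simp
      have "mat_delete (?B i) t i = mat_delete A t i"
        unfolding mat_delete_def using A i t by (intro eq_matI) auto
      then have "cofactor (?B i) t i = cofactor A t i" by (simp add: cofactor_def)
      then show "?B i $$ (t, i) * cofactor (?B i) t i = (\<Sum>u<N. S $$ (t, u) * A $$ (u, i) * cofactor A t i)"
        using t i by (simp add: mat_mult_index[OF S A] sum_distrib_right)
    qed
    finally show ?thesis .
  qed
  then have "(\<Sum>i<N. det (?B i)) = (\<Sum>i<N. \<Sum>t<N. \<Sum>u<N. S $$ (t, u) * A $$ (u, i) * cofactor A t i)"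
    by (intro sum.cong refl) simp
  also have "\<dots> = (\<Sum>t<N. \<Sum>i<N. \<Sum>u<N. S $$ (t, u) * A $$ (u, i) * cofactor A t i)" by (rule sum.swap)
  also have "\<dots> = (\<Sum>t<N. \<Sum>u<N. \<Sum>i<N. S $$ (t, u) * A $$ (u, i) * cofactor A t i)" by (intro sum.cong refl sum.swap)
  also have "\<dots> = (\<Sum>t<N. \<Sum>u<N. if u = t then S $$ (t, t) * det A else 0)"
  proof (intro sum.cong refl)
    fix t u assume "t \<in> {..<N}" "u \<in> {..<N}"
    then have t: "t < N" "u < N" by auto
    have "(\<Sum>i<N. A $$ (u, i) * cofactor A t i) = (A * adj_mat A) $$ (u, t)"
      unfolding mat_mult_index[OF A adj_mat(1)[OF A] t(2,1)]
      using A t by (intro sum.cong refl) (simp add: adj_mat_def)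
    also have "\<dots> = (if u = t then det A else 0)" using adj_mat(2)[OF A] t by simp
    finally have "(\<Sum>i<N. A $$ (u, i) * cofactor A t i) = (if u = t then det A else 0)" .
    then show "(\<Sum>i<N. S $$ (t, u) * A $$ (u, i) * cofactor A t i) = (if u = t then S $$ (t, t) * det A else 0)"
      by (simp add: mult.assoc flip: sum_distrib_left)
  qed
  also have "\<dots> = mat_trace S * det A" by (simp add: mat_trace[OF S] sum_distrib_right)
  finally show ?thesis .
qed

text \<open>
  The vectors a_i enter through the coordinates listed in ms.  If ms is a permutation of all
  coordinates, this is the preceding lemma; if ms repeats a coordinate, all determinants have two equal
  rows.
\<close>

lemma sum_det_apply_operator:
  fixes a :: "nat \<Rightarrow> nat \<Rightarrow> 'k::field" and T :: "nat \<Rightarrow> nat \<Rightarrow> 'k"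
  assumes ms: "ms \<in> index_lists N N"
    and b: "\<And>i m. i < N \<Longrightarrow> m < N \<Longrightarrow> b i m = (\<Sum>l<N. T m l * a i l)"
  shows "(\<Sum>i<N. det (mat N N (\<lambda>(t, j). (a(i := b i)) j (ms ! t)))) = (\<Sum>m<N. T m m) * det (mat N N (\<lambda>(t, j). a j (ms ! t)))"
proof -
  have len: "length ms = N" using ms by (simp add: index_lists_def)
  have rng: "ms ! t < N" if "t < N" for t
  proof -
    have "ms ! t \<in> set ms" using that len by simp
    then show ?thesis using ms by (auto simp: index_lists_def)
  qed
  show ?thesis
  proof (cases "distinct ms")
    case False
    then obtain s t where st: "s < N" "t < N" "s \<noteq> t" "ms ! s = ms ! t"
      using len by (auto simp: distinct_conv_nth)
    have z: "det (mat N N (\<lambda>(t, j). c j (ms ! t))) = 0" for c :: "nat \<Rightarrow> nat \<Rightarrow> 'k"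
      by (rule det_identical_rows[OF _ st(3,1,2)]) (use st in \<open>auto intro!: eq_vecI\<close>)
    show ?thesis unfolding z[of a] z[of "a(i := b i)" for i] by simp
  next
    case True
    define A where "A = mat N N (\<lambda>(t, j). a j (ms ! t))"
    define S where "S = mat N N (\<lambda>(t, u). T (ms ! t) (ms ! u))"
    have A: "A \<in> carrier_mat N N" and S: "S \<in> carrier_mat N N" by (simp_all add: A_def S_def)
    have bij: "bij_betw ((!) ms) {..<N} {..<N}"
    proof -
      have "inj_on ((!) ms) {..<N}" using True len by (auto simp: inj_on_def nth_eq_iff_index_eq)
      moreover have "(!) ms ` {..<N} \<subseteq> {..<N}" using rng by auto
      ultimately show ?thesis by (simp add: bij_betw_def endo_inj_surj)
    qed
    have Ai: "A $$ (t, j) = a j (ms ! t)" if "t < N" "j < N" for t j using that by (simp add: A_def)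
    have SA: "(S * A) $$ (t, i) = b i (ms ! t)" if "t < N" "i < N" for t i
    proof -
      have "(S * A) $$ (t, i) = (\<Sum>u<N. T (ms ! t) (ms ! u) * a i (ms ! u))"
        unfolding mat_mult_index[OF S A that] using that by (intro sum.cong refl) (simp add: S_def A_def)
      also have "\<dots> = (\<Sum>l<N. T (ms ! t) l * a i l)" by (rule sum.reindex_bij_betw[OF bij])
      finally show ?thesis using b that rng by simp
    qed
    have "mat N N (\<lambda>(t, j). (a(i := b i)) j (ms ! t)) = mat N N (\<lambda>(t, j). if j = i then (S * A) $$ (t, j) else A $$ (t, j))" for i
      by (rule mat_eqI[of _ N N]) (auto simp: SA Ai)
    then have "(\<Sum>i<N. det (mat N N (\<lambda>(t, j). (a(i := b i)) j (ms ! t)))) = mat_trace S * det A"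
      using sum_det_replace_columns[OF A S] by simp
    also have "mat_trace S = (\<Sum>t<N. T (ms ! t) (ms ! t))" unfolding mat_trace[OF S] by (simp add: S_def)
    also have "\<dots> = (\<Sum>m<N. T m m)" by (rule sum.reindex_bij_betw[OF bij])
    finally show ?thesis by (simp add: A_def)
  qed
qed

section \<open>The alternating trace function\<close>

text \<open>
  The arguments of the alternating function are numbered as slots: slot 2 i holds x_i and slot 2 k + 1
  holds y_k.  A permutation \<sigma> of the x_i gives the word x_\<sigma>(0) y_0 x_\<sigma>(1) y_1 ...
\<close>

definition slot_word :: "(nat \<Rightarrow> nat) \<Rightarrow> nat list \<Rightarrow> nat list" where
  "slot_word \<sigma> ks = concat (map (\<lambda>k. [2 * \<sigma> k, 2 * k + 1]) ks)"

lemma slot_word_simps [simp]: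
  "slot_word \<sigma> [] = []" "slot_word \<sigma> (k # ks) = 2 * \<sigma> k # (2 * k + 1) # slot_word \<sigma> ks"
  "slot_word \<sigma> (ks @ ls) = slot_word \<sigma> ks @ slot_word \<sigma> ls"
  by (simp_all add: slot_word_def)

lemma set_slot_word: "set (slot_word \<sigma> ks) = (\<lambda>k. 2 * \<sigma> k) ` set ks \<union> (\<lambda>k. 2 * k + 1) ` set ks"
  by (auto simp: slot_word_def)

lemma map_slot_word: "map b (slot_word \<sigma> ks) = concat (map (\<lambda>k. [b (2 * \<sigma> k), b (2 * k + 1)]) ks)"
  by (induction ks) auto

lemma even_in_slot_word: "2 * i \<in> set (slot_word \<sigma> ks) \<longleftrightarrow> i \<in> \<sigma> ` set ks"
proof -
  have "2 * i \<noteq> 2 * k + 1" for k by presburger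
  then show ?thesis by (auto simp: set_slot_word)
qed

lemma odd_in_slot_word: "2 * i + 1 \<in> set (slot_word \<sigma> ks) \<longleftrightarrow> i \<in> set ks"
proof -
  have "2 * i + 1 \<noteq> 2 * k" for k by presburger
  then show ?thesis by (auto simp: set_slot_word)
qed

lemma distinct_slot_word:
  assumes "inj \<sigma>" "distinct ks" shows "distinct (slot_word \<sigma> ks)"
  using assms(2)
proof (induction ks)
  case (Cons k ks)
  have "2 * \<sigma> k \<noteq> 2 * k + 1" by presburger
  moreover have "\<sigma> k \<notin> \<sigma> ` set ks" using Cons assms(1) by (auto dest: injD)
  ultimately show ?case using Cons even_in_slot_word[of "\<sigma> k" \<sigma> ks] odd_in_slot_word[of k \<sigma> ks] by simp
qed simp

definition alt_trace :: "nat \<Rightarrow> (nat \<Rightarrow> 'k::field mat) \<Rightarrow> 'k" where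
  "alt_trace n b = (\<Sum>\<sigma> | \<sigma> permutes {0..<n * n}. signof \<sigma> * mat_trace (mprod n (map b (slot_word \<sigma> [0..<n * n]))))"

text \<open>
  Expand the trace of each word in the coordinates of the x_i.  For a fixed list of coordinates, the
  sum over the permutations is the Leibniz formula.
\<close>

lemma alt_trace_expand:
  fixes y :: "nat \<Rightarrow> 'k::field mat"
  assumes y: "\<And>k. y k \<in> carrier_mat n n"
  shows "\<exists>D. \<forall>b. (\<forall>s. b s \<in> carrier_mat n n) \<longrightarrow> (\<forall>k. b (2 * k + 1) = y k) \<longrightarrow>
    alt_trace n b = (\<Sum>ms\<in>index_lists (n * n) (n * n). D ms * det (mat (n * n) (n * n) (\<lambda>(t, j). coord n (b (2 * j)) (ms ! t))))"
proof -
  let ?N = "n * n"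
  let ?L = "index_lists ?N ?N"
  obtain c where c: "\<And>a p q. (\<forall>k. a k \<in> carrier_mat n n) \<Longrightarrow> p < n \<Longrightarrow> q < n \<Longrightarrow>
     mprod n (concat (map (\<lambda>k. [a k, y k]) [0..<?N])) $$ (p, q) =
     (\<Sum>ms\<in>?L. c ms p q * (\<Prod>t<?N. coord n (a ([0..<?N] ! t)) (ms ! t)))"
    using mprod_multilinear[of y n "[0..<?N]", OF y] by auto
  define D where "D ms = (\<Sum>p<n. c ms p p)" for ms
  show ?thesis
  proof (intro exI[of _ D] allI impI)
    fix b assume b: "\<forall>s. b s \<in> carrier_mat n n" "\<forall>k. b (2 * k + 1) = y k"
    have tr: "mat_trace (mprod n (map b (slot_word \<sigma> [0..<?N]))) = (\<Sum>ms\<in>?L. D ms * (\<Prod>t<?N. coord n (b (2 * \<sigma> t)) (ms ! t)))" for \<sigma>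
    proof -
      let ?W = "mprod n (concat (map (\<lambda>k. [b (2 * \<sigma> k), y k]) [0..<?N]))"
      have "?W \<in> carrier_mat n n" by (rule mprod_carrier) (use b y in auto)
      then have "mat_trace ?W = (\<Sum>p<n. \<Sum>ms\<in>?L. c ms p p * (\<Prod>t<?N. coord n (b (2 * \<sigma> ([0..<?N] ! t))) (ms ! t)))"
        using c[of "\<lambda>k. b (2 * \<sigma> k)"] b by (simp add: mat_trace)
      also have "\<dots> = (\<Sum>ms\<in>?L. \<Sum>p<n. c ms p p * (\<Prod>t<?N. coord n (b (2 * \<sigma> ([0..<?N] ! t))) (ms ! t)))"
        by (rule sum.swap)
      also have "\<dots> = (\<Sum>ms\<in>?L. D ms * (\<Prod>t<?N. coord n (b (2 * \<sigma> t)) (ms ! t)))"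
        by (simp add: D_def sum_distrib_right)
      finally show ?thesis using b by (simp add: map_slot_word)
    qed
    have "alt_trace n b = (\<Sum>\<sigma> | \<sigma> permutes {0..<?N}. \<Sum>ms\<in>?L. D ms * (signof \<sigma> * (\<Prod>t<?N. coord n (b (2 * \<sigma> t)) (ms ! t))))"
      unfolding alt_trace_def tr by (simp add: sum_distrib_left mult_ac)
    also have "\<dots> = (\<Sum>ms\<in>?L. \<Sum>\<sigma> | \<sigma> permutes {0..<?N}. D ms * (signof \<sigma> * (\<Prod>t<?N. coord n (b (2 * \<sigma> t)) (ms ! t))))"
      by (rule sum.swap)
    also have "\<dots> = (\<Sum>ms\<in>?L. D ms * det (mat ?N ?N (\<lambda>(t, j). coord n (b (2 * j)) (ms ! t))))"
    proof (intro sum.cong refl)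
      fix ms
      have "det (mat ?N ?N (\<lambda>(t, j). coord n (b (2 * j)) (ms ! t))) = (\<Sum>\<sigma> | \<sigma> permutes {0..<?N}. signof \<sigma> * (\<Prod>t<?N. coord n (b (2 * \<sigma> t)) (ms ! t)))"
        by (subst det_def') (auto simp: atLeast0LessThan permutes_in_image intro!: sum.cong prod.cong arg_cong2[where f = "(*)"])
      then show "(\<Sum>\<sigma> | \<sigma> permutes {0..<?N}. D ms * (signof \<sigma> * (\<Prod>t<?N. coord n (b (2 * \<sigma> t)) (ms ! t)))) = D ms * det (mat ?N ?N (\<lambda>(t, j). coord n (b (2 * j)) (ms ! t)))"
        by (simp add: sum_distrib_left)
    qed
    finally show "alt_trace n b = (\<Sum>ms\<in>?L. D ms * det (mat ?N ?N (\<lambda>(t, j). coord n (b (2 * j)) (ms ! t))))" .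
  qed
qed

lemma coord_sandwich:
  assumes "P \<in> carrier_mat n n" "A \<in> carrier_mat n n" "R \<in> carrier_mat n n" and m: "m < n * n"
  shows "coord n (P * A * R) m = (\<Sum>l<n * n. (P $$ (m div n, l div n) * R $$ (l mod n, m mod n)) * coord n (A :: 'k::field mat) l)"
proof -
  note i = div_less_square[OF m] mod_less_square[OF m]
  have "coord n (P * A * R) m = (\<Sum>q<n. (P * A) $$ (m div n, q) * R $$ (q, m mod n))"
    unfolding coord_def by (rule mat_mult_index[OF mult_carrier_square[OF assms(1,2)] assms(3) i])
  also have "\<dots> = (\<Sum>q<n. \<Sum>p<n. P $$ (m div n, p) * R $$ (q, m mod n) * A $$ (p, q))"
    using i by (intro sum.cong refl) (simp add: mat_mult_index[OF assms(1,2)] sum_distrib_left sum_distrib_right mult_ac)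
  also have "\<dots> = (\<Sum>p<n. \<Sum>q<n. P $$ (m div n, p) * R $$ (q, m mod n) * A $$ (p, q))" by (rule sum.swap)
  also have "\<dots> = (\<Sum>l<n * n. P $$ (m div n, l div n) * R $$ (l mod n, m mod n) * A $$ (l div n, l mod n))"
    using sum_square_index[of "\<lambda>p q. P $$ (m div n, p) * R $$ (q, m mod n) * A $$ (p, q)" n] by simp
  finally show ?thesis by (simp add: coord_def)
qed

text \<open>
  In coordinates, x \<mapsto> P x R is the operator with entries P_pp' R_q'q, and its trace is tr(P) tr(R).
\<close>

lemma alt_trace_derivation:
  fixes b :: "nat \<Rightarrow> 'k::field mat"
  assumes b: "\<And>s. b s \<in> carrier_mat n n" and P: "P \<in> carrier_mat n n" and R: "R \<in> carrier_mat n n"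
  shows "(\<Sum>i<n * n. alt_trace n (b(2 * i := P * b (2 * i) * R))) = mat_trace P * mat_trace R * alt_trace n b"
proof -
  let ?N = "n * n"
  let ?L = "index_lists ?N ?N"
  obtain D where D: "\<And>b'. (\<forall>s. b' s \<in> carrier_mat n n) \<Longrightarrow> (\<forall>k. b' (2 * k + 1) = b (2 * k + 1)) \<Longrightarrow>
    alt_trace n b' = (\<Sum>ms\<in>?L. D ms * det (mat ?N ?N (\<lambda>(t, j). coord n (b' (2 * j)) (ms ! t))))"
    using alt_trace_expand[of "\<lambda>k. b (2 * k + 1)" n] b by blast
  let ?a = "\<lambda>j. coord n (b (2 * j))"
  let ?b = "\<lambda>i. coord n (P * b (2 * i) * R)"
  let ?T = "\<lambda>m l. P $$ (m div n, l div n) * R $$ (l mod n, m mod n)"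
  have step: "alt_trace n (b(2 * i := P * b (2 * i) * R)) = (\<Sum>ms\<in>?L. D ms * det (mat ?N ?N (\<lambda>(t, j). (?a(i := ?b i)) j (ms ! t))))" for i
  proof -
    have "(b(2 * i := P * b (2 * i) * R)) (2 * k + 1) = b (2 * k + 1)" for k
    proof -
      have "2 * k + 1 \<noteq> 2 * i" by presburger
      then show ?thesis by simp
    qed
    moreover have "\<forall>s. (b(2 * i := P * b (2 * i) * R)) s \<in> carrier_mat n n" using b P R by simp
    moreover have "coord n ((b(2 * i := P * b (2 * i) * R)) (2 * j)) = (?a(i := ?b i)) j" for j by simp
    ultimately show ?thesis using D[of "b(2 * i := P * b (2 * i) * R)"] by simp
  qed
  have trT: "(\<Sum>m<?N. ?T m m) = mat_trace P * mat_trace R"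
    using sum_square_index[of "\<lambda>p q. P $$ (p, p) * R $$ (q, q)" n]
    by (simp add: mat_trace[OF P] mat_trace[OF R] sum_product)
  have "(\<Sum>i<?N. alt_trace n (b(2 * i := P * b (2 * i) * R))) = (\<Sum>ms\<in>?L. \<Sum>i<?N. D ms * det (mat ?N ?N (\<lambda>(t, j). (?a(i := ?b i)) j (ms ! t))))"
    unfolding step by (rule sum.swap)
  also have "\<dots> = (\<Sum>ms\<in>?L. D ms * ((\<Sum>m<?N. ?T m m) * det (mat ?N ?N (\<lambda>(t, j). ?a j (ms ! t)))))"
  proof (intro sum.cong refl)
    fix ms assume ms: "ms \<in> ?L"
    have "(\<Sum>i<?N. det (mat ?N ?N (\<lambda>(t, j). (?a(i := ?b i)) j (ms ! t)))) = (\<Sum>m<?N. ?T m m) * det (mat ?N ?N (\<lambda>(t, j). ?a j (ms ! t)))"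
      by (rule sum_det_apply_operator[OF ms]) (rule coord_sandwich[OF P b R])
    then show "(\<Sum>i<?N. D ms * det (mat ?N ?N (\<lambda>(t, j). (?a(i := ?b i)) j (ms ! t)))) = D ms * ((\<Sum>m<?N. ?T m m) * det (mat ?N ?N (\<lambda>(t, j). ?a j (ms ! t))))"
      by (simp only: sum_distrib_left[symmetric])
  qed
  also have "\<dots> = mat_trace P * mat_trace R * alt_trace n b"
    unfolding trT D[of b, OF allI[OF b] allI[OF refl]] by (simp add: sum_distrib_left mult_ac)
  finally show ?thesis .
qed

text \<open>
  Slot 2 k holds the k-th matrix unit e_pq and slot 2 k + 1 the matrix unit that connects its column to
  the row of the next one, where the row 0 follows the last.  The word of \<sigma> then vanishes unless \<sigma> is the
  identity.
\<close>

definition unit_slots :: "nat \<Rightarrow> nat \<Rightarrow> 'k::field mat" where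
  "unit_slots n s = (let k = s div 2; P = (\<lambda>k. if k < n * n then k div n else 0) in
     if even s then mat_unit n (k div n) (k mod n) else mat_unit n (k mod n) (P (Suc k)))"

lemma mat_unit_mult:
  assumes "j < n" "k < n"
  shows "mat_unit n i j * mat_unit n k l = (if j = k then mat_unit n i l else (0\<^sub>m n n :: 'k::field mat))"
proof (rule mat_eqI[of _ n n])
  fix a b assume ab: "a < n" "b < n"
  show "(mat_unit n i j * mat_unit n k l) $$ (a, b) = (if j = k then mat_unit n i l else (0\<^sub>m n n :: 'k mat)) $$ (a, b)"
    unfolding mat_unit_mult_index[OF mat_unit_carrier ab assms(1)] using ab assms by (auto simp: mat_unit_index)
qed auto

lemma alt_trace_unit_slots:
  assumes n: "0 < n" shows "alt_trace n (unit_slots n) = (1 :: 'k::field)"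
proof -
  let ?N = "n * n"
  let ?u = "unit_slots n :: nat \<Rightarrow> 'k mat"
  define P where "P k = (if k < ?N then k div n else 0)" for k
  have ev: "?u (2 * k) = mat_unit n (k div n) (k mod n)" for k by (simp add: unit_slots_def)
  have od: "?u (2 * k + 1) = mat_unit n (k mod n) (P (Suc k))" for k by (simp add: unit_slots_def P_def Let_def)
  have uc: "set (map ?u xs) \<subseteq> carrier_mat n n" for xs by (auto simp: unit_slots_def Let_def)
  have N: "0 < ?N" using n by simp
  have Pn: "P k < n" for k using n by (auto simp: P_def div_less_square)
  let ?R = "\<lambda>\<sigma> s. mprod n (map ?u (slot_word \<sigma> [s..<?N]))"
  have Rc: "?R \<sigma> s \<in> carrier_mat n n" for \<sigma> s by (rule mprod_carrier[OF uc])
  have main: "mat_unit n x (P s) * ?R \<sigma> s = (if \<forall>k. s \<le> k \<and> k < ?N \<longrightarrow> \<sigma> k = k then mat_unit n x 0 else 0\<^sub>m n n)"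
    if s: "s \<le> ?N" and \<sigma>: "\<And>k. k < ?N \<Longrightarrow> \<sigma> k < ?N" for s x \<sigma>
    using s
  proof (induction "?N - s" arbitrary: s)
    case 0
    then have "s = ?N" by simp
    then show ?case using right_mult_one_mat[OF mat_unit_carrier, of n x 0] by (simp add: P_def)
  next
    case (Suc d)
    then have sN: "s < ?N" by simp
    have r: "[s..<?N] = s # [Suc s..<?N]" using sN by (simp add: upt_conv_Cons)
    let ?E = "mat_unit n x (P s) :: 'k mat" and ?A = "mat_unit n (\<sigma> s div n) (\<sigma> s mod n) :: 'k mat"
      and ?B = "mat_unit n (s mod n) (P (Suc s)) :: 'k mat"
    note lt = div_less_square[OF \<sigma>[OF sN]] mod_less_square[OF \<sigma>[OF sN]] mod_less_square[OF sN]
    have "?R \<sigma> s = ?A * (?B * ?R \<sigma> (Suc s))" unfolding r by (simp add: ev od[simplified])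
    then have "?E * ?R \<sigma> s = ?E * ?A * ?B * ?R \<sigma> (Suc s)"
      using assoc_mult_mat[of ?E n n ?A n "?B * ?R \<sigma> (Suc s)" n] assoc_mult_mat[of "?E * ?A" n n ?B n "?R \<sigma> (Suc s)" n] Rc[of \<sigma> "Suc s"] by simp
    also have "?E * ?A * ?B = (if \<sigma> s = s then mat_unit n x (P (Suc s)) else 0\<^sub>m n n)"
    proof -
      have "\<sigma> s = s \<longleftrightarrow> P s = \<sigma> s div n \<and> \<sigma> s mod n = s mod n"
        using sN by (metis P_def div_mult_mod_eq)
      moreover have "?E * ?A = (if P s = \<sigma> s div n then mat_unit n x (\<sigma> s mod n) else 0\<^sub>m n n)"
        by (rule mat_unit_mult[OF Pn lt(1)])
      moreover have "mat_unit n x (\<sigma> s mod n) * ?B = (if \<sigma> s mod n = s mod n then mat_unit n x (P (Suc s)) else 0\<^sub>m n n)"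
        by (rule mat_unit_mult[OF lt(2,3)])
      moreover have "0\<^sub>m n n * ?B = 0\<^sub>m n n" by (rule left_mult_zero_mat[OF mat_unit_carrier])
      ultimately show ?thesis by auto
    qed
    also have "\<dots> * ?R \<sigma> (Suc s) = (if \<sigma> s = s then mat_unit n x (P (Suc s)) * ?R \<sigma> (Suc s) else 0\<^sub>m n n)"
      using left_mult_zero_mat[OF Rc[of \<sigma> "Suc s"], of n] by simp
    also have "\<dots> = (if \<forall>k. s \<le> k \<and> k < ?N \<longrightarrow> \<sigma> k = k then mat_unit n x 0 else 0\<^sub>m n n)"
    proof -
      have "(\<forall>k. s \<le> k \<and> k < ?N \<longrightarrow> \<sigma> k = k) \<longleftrightarrow> \<sigma> s = s \<and> (\<forall>k. Suc s \<le> k \<and> k < ?N \<longrightarrow> \<sigma> k = k)"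
        using sN by (metis Suc_leD Suc_leI le_neq_implies_less order_refl)
      then show ?thesis using Suc.hyps(1)[of "Suc s"] Suc.hyps(2) sN by auto
    qed
    finally show ?case .
  qed
  have tr: "mat_trace (?R \<sigma> 0) = (if \<sigma> = id then 1 else 0)" if \<sigma>: "\<sigma> permutes {0..<?N}" for \<sigma>
  proof -
    have rng: "\<sigma> k < ?N" if "k < ?N" for k using permutes_in_image[OF \<sigma>, of k] that by simp
    obtain M where M: "?N = Suc M" using N by (cases ?N) auto
    have last: "?R \<sigma> 0 * mat_unit n 0 0 = ?R \<sigma> 0"
    proof -
      let ?A = "mprod n (map ?u (slot_word \<sigma> [0..<M]))" and ?B = "?u (2 * \<sigma> M)" and ?C = "mat_unit n (M mod n) 0 :: 'k mat"
      have Ac: "?A \<in> carrier_mat n n" by (rule mprod_carrier[OF uc])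
      have Bc: "?B \<in> carrier_mat n n" using uc[of "[2 * \<sigma> M]"] by simp
      have "P (Suc M) = 0" using M by (simp add: P_def)
      then have C: "?u (2 * M + 1) = ?C" using od[of M] by simp
      have "?R \<sigma> 0 = ?A * (?B * ?C)"
        using mprod_append[OF uc uc, of "slot_word \<sigma> [0..<M]" "slot_word \<sigma> [M]"] C[simplified] Bc
          right_mult_one_mat[of ?C n n] unfolding M by simp
      moreover have "?C * mat_unit n 0 0 = ?C" using mat_unit_mult[OF n n] by simp
      moreover have "?A * (?B * ?C) * mat_unit n 0 0 = ?A * (?B * (?C * mat_unit n 0 0))"
        using assoc_mult_mat[of ?A n n "?B * ?C" n "mat_unit n 0 0" n] assoc_mult_mat[of ?B n n ?C n "mat_unit n 0 0" n] Ac Bc by simp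
      ultimately show ?thesis by simp
    qed
    have "mat_trace (?R \<sigma> 0) = mat_trace (mat_unit n 0 0 * ?R \<sigma> 0)"
      using mat_trace_comm[OF Rc mat_unit_carrier, of \<sigma> 0 0 0] last by simp
    also have "mat_unit n 0 0 * ?R \<sigma> 0 = (if \<forall>k. k < ?N \<longrightarrow> \<sigma> k = k then mat_unit n 0 0 else 0\<^sub>m n n)"
      using main[of 0 \<sigma> 0] rng N by (simp add: P_def)
    also have "(\<forall>k. k < ?N \<longrightarrow> \<sigma> k = k) \<longleftrightarrow> \<sigma> = id"
      using permutes_not_in[OF \<sigma>] by (metis atLeastLessThan_iff eq_id_iff id_apply)
    finally have "mat_trace (?R \<sigma> 0) = mat_trace (if \<sigma> = id then mat_unit n 0 0 else 0\<^sub>m n n :: 'k mat)" .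
    moreover have "mat_trace (mat_unit n 0 0 :: 'k mat) = 1"
      unfolding mat_trace[OF mat_unit_carrier] using n by (simp add: mat_unit_index)
    moreover have "mat_trace (0\<^sub>m n n :: 'k mat) = 0" by (simp add: mat_trace[of _ n])
    ultimately show ?thesis by simp
  qed
  have "alt_trace n ?u = (\<Sum>\<sigma> | \<sigma> permutes {0..<?N}. if \<sigma> = id then signof id else 0)"
    unfolding alt_trace_def by (intro sum.cong refl) (simp add: tr)
  also have "\<dots> = 1" by (simp add: finite_permutations permutes_id sign_id)
  finally show ?thesis .
qed

text \<open>
  Each slot occurs exactly once in the word of a permutation.
\<close>

lemma alt_trace_slot_additive:
  fixes b :: "nat \<Rightarrow> 'k::field mat"
  assumes b: "\<And>s. b s \<in> carrier_mat n n" and c: "\<And>g. c g \<in> carrier_mat n n" and s: "s < 2 * (n * n)"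
  shows "alt_trace n (b(s := msum n c S)) = (\<Sum>g\<in>S. alt_trace n (b(s := c g)))"
proof -
  have one: "mat_trace (mprod n (map (b(s := msum n c S)) (slot_word \<sigma> [0..<n * n]))) = (\<Sum>g\<in>S. mat_trace (mprod n (map (b(s := c g)) (slot_word \<sigma> [0..<n * n]))))"
    if \<sigma>: "\<sigma> permutes {0..<n * n}" for \<sigma>
  proof -
    have "s \<in> set (slot_word \<sigma> [0..<n * n])"
    proof (cases "even s")
      case True
      then obtain i where "s = 2 * i" by (rule evenE)
      then show ?thesis using s permutes_image[OF \<sigma>] even_in_slot_word[of i \<sigma> "[0..<n * n]"] by auto
    next
      case False
      then obtain i where "s = 2 * i + 1" by (rule oddE)
      then show ?thesis using s odd_in_slot_word[of i \<sigma> "[0..<n * n]"] by auto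
    qed
    then obtain xs ys where split: "slot_word \<sigma> [0..<n * n] = xs @ s # ys" by (meson split_list)
    have "distinct (xs @ s # ys)" using distinct_slot_word[OF permutes_inj[OF \<sigma>], of "[0..<n * n]"] split by simp
    then have nin: "s \<notin> set xs" "s \<notin> set ys" by auto
    have bc: "set (map b zs) \<subseteq> carrier_mat n n" for zs using b by auto
    note Xc = mprod_carrier[OF bc[of xs]] and Yc = mprod_carrier[OF bc[of ys]]
    have w: "mprod n (map (b(s := A)) (slot_word \<sigma> [0..<n * n])) = mprod n (map b xs) * A * mprod n (map b ys)"
      if A: "A \<in> carrier_mat n n" for A
    proof -
      have eq: "map (b(s := A)) (xs @ s # ys) = map b xs @ A # map b ys" using nin by auto
      have "mprod n (map (b(s := A)) (slot_word \<sigma> [0..<n * n])) = mprod n (map b xs) * (A * mprod n (map b ys))"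
        unfolding split eq using mprod_append[of "map b xs" n "A # map b ys"] bc[of xs] bc[of ys] A by simp
      then show ?thesis using assoc_mult_mat[OF Xc A Yc] by simp
    qed
    have "mprod n (map (b(s := msum n c S)) (slot_word \<sigma> [0..<n * n])) = msum n (\<lambda>g. mprod n (map (b(s := c g)) (slot_word \<sigma> [0..<n * n]))) S"
      unfolding w[OF c] w[OF msum_carrier] by (rule sandwich_msum[OF Xc Yc c])
    moreover have "mprod n (map (b(s := c g)) (slot_word \<sigma> [0..<n * n])) \<in> carrier_mat n n" for g
      by (rule mprod_carrier) (use b c in auto)
    ultimately show ?thesis by (simp add: mat_trace_msum)
  qed
  have "alt_trace n (b(s := msum n c S)) = (\<Sum>\<sigma> | \<sigma> permutes {0..<n * n}. \<Sum>g\<in>S. signof \<sigma> * mat_trace (mprod n (map (b(s := c g)) (slot_word \<sigma> [0..<n * n]))))"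
    unfolding alt_trace_def by (intro sum.cong refl) (simp add: one sum_distrib_left)
  also have "\<dots> = (\<Sum>g\<in>S. alt_trace n (b(s := c g)))"
    unfolding alt_trace_def by (rule sum.swap)
  finally show ?thesis .
qed

text \<open>
  A function that is additive in each argument and does not vanish somewhere does not vanish at some
  homogeneous arguments: split the arguments one after the other into their components.
\<close>

lemma (in graded_matrix) homogeneous_nonzero_value:
  fixes H :: "(nat \<Rightarrow> 'k mat) \<Rightarrow> 'k"
  assumes add: "\<And>s b c. s < K \<Longrightarrow> (\<forall>s. b s \<in> carrier_mat n n) \<Longrightarrow> (\<forall>g. c g \<in> carrier_mat n n) \<Longrightarrow>
      H (b(s := msum n c (UNIV :: 'g set))) = (\<Sum>g\<in>UNIV. H (b(s := c g)))"
    and b: "\<forall>s. b s \<in> carrier_mat n n" and nz: "H b \<noteq> 0"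
  shows "\<exists>b' \<delta>. (\<forall>s. b' s \<in> carrier_mat n n) \<and> (\<forall>s<K. b' s \<in> \<Gamma> (\<delta> s)) \<and> H b' \<noteq> 0"
proof -
  have "\<exists>b' \<delta>. (\<forall>s. b' s \<in> carrier_mat n n) \<and> (\<forall>s<k. b' s \<in> \<Gamma> (\<delta> s)) \<and> H b' \<noteq> 0" if "k \<le> K" for k
    using that
  proof (induction k)
    case 0
    then show ?case using b nz by auto
  next
    case (Suc k)
    then obtain b' \<delta> where b': "\<forall>s. b' s \<in> carrier_mat n n" "\<forall>s<k. b' s \<in> \<Gamma> (\<delta> s)" "H b' \<noteq> 0" by auto
    have c: "\<forall>g. component (b' k) g \<in> carrier_mat n n" using component(1) b'(1) carrier by blast
    have "b'(k := msum n (component (b' k)) (UNIV :: 'g set)) = b'" using component(2)[of "b' k"] b'(1) by (simp add: fun_upd_idem)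
    then have "(\<Sum>g\<in>UNIV. H (b'(k := component (b' k) g))) \<noteq> 0" using add[of k b' "component (b' k)"] b' c Suc.prems by simp
    then obtain g where g: "H (b'(k := component (b' k) g)) \<noteq> 0" by (meson sum.neutral)
    show ?case
      by (intro exI[of _ "b'(k := component (b' k) g)"] exI[of _ "\<delta>(k := g)"])
        (use b' c g component(1) in \<open>auto simp: less_Suc_eq fun_upd_def\<close>)
  qed
  then show ?thesis by blast
qed

section \<open>Polynomials with values on a line\<close>

text \<open>
  Slot 2 N holds a further variable w.  The word arises from x_\<sigma>(0) y_0 x_\<sigma>(1) ... by the replacement of
  x_\<sigma>(k) by z x_\<sigma>(k) w and a cyclic rotation under the trace that moves z to the front, where it is split
  off.
\<close>

definition cyclic_word :: "nat \<Rightarrow> (nat \<Rightarrow> nat) \<Rightarrow> nat \<Rightarrow> nat list" where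
  "cyclic_word N \<sigma> k = 2 * \<sigma> k # 2 * N # (2 * k + 1) # slot_word \<sigma> [Suc k..<N] @ slot_word \<sigma> [0..<k]"

lemma trace_cyclic_word:
  fixes b :: "nat \<Rightarrow> 'k::field mat"
  assumes b: "\<And>s. b s \<in> carrier_mat n n" and Z: "Z \<in> carrier_mat n n"
    and \<sigma>: "\<sigma> permutes {0..<N}" and k: "k < N"
  shows "mat_trace (Z * mprod n (map b (cyclic_word N \<sigma> k))) =
    mat_trace (mprod n (map (b(2 * \<sigma> k := Z * b (2 * \<sigma> k) * b (2 * N))) (slot_word \<sigma> [0..<N])))"
proof -
  define A where "A = mprod n (map b (slot_word \<sigma> [0..<k]))"
  define B where "B = b (2 * k + 1) * mprod n (map b (slot_word \<sigma> [Suc k..<N]))"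
  let ?x = "b (2 * \<sigma> k)" and ?w = "b (2 * N)"
  have bc: "set (map b zs) \<subseteq> carrier_mat n n" for zs using b by auto
  have Ac: "A \<in> carrier_mat n n" unfolding A_def by (rule mprod_carrier[OF bc])
  have Mc: "mprod n (map b (slot_word \<sigma> [Suc k..<N])) \<in> carrier_mat n n" by (rule mprod_carrier[OF bc])
  have Bc: "B \<in> carrier_mat n n" unfolding B_def using b Mc by auto
  have up: "[0..<N] = [0..<k] @ k # [Suc k..<N]" using k by (metis append_Cons append_Nil le_add1 plus_nat.add_0 upt_add_eq_append upt_conv_Cons less_imp_le le0 le_add_diff_inverse)
  have nin: "2 * \<sigma> k \<notin> set (slot_word \<sigma> [0..<k])" "2 * \<sigma> k \<notin> set (slot_word \<sigma> [Suc k..<N])"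
    unfolding even_in_slot_word inj_image_mem_iff[OF permutes_inj[OF \<sigma>]] by simp_all
  have no: "2 * k + 1 \<noteq> 2 * \<sigma> k" by presburger
  have L: "mprod n (map b (cyclic_word N \<sigma> k)) = ?x * ?w * B * A"
  proof -
    have "mprod n (map b (cyclic_word N \<sigma> k)) = ?x * (?w * (b (2 * k + 1) * (mprod n (map b (slot_word \<sigma> [Suc k..<N])) * A)))"
      unfolding cyclic_word_def A_def using mprod_append[OF bc bc] by simp
    also have "b (2 * k + 1) * (mprod n (map b (slot_word \<sigma> [Suc k..<N])) * A) = B * A"
      unfolding B_def by (rule assoc_mult_mat[OF b Mc Ac, symmetric])
    finally show ?thesis
      using assoc_mult_mat[OF b[of "2 * \<sigma> k"] b[of "2 * N"] mult_carrier_square[OF Bc Ac]]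
        assoc_mult_mat[OF mult_carrier_square[OF b[of "2 * \<sigma> k"] b[of "2 * N"]] Bc Ac] by simp
  qed
  have R: "mprod n (map (b(2 * \<sigma> k := M)) (slot_word \<sigma> [0..<N])) = A * (M * B)" if M: "M \<in> carrier_mat n n" for M
  proof -
    have eq: "map (b(2 * \<sigma> k := M)) (slot_word \<sigma> [0..<N]) = map b (slot_word \<sigma> [0..<k]) @ M # b (2 * k + 1) # map b (slot_word \<sigma> [Suc k..<N])"
      unfolding up using nin no by (auto simp: fun_upd_def)
    have "set (M # b (2 * k + 1) # map b (slot_word \<sigma> [Suc k..<N])) \<subseteq> carrier_mat n n" using M b by auto
    from mprod_append[OF bc this, of "slot_word \<sigma> [0..<k]"] show ?thesis
      unfolding eq by (simp add: A_def B_def)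
  qed
  let ?M = "Z * ?x * ?w"
  have Mc': "?M \<in> carrier_mat n n" using Z b by auto
  have "Z * (?x * ?w * B * A) = ?M * B * A"
    using assoc_mult_mat[OF Z mult_carrier_square[OF mult_carrier_square[OF b[of "2 * \<sigma> k"] b[of "2 * N"]] Bc] Ac]
      assoc_mult_mat[OF Z mult_carrier_square[OF b[of "2 * \<sigma> k"] b[of "2 * N"]] Bc]
      assoc_mult_mat[OF Z b[of "2 * \<sigma> k"] b[of "2 * N"]] by simp
  then have "mat_trace (Z * mprod n (map b (cyclic_word N \<sigma> k))) = mat_trace (?M * B * A)" unfolding L by simp
  also have "\<dots> = mat_trace (A * (?M * B))" by (rule mat_trace_comm[OF mult_carrier_square[OF Mc' Bc] Ac])
  finally show ?thesis unfolding R[OF Mc'] .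
qed

text \<open>
  The variables of slot s are x^(\<delta> s) with index M + s; a large M separates them from the variables of
  other polynomials.
\<close>

definition twisted_trace_poly :: "nat \<Rightarrow> ('g \<Rightarrow> 'k::field) \<Rightarrow> (nat \<Rightarrow> 'g) \<Rightarrow> nat \<Rightarrow> ('g, 'k) gr_poly" where
  "twisted_trace_poly N \<chi> \<delta> M = (\<Sum>\<sigma> | \<sigma> permutes {0..<N}. \<Sum>k<N.
     Poly_Mapping.single (FMon (map (\<lambda>s. (\<delta> s, M + s)) (cyclic_word N \<sigma> k))) (signof \<sigma> * \<chi> (\<delta> (2 * \<sigma> k))))"

lemma poly_vars_sum: "poly_vars (\<Sum>x\<in>S. F x) \<subseteq> (\<Union>x\<in>S. poly_vars (F x))"
proof (induction S rule: infinite_finite_induct)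
  case (insert x S)
  have "poly_vars (F x + sum F S) \<subseteq> poly_vars (F x) \<union> poly_vars (sum F S)"
    unfolding poly_vars_def using keys_add[of "F x" "sum F S"] by blast
  then show ?case using insert by auto
qed (auto simp: poly_vars_def)

lemma poly_vars_single: "poly_vars (Poly_Mapping.single w c) \<subseteq> set (letters w)"
  by (auto simp: poly_vars_def split: if_splits)

lemma poly_vars_twisted_trace_poly: "x \<in> poly_vars (twisted_trace_poly N \<chi> \<delta> M) \<Longrightarrow> M \<le> snd x"
proof -
  assume x: "x \<in> poly_vars (twisted_trace_poly N \<chi> \<delta> M)"
  obtain \<sigma> where "x \<in> poly_vars (\<Sum>k<N. Poly_Mapping.single (FMon (map (\<lambda>s. (\<delta> s, M + s)) (cyclic_word N \<sigma> k))) (signof \<sigma> * \<chi> (\<delta> (2 * \<sigma> k))))"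
    using x poly_vars_sum unfolding twisted_trace_poly_def by fast
  then obtain k where "x \<in> poly_vars (Poly_Mapping.single (FMon (map (\<lambda>s. (\<delta> s, M + s)) (cyclic_word N \<sigma> k))) (signof \<sigma> * \<chi> (\<delta> (2 * \<sigma> k))))"
    using poly_vars_sum by fast
  then have "x \<in> set (map (\<lambda>s. (\<delta> s, M + s)) (cyclic_word N \<sigma> k))" using poly_vars_single by fastforce
  then show ?thesis by auto
qed

text \<open>
  The trace of Z times the value is the sum of the alternating traces in which one x_i is replaced by
  Z u x_i v w, because \<chi>(deg x_i) x_i = u x_i v.  By \<open>alt_trace_derivation\<close> it equals the trace of Z times
  the right-hand side, and the trace form is nondegenerate.
\<close>

lemma eval_twisted_trace_poly:
  fixes \<sigma> :: "'g \<times> nat \<Rightarrow> 'k::field mat"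
  assumes s: "\<And>x. \<sigma> x \<in> carrier_mat n n" and u: "u \<in> carrier_mat n n" and v: "v \<in> carrier_mat n n"
    and uv: "\<And>i. i < n * n \<Longrightarrow> u * \<sigma> (\<delta> (2 * i), M + 2 * i) * v = \<chi> (\<delta> (2 * i)) \<cdot>\<^sub>m \<sigma> (\<delta> (2 * i), M + 2 * i)"
  shows "eval_poly (mat_alg n) \<sigma> (twisted_trace_poly (n * n) \<chi> \<delta> M) =
    (mat_trace (v * \<sigma> (\<delta> (2 * (n * n)), M + 2 * (n * n))) * alt_trace n (\<lambda>s. \<sigma> (\<delta> s, M + s))) \<cdot>\<^sub>m u"
proof (rule mat_trace_nondegenerate[OF eval_poly_carrier[of \<sigma>, OF s] smult_carrier_mat[OF u]])
  let ?N = "n * n"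
  define b where "b s = \<sigma> (\<delta> s, M + s)" for s
  have bf: "b = (\<lambda>s. \<sigma> (\<delta> s, M + s))" by (simp add: b_def fun_eq_iff)
  have b: "b s \<in> carrier_mat n n" for s unfolding b_def by (rule s)
  let ?w = "b (2 * ?N)"
  fix Z :: "'k mat" assume Z: "Z \<in> carrier_mat n n"
  let ?X = "\<lambda>\<tau> k. mprod n (map b (cyclic_word ?N \<tau> k))"
  have Xc: "?X \<tau> k \<in> carrier_mat n n" for \<tau> k by (rule mprod_carrier) (use b in auto)
  let ?c = "\<lambda>i. \<chi> (\<delta> (2 * i))"
  let ?h = "\<lambda>\<tau> i. mat_trace (mprod n (map (b(2 * i := Z * u * b (2 * i) * (v * ?w))) (slot_word \<tau> [0..<?N])))"
  have ev: "eval_poly (mat_alg n) \<sigma> (twisted_trace_poly ?N \<chi> \<delta> M) = msum n (\<lambda>\<tau>. msum n (\<lambda>k. (signof \<tau> * ?c (\<tau> k)) \<cdot>\<^sub>m ?X \<tau> k) {..<?N}) {\<tau>. \<tau> permutes {0..<?N}}"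
    unfolding twisted_trace_poly_def eval_poly_sum[of \<sigma>, OF s] eval_poly_single[of \<sigma>, OF s] eval_fmon_mprod
    by (simp add: bf comp_def)
  have "mat_trace (Z * eval_poly (mat_alg n) \<sigma> (twisted_trace_poly ?N \<chi> \<delta> M))
    = (\<Sum>\<tau> | \<tau> permutes {0..<?N}. \<Sum>k<?N. mat_trace (Z * ((signof \<tau> * ?c (\<tau> k)) \<cdot>\<^sub>m ?X \<tau> k)))"
    unfolding ev using Z Xc by (simp add: mult_msum mat_trace_msum)
  also have "\<dots> = (\<Sum>\<tau> | \<tau> permutes {0..<?N}. \<Sum>k<?N. signof \<tau> * ?h \<tau> (\<tau> k))"
  proof (intro sum.cong refl)
    fix \<tau> k assume "\<tau> \<in> {\<tau>. \<tau> permutes {0..<?N}}" "k \<in> {..<?N}"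
    then have \<tau>: "\<tau> permutes {0..<?N}" and k: "k < ?N" by auto
    have tk: "\<tau> k < ?N" using permutes_in_image[OF \<tau>, of k] k by simp
    let ?x = "b (2 * \<tau> k)"
    have cx: "(?c (\<tau> k) \<cdot>\<^sub>m Z) * ?x * ?w = Z * u * ?x * (v * ?w)"
    proof -
      have "Z * u * ?x * (v * ?w) = Z * (u * ?x * v) * ?w"
        using assoc_mult_mat[OF Z u b[of "2 * \<tau> k"]] assoc_mult_mat[OF mult_carrier_square[OF mult_carrier_square[OF Z u] b[of "2 * \<tau> k"]] v b[of "2 * ?N"]]
          assoc_mult_mat[OF Z mult_carrier_square[OF u b[of "2 * \<tau> k"]] v] by simp
      also have "u * ?x * v = ?c (\<tau> k) \<cdot>\<^sub>m ?x" using uv[OF tk] by (simp add: b_def)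
      finally show ?thesis using Z b by (simp add: mult_smult_distrib[of _ n n _ n] mult_smult_assoc_mat[of _ n n _ n])
    qed
    have "mat_trace (Z * ((signof \<tau> * ?c (\<tau> k)) \<cdot>\<^sub>m ?X \<tau> k)) = signof \<tau> * mat_trace ((?c (\<tau> k) \<cdot>\<^sub>m Z) * ?X \<tau> k)"
      using Z Xc[of \<tau> k] by (simp add: mult_smult_distrib[of _ n n _ n] mult_smult_assoc_mat[of _ n n _ n] mat_trace_smult[of _ n] mult.assoc)
    also have "mat_trace ((?c (\<tau> k) \<cdot>\<^sub>m Z) * ?X \<tau> k) = ?h \<tau> (\<tau> k)"
      using trace_cyclic_word[of b n, OF b smult_carrier_mat[OF Z] \<tau> k, of "?c (\<tau> k)"] unfolding cx .
    finally show "mat_trace (Z * ((signof \<tau> * ?c (\<tau> k)) \<cdot>\<^sub>m ?X \<tau> k)) = signof \<tau> * ?h \<tau> (\<tau> k)" .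
  qed
  also have "\<dots> = (\<Sum>\<tau> | \<tau> permutes {0..<?N}. \<Sum>i<?N. signof \<tau> * ?h \<tau> i)"
  proof (rule sum.cong[OF refl])
    fix \<tau> assume "\<tau> \<in> {\<tau>. \<tau> permutes {0..<?N}}"
    then have "\<tau> permutes {..<?N}" by (simp add: atLeast0LessThan)
    from sum.permute[OF this, of "\<lambda>i. signof \<tau> * ?h \<tau> i"]
    show "(\<Sum>k<?N. signof \<tau> * ?h \<tau> (\<tau> k)) = (\<Sum>i<?N. signof \<tau> * ?h \<tau> i)" by (simp add: comp_def)
  qed
  also have "\<dots> = (\<Sum>i<?N. \<Sum>\<tau> | \<tau> permutes {0..<?N}. signof \<tau> * ?h \<tau> i)" by (rule sum.swap)
  also have "\<dots> = (\<Sum>i<?N. alt_trace n (b(2 * i := Z * u * b (2 * i) * (v * ?w))))" by (simp add: alt_trace_def)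
  also have "\<dots> = mat_trace (Z * u) * mat_trace (v * ?w) * alt_trace n b"
    by (rule alt_trace_derivation) (use b Z u v in auto)
  also have "\<dots> = mat_trace (Z * ((mat_trace (v * ?w) * alt_trace n b) \<cdot>\<^sub>m u))"
    using Z u by (simp add: mult_smult_distrib[of _ n n _ n] mat_trace_smult[of _ n])
  finally show "mat_trace (Z * eval_poly (mat_alg n) \<sigma> (twisted_trace_poly ?N \<chi> \<delta> M)) =
    mat_trace (Z * ((mat_trace (v * \<sigma> (\<delta> (2 * ?N), M + 2 * ?N)) * alt_trace n (\<lambda>s. \<sigma> (\<delta> s, M + s))) \<cdot>\<^sub>m u))"
    unfolding b_def .
qed

context graded_matrix begin

lemma exists_homogeneous_slots:
  "\<exists>b \<delta>. (\<forall>s. b s \<in> carrier_mat n n) \<and> (\<forall>s<2 * (n * n). b s \<in> \<Gamma> (\<delta> s)) \<and> alt_trace n b \<noteq> 0"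
proof (rule homogeneous_nonzero_value[where b = "unit_slots n"])
  show "alt_trace n (b(s := msum n c (UNIV :: 'g set))) = (\<Sum>g\<in>UNIV. alt_trace n (b(s := c g)))"
    if "s < 2 * (n * n)" "\<forall>s. b s \<in> carrier_mat n n" "\<forall>g. c g \<in> carrier_mat n n" for s b and c :: "'g \<Rightarrow> 'k mat"
    using alt_trace_slot_additive[of b n c s UNIV] that by blast
  show "\<forall>s. unit_slots n s \<in> carrier_mat n n" by (simp add: unit_slots_def Let_def)
  show "alt_trace n (unit_slots n :: nat \<Rightarrow> 'k mat) \<noteq> 0" using alt_trace_unit_slots[OF n_pos, where 'k = 'k] by simp
qed

lemma exists_homogeneous_dual:
  assumes v: "v \<in> carrier_mat n n" "v \<noteq> 0\<^sub>m n n"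
  shows "\<exists>g. \<exists>w\<in>\<Gamma> g. mat_trace (v * w) \<noteq> 0"
proof -
  have "\<exists>Z\<in>carrier_mat n n. mat_trace (v * Z) \<noteq> 0"
  proof (rule ccontr)
    assume "\<not> ?thesis"
    then have z: "mat_trace (v * Z) = 0" if "Z \<in> carrier_mat n n" for Z using that by blast
    have "v = 0\<^sub>m n n"
    proof (rule mat_trace_nondegenerate[OF v(1) zero_carrier_mat])
      fix Z :: "'k mat" assume Z: "Z \<in> carrier_mat n n"
      have "mat_trace (Z * 0\<^sub>m n n) = 0" using Z by (simp add: mat_trace[of _ n])
      then show "mat_trace (Z * v) = mat_trace (Z * 0\<^sub>m n n)" using z[OF Z] mat_trace_comm[OF v(1) Z] by simp
    qed
    then show False using v by simp
  qed
  then obtain Z where Z: "Z \<in> carrier_mat n n" "mat_trace (v * Z) \<noteq> 0" by blast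
  have c: "component Z g \<in> carrier_mat n n" for g using component(1)[OF Z(1)] carrier by blast
  have "v * Z = msum n (\<lambda>g. v * component Z g) UNIV"
    using mult_msum[OF v(1), of UNIV "component Z"] c component(2)[OF Z(1)] by simp
  then have "mat_trace (v * Z) = (\<Sum>g\<in>UNIV. mat_trace (v * component Z g))"
    using mat_trace_msum[of UNIV "\<lambda>g. v * component Z g" n] v c by simp
  then obtain g where "mat_trace (v * component Z g) \<noteq> 0" using Z(2) by (metis sum.neutral)
  then show ?thesis using component(1)[OF Z(1)] by blast
qed

text \<open>
  The trace form is nondegenerate, so the last slot w can be chosen with tr(v w) \<noteq> 0, and even
  homogeneous; for the other slots homogeneous arguments with a nonzero alternating trace exist.
\<close>

lemma exists_line_polynomial:
  assumes u: "u \<in> carrier_mat n n" and v: "v \<in> carrier_mat n n" "v \<noteq> 0\<^sub>m n n" "u \<noteq> 0\<^sub>m n n"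
    and uv: "\<And>g a. a \<in> \<Gamma> g \<Longrightarrow> u * a * v = \<chi> g \<cdot>\<^sub>m a"
  shows "\<exists>f :: ('g, 'k) gr_poly. (\<forall>x\<in>poly_vars f. M \<le> snd x) \<and>
    (\<forall>\<sigma>. graded_subst \<Gamma> \<sigma> \<longrightarrow> (\<exists>c. eval_poly (mat_alg n) \<sigma> f = c \<cdot>\<^sub>m u)) \<and>
    (\<exists>\<sigma>. graded_subst \<Gamma> \<sigma> \<and> eval_poly (mat_alg n) \<sigma> f \<noteq> 0\<^sub>m n n)"
proof -
  let ?N = "n * n"
  obtain b \<delta> where b: "\<forall>s. b s \<in> carrier_mat n n" "\<forall>s<2 * ?N. b s \<in> \<Gamma> (\<delta> s)" "alt_trace n b \<noteq> 0"
    using exists_homogeneous_slots by blast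
  obtain h w where w: "w \<in> \<Gamma> h" "mat_trace (v * w) \<noteq> 0" using exists_homogeneous_dual[OF v(1,2)] by blast
  define \<epsilon> where "\<epsilon> = \<delta>(2 * ?N := h)"
  define f where "f = twisted_trace_poly ?N \<chi> \<epsilon> M"
  have sc: "\<sigma> x \<in> carrier_mat n n" if "graded_subst \<Gamma> \<sigma>" for \<sigma> x
    using that carrier unfolding graded_subst_def by (cases x) blast
  have val: "eval_poly (mat_alg n) \<sigma> f = (mat_trace (v * \<sigma> (\<epsilon> (2 * ?N), M + 2 * ?N)) * alt_trace n (\<lambda>s. \<sigma> (\<epsilon> s, M + s))) \<cdot>\<^sub>m u"
    if s: "graded_subst \<Gamma> \<sigma>" for \<sigma>
    unfolding f_def
  proof (rule eval_twisted_trace_poly[OF sc[OF s] u v(1)])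
    fix i
    show "u * \<sigma> (\<epsilon> (2 * i), M + 2 * i) * v = \<chi> (\<epsilon> (2 * i)) \<cdot>\<^sub>m \<sigma> (\<epsilon> (2 * i), M + 2 * i)"
      using s uv unfolding graded_subst_def by blast
  qed
  define \<sigma> where "\<sigma> x = (let s = snd x - M in
     if M \<le> snd x \<and> s < 2 * ?N \<and> fst x = \<delta> s then b s
     else if snd x = M + 2 * ?N \<and> fst x = h then w else 0\<^sub>m n n)" for x :: "'g \<times> nat"
  have g: "graded_subst \<Gamma> \<sigma>" unfolding graded_subst_def \<sigma>_def using b w zero by (auto simp: Let_def)
  have s1: "\<sigma> (\<epsilon> s, M + s) = b s" if "s < 2 * ?N" for s using that by (simp add: \<sigma>_def \<epsilon>_def)
  have s2: "\<sigma> (\<epsilon> (2 * ?N), M + 2 * ?N) = w" by (simp add: \<sigma>_def \<epsilon>_def)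
  have "alt_trace n (\<lambda>s. \<sigma> (\<epsilon> s, M + s)) = alt_trace n b"
  proof -
    have m: "map (\<lambda>s. \<sigma> (\<epsilon> s, M + s)) (slot_word \<tau> [0..<?N]) = map b (slot_word \<tau> [0..<?N])"
      if \<tau>: "\<tau> permutes {0..<?N}" for \<tau>
    proof (rule map_cong[OF refl])
      fix s assume "s \<in> set (slot_word \<tau> [0..<?N])"
      then obtain k where k: "k < ?N" "s = 2 * \<tau> k \<or> s = 2 * k + 1" unfolding set_slot_word by auto
      have "\<tau> k < ?N" using permutes_in_image[OF \<tau>, of k] k(1) by simp
      then have "s < 2 * ?N" using k by linarith
      then show "\<sigma> (\<epsilon> s, M + s) = b s" by (rule s1)
    qed
    show ?thesis unfolding alt_trace_def by (intro sum.cong refl) (simp add: m)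
  qed
  then have "eval_poly (mat_alg n) \<sigma> f \<noteq> 0\<^sub>m n n"
    unfolding val[OF g] s2 using smult_zero_iff_mat[OF u] b w v by simp
  moreover have "\<forall>x\<in>poly_vars f. M \<le> snd x" unfolding f_def using poly_vars_twisted_trace_poly by blast
  ultimately show ?thesis using val g by blast
qed

end

lemma finite_poly_vars: "finite (poly_vars f)" by (simp add: poly_vars_def)

lemma eval_poly_cong:
  assumes "\<And>x. x \<in> poly_vars f \<Longrightarrow> \<sigma> x = \<tau> x"
    and s: "\<And>x. \<sigma> x \<in> carrier_mat n n" and t: "\<And>x. \<tau> x \<in> carrier_mat n n"
  shows "eval_poly (mat_alg n) \<sigma> f = eval_poly (mat_alg n) \<tau> f"
  unfolding eval_poly_msum[of \<sigma>, OF s] eval_poly_msum[of \<tau>, OF t]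
proof (rule msum_cong[OF refl])
  fix w assume w: "w \<in> Poly_Mapping.keys f"
  have "map \<sigma> (letters w) = map \<tau> (letters w)" using assms(1) w by (auto simp: poly_vars_def)
  from arg_cong[OF this, of "mprod n"] have "eval_fmon (mat_alg n) \<sigma> w = eval_fmon (mat_alg n) \<tau> w"
    unfolding eval_fmon_mprod[symmetric] by simp
  then show "Poly_Mapping.lookup f w \<cdot>\<^sub>m eval_fmon (mat_alg n) \<sigma> w = Poly_Mapping.lookup f w \<cdot>\<^sub>m eval_fmon (mat_alg n) \<tau> w"
    by simp
qed

section \<open>Failure of primeness\<close>

text \<open>
  Conjugation by u acts on homogeneous elements by the scalars \<chi>, and conjugation by the inverse v by
  the inverse scalars.  Polynomials with values in K u and in K v in disjoint sets of variables have a
  proper central product, but u is not central.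
\<close>

theorem (in graded_matrix) not_primeness:
  assumes u: "u \<in> carrier_mat n n" and v: "v \<in> carrier_mat n n" and uv: "u * v = 1\<^sub>m n"
    and eig: "\<And>g a. a \<in> \<Gamma> g \<Longrightarrow> u * a = \<chi> g \<cdot>\<^sub>m (a * u)" and nz: "\<And>g. \<chi> g \<noteq> 0"
    and nc: "a0 \<in> carrier_mat n n" "u * a0 \<noteq> a0 * u"
  shows "\<not> primeness_property (mat_alg n) \<Gamma>"
proof
  assume prim: "primeness_property (mat_alg n) \<Gamma>"
  have vu: "v * u = 1\<^sub>m n" by (rule mat_mult_left_right_inverse[OF u v uv])
  have n1: "1\<^sub>m n \<noteq> (0\<^sub>m n n :: 'k mat)" using n_pos by (metis index_one_mat(1) index_zero_mat(1) zero_neq_one)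
  have un: "u \<noteq> 0\<^sub>m n n" "v \<noteq> 0\<^sub>m n n" using uv vu n1 u v by auto
  have c1: "u * a * v = \<chi> g \<cdot>\<^sub>m a" if a: "a \<in> \<Gamma> g" for g a
  proof -
    note ac = carrier[OF a]
    have "u * a * v = \<chi> g \<cdot>\<^sub>m (a * (u * v))"
      unfolding eig[OF a] using assoc_mult_mat[OF ac u v] ac u v by (simp add: mult_smult_assoc_mat[of _ n n _ n])
    then show ?thesis using uv ac by simp
  qed
  have c2: "v * a * u = inverse (\<chi> g) \<cdot>\<^sub>m a" if a: "a \<in> \<Gamma> g" for g a
  proof -
    note ac = carrier[OF a]
    have "v * (u * a * v) * u = a"
      using assoc_mult_mat[OF v mult_carrier_square[OF u ac] v] assoc_mult_mat[OF v u ac] assoc_mult_mat[OF ac v u] vu ac by simp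
    then have "v * (\<chi> g \<cdot>\<^sub>m a) * u = a" using c1[OF a] by simp
    then have "\<chi> g \<cdot>\<^sub>m (v * a * u) = a"
      using ac u v by (simp add: mult_smult_assoc_mat[of _ n n _ n] mult_smult_distrib[of _ n n _ n])
    then have "inverse (\<chi> g) \<cdot>\<^sub>m (\<chi> g \<cdot>\<^sub>m (v * a * u)) = inverse (\<chi> g) \<cdot>\<^sub>m a" by simp
    then show ?thesis using nz[of g] by (simp add: smult_smult_mat)
  qed
  have sc: "\<sigma> x \<in> carrier_mat n n" if "graded_subst \<Gamma> \<sigma>" for \<sigma> x
    using that carrier unfolding graded_subst_def by (cases x) blast
  obtain f :: "('g, 'k) gr_poly" and \<sigma> where
    f: "\<And>\<sigma>. graded_subst \<Gamma> \<sigma> \<Longrightarrow> \<exists>c. eval_poly (mat_alg n) \<sigma> f = c \<cdot>\<^sub>m u"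
    and fs: "graded_subst \<Gamma> \<sigma>" "eval_poly (mat_alg n) \<sigma> f \<noteq> 0\<^sub>m n n"
    using exists_line_polynomial[where u = u and v = v and \<chi> = \<chi> and M = 0, OF u v un(2,1) c1] by blast
  obtain M where M: "\<And>x. x \<in> poly_vars f \<Longrightarrow> snd x < M"
    using finite_poly_vars[of f] by (metis finite_imageI finite_nat_set_iff_bounded imageI)
  obtain f' :: "('g, 'k) gr_poly" and \<sigma>' where
    f'M: "\<And>x. x \<in> poly_vars f' \<Longrightarrow> M \<le> snd x"
    and f': "\<And>\<sigma>. graded_subst \<Gamma> \<sigma> \<Longrightarrow> \<exists>c. eval_poly (mat_alg n) \<sigma> f' = c \<cdot>\<^sub>m v"
    and fs': "graded_subst \<Gamma> \<sigma>'" "eval_poly (mat_alg n) \<sigma>' f' \<noteq> 0\<^sub>m n n"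
    using exists_line_polynomial[where u = v and v = u and \<chi> = "\<lambda>g. inverse (\<chi> g)" and M = M, OF v u un c2] by blast
  have dis: "poly_vars f \<inter> poly_vars f' = {}" using M f'M by (meson disjoint_iff leD)
  have prod: "\<exists>c d. eval_poly (mat_alg n) \<tau> (f * f') = (c * d) \<cdot>\<^sub>m 1\<^sub>m n \<and> eval_poly (mat_alg n) \<tau> f = c \<cdot>\<^sub>m u \<and> eval_poly (mat_alg n) \<tau> f' = d \<cdot>\<^sub>m v"
    if t: "graded_subst \<Gamma> \<tau>" for \<tau>
  proof -
    obtain c d where cd: "eval_poly (mat_alg n) \<tau> f = c \<cdot>\<^sub>m u" "eval_poly (mat_alg n) \<tau> f' = d \<cdot>\<^sub>m v" using f[OF t] f'[OF t] by blast
    have "eval_poly (mat_alg n) \<tau> (f * f') = (c \<cdot>\<^sub>m u) * (d \<cdot>\<^sub>m v)" unfolding eval_poly_mult[of \<tau>, OF sc[OF t]] cd ..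
    also have "\<dots> = (c * d) \<cdot>\<^sub>m 1\<^sub>m n"
      using u v uv by (simp add: mult_smult_assoc_mat[of _ n n _ n] mult_smult_distrib[of _ n n _ n] smult_smult_mat mult.commute)
    finally show ?thesis using cd by blast
  qed
  have central: "graded_central (mat_alg n) \<Gamma> (f * f')"
    unfolding graded_central_def
  proof (intro allI impI)
    fix \<tau> assume t: "graded_subst \<Gamma> \<tau>"
    obtain k where k: "eval_poly (mat_alg n) \<tau> (f * f') = k \<cdot>\<^sub>m 1\<^sub>m n" using prod[OF t] by blast
    show "eval_poly (mat_alg n) \<tau> (f * f') \<in> alg_center (mat_alg n)"
      unfolding k alg_center_def module_mat_simps
      by (auto simp: mult_smult_assoc_mat[of _ n n _ n] mult_smult_distrib[of _ n n _ n])
  qed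
  have "\<not> graded_identity (mat_alg n) \<Gamma> (f * f')"
  proof
    assume id: "graded_identity (mat_alg n) \<Gamma> (f * f')"
    define \<tau> where "\<tau> x = (if snd x < M then \<sigma> x else \<sigma>' x)" for x
    have t: "graded_subst \<Gamma> \<tau>" using fs(1) fs'(1) by (auto simp: graded_subst_def \<tau>_def)
    have e1: "eval_poly (mat_alg n) \<tau> f = eval_poly (mat_alg n) \<sigma> f"
      by (rule eval_poly_cong[OF _ sc[OF t] sc[OF fs(1)]]) (use M in \<open>auto simp: \<tau>_def\<close>)
    have e2: "eval_poly (mat_alg n) \<tau> f' = eval_poly (mat_alg n) \<sigma>' f'"
      by (rule eval_poly_cong[OF _ sc[OF t] sc[OF fs'(1)]]) (use f'M in \<open>force simp: \<tau>_def\<close>)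
    obtain c d where cd: "eval_poly (mat_alg n) \<tau> (f * f') = (c * d) \<cdot>\<^sub>m 1\<^sub>m n" "eval_poly (mat_alg n) \<tau> f = c \<cdot>\<^sub>m u" "eval_poly (mat_alg n) \<tau> f' = d \<cdot>\<^sub>m v"
      using prod[OF t] by blast
    have "c \<noteq> 0" using cd(2) e1 fs(2) smult_zero_iff_mat[OF u] by metis
    moreover have "d \<noteq> 0" using cd(3) e2 fs'(2) smult_zero_iff_mat[OF v] by metis
    moreover have "(c * d) \<cdot>\<^sub>m 1\<^sub>m n = (0\<^sub>m n n :: 'k mat) \<longleftrightarrow> c * d = 0 \<or> 1\<^sub>m n = (0\<^sub>m n n :: 'k mat)"
      by (rule smult_zero_iff_mat) simp
    ultimately have "(c * d) \<cdot>\<^sub>m 1\<^sub>m n \<noteq> (0\<^sub>m n n :: 'k mat)" using n1 by simp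
    then show False using id t cd(1) unfolding graded_identity_def module_mat_simps by metis
  qed
  then have "proper_graded_central (mat_alg n) \<Gamma> (f * f')" using central by (simp add: proper_graded_central_def)
  then have "graded_central (mat_alg n) \<Gamma> f" using prim dis unfolding primeness_property_def proper_graded_central_def by blast
  then have "eval_poly (mat_alg n) \<sigma> f \<in> alg_center (mat_alg n)" using fs(1) unfolding graded_central_def by blast
  moreover obtain c where c: "eval_poly (mat_alg n) \<sigma> f = c \<cdot>\<^sub>m u" using f[OF fs(1)] by blast
  ultimately have "(c \<cdot>\<^sub>m u) * a0 = a0 * (c \<cdot>\<^sub>m u)" using nc(1) unfolding alg_center_def module_mat_simps by auto
  then have "c \<cdot>\<^sub>m (u * a0) = c \<cdot>\<^sub>m (a0 * u)" using u nc(1) by (simp add: mult_smult_assoc_mat[of _ n n _ n] mult_smult_distrib[of _ n n _ n])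
  then have "inverse c \<cdot>\<^sub>m (c \<cdot>\<^sub>m (u * a0)) = inverse c \<cdot>\<^sub>m (c \<cdot>\<^sub>m (a0 * u))" by simp
  moreover have "c \<noteq> 0" using c fs(2) smult_zero_iff_mat[OF u] by metis
  ultimately show False using nc(2) by (simp add: smult_smult_mat)
qed

section \<open>Characters of finite abelian groups\<close>

text \<open>
  Adjoin x to Q.  The multiples of x in Q are the multiples of k x for the least such k > 0, so the value
  at x may be any k-th root y of \<chi>(k x), which exists in K.  The element q + j x then has the value
  \<chi>(q) y^j, independent of the representation.
\<close>

lemma extend_character_step:
  fixes Q :: "'g::{ab_group_add,finite} set" and \<chi> :: "'g \<Rightarrow> 'k::alg_closed_field"
  assumes Q: "add_subgroup Q" and hom: "\<And>p q. p \<in> Q \<Longrightarrow> q \<in> Q \<Longrightarrow> \<chi> (p + q) = \<chi> p * \<chi> q"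
    and nz: "\<And>q. q \<in> Q \<Longrightarrow> \<chi> q \<noteq> 0"
  shows "\<exists>Q' \<chi>'. add_subgroup Q' \<and> insert x Q \<subseteq> Q' \<and> (\<forall>p\<in>Q'. \<forall>q\<in>Q'. \<chi>' (p + q) = \<chi>' p * \<chi>' q) \<and>
    (\<forall>q\<in>Q'. \<chi>' q \<noteq> 0) \<and> (\<forall>q\<in>Q. \<chi>' q = \<chi> q)"
proof -
  define m where "m k = (((+) x) ^^ k) 0" for k :: nat
  have m0 [simp]: "m 0 = 0" and mS: "m (Suc k) = x + m k" for k by (simp_all add: m_def)
  have madd: "m (i + j) = m i + m j" for i j by (induction i) (simp_all add: mS add.assoc)
  have Q0: "0 \<in> Q" and Qa: "p \<in> Q \<Longrightarrow> q \<in> Q \<Longrightarrow> p + q \<in> Q" and Qn: "q \<in> Q \<Longrightarrow> - q \<in> Q" for p q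
    using Q by (auto simp: add_subgroup_def)
  have Qd: "p - q \<in> Q" if "p \<in> Q" "q \<in> Q" for p q using Qa[OF that(1) Qn[OF that(2)]] by simp
  have \<chi>0: "\<chi> 0 = 1" using hom[OF Q0 Q0] nz[OF Q0] by simp
  obtain N where N: "N > 0" "m N = 0" using exists_positive_multiple_zero[of x] unfolding m_def by blast
  define k where "k = (LEAST k. 0 < k \<and> m k \<in> Q)"
  have k: "0 < k \<and> m k \<in> Q" unfolding k_def by (rule LeastI[of _ N]) (use N Q0 in auto)
  have kleast: "k \<le> j" if "0 < j" "m j \<in> Q" for j unfolding k_def by (rule Least_le) (use that in auto)
  obtain y where y: "y ^ k = \<chi> (m k)" using nth_root_exists k by blast
  have ynz: "y \<noteq> 0"
  proof
    assume "y = 0"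
    then have "\<chi> (m k) = 0" using y k by (simp add: power_0_left)
    then show False using nz k by blast
  qed
  have pow: "\<chi> (m d) = y ^ d" if "m d \<in> Q" for d
    using that
  proof (induction d rule: less_induct)
    case (less d)
    show ?case
    proof (cases "d = 0")
      case True then show ?thesis by (simp add: \<chi>0)
    next
      case False
      then have kd: "k \<le> d" using kleast less.prems by simp
      then have md: "m d = m (d - k) + m k" by (simp flip: madd)
      have q: "m (d - k) \<in> Q" using Qd[OF less.prems, of "m k"] k md by simp
      have "\<chi> (m (d - k)) = y ^ (d - k)" using less.IH[of "d - k"] False k kd q by simp
      moreover have "y ^ d = y ^ (d - k) * y ^ k" using kd by (simp flip: power_add)
      ultimately show ?thesis using hom[OF q, of "m k"] k y md by simp
    qed
  qed
  have uniq: "\<chi> p * y ^ i = \<chi> q * y ^ j" if pq: "p \<in> Q" "q \<in> Q" and eq: "p + m i = q + m j" for p q i j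
  proof -
    have *: "\<chi> p * y ^ i = \<chi> q * y ^ j" if pq: "p \<in> Q" "q \<in> Q" and eq: "p + m i = q + m j" and ij: "j \<le> i" for p q i j
    proof -
      have mi: "m i = m (i - j) + m j" using ij by (simp flip: madd)
      then have e: "q = p + m (i - j)" using eq by (simp flip: add.assoc)
      then have mq: "m (i - j) \<in> Q" using Qd[OF pq(2,1)] by simp
      have "\<chi> q = \<chi> p * y ^ (i - j)" unfolding e using hom[OF pq(1) mq] pow[OF mq] by simp
      then show ?thesis using ij by (simp add: mult.assoc flip: power_add)
    qed
    show ?thesis
    proof (cases "j \<le> i")
      case True then show ?thesis using *[OF pq eq] by simp
    next
      case False then show ?thesis using *[OF pq(2,1) eq[symmetric]] by simp
    qed
  qed
  define Q' where "Q' = {q + m j | q j. q \<in> Q}"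
  define \<chi>' where "\<chi>' g = (SOME c. \<exists>q\<in>Q. \<exists>j. g = q + m j \<and> c = \<chi> q * y ^ j)" for g
  have val: "\<chi>' (q + m j) = \<chi> q * y ^ j" if q: "q \<in> Q" for q j
    unfolding \<chi>'_def
  proof (rule some_equality)
    show "\<exists>q'\<in>Q. \<exists>j'. q + m j = q' + m j' \<and> \<chi> q * y ^ j = \<chi> q' * y ^ j'" using q by blast
    show "c = \<chi> q * y ^ j" if "\<exists>q'\<in>Q. \<exists>j'. q + m j = q' + m j' \<and> c = \<chi> q' * y ^ j'" for c
      using that uniq q by metis
  qed
  have sum: "(p + m i) + (q + m j) = (p + q) + m (i + j)" for p q i j by (simp add: madd algebra_simps)
  have Q'I: "q + m j \<in> Q'" if "q \<in> Q" for q j unfolding Q'_def using that by blast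
  have Q'E: "\<exists>q\<in>Q. \<exists>j. g = q + m j" if "g \<in> Q'" for g using that unfolding Q'_def by blast
  have mN: "m (t * N) = 0" for t by (induction t) (simp_all add: madd N)
  have "add_subgroup Q'"
    unfolding add_subgroup_def
  proof (intro conjI ballI)
    show "0 \<in> Q'" using Q'I[OF Q0, of 0] by simp
    fix g h assume "g \<in> Q'" "h \<in> Q'"
    then obtain p i q j where pq: "p \<in> Q" "q \<in> Q" "g = p + m i" "h = q + m j" using Q'E by metis
    show "g + h \<in> Q'" unfolding pq(3,4) sum by (rule Q'I[OF Qa[OF pq(1,2)]])
  next
    fix g assume "g \<in> Q'"
    then obtain p i where p: "p \<in> Q" "g = p + m i" using Q'E by metis
    have "i * N = i + i * (N - 1)" using N by (cases N) auto
    then have "m i + m (i * (N - 1)) = 0" using madd[of i "i * (N - 1)"] mN[of i] by simp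
    then have "- m i = m (i * (N - 1))" by (rule minus_unique)
    then have "- g = - p + m (i * (N - 1))" using p by simp
    then show "- g \<in> Q'" using Q'I[OF Qn[OF p(1)]] by simp
  qed
  moreover have "insert x Q \<subseteq> Q'"
  proof
    fix g assume "g \<in> insert x Q"
    then show "g \<in> Q'" using Q'I[OF Q0, of 1] Q'I[of g 0] mS[of 0] by auto
  qed
  moreover have "\<forall>g\<in>Q'. \<forall>h\<in>Q'. \<chi>' (g + h) = \<chi>' g * \<chi>' h"
  proof (intro ballI)
    fix g h assume "g \<in> Q'" "h \<in> Q'"
    then obtain p i q j where pq: "p \<in> Q" "q \<in> Q" "g = p + m i" "h = q + m j" using Q'E by metis
    show "\<chi>' (g + h) = \<chi>' g * \<chi>' h"
      unfolding pq(3,4) sum val[OF Qa[OF pq(1,2)]] val[OF pq(1)] val[OF pq(2)] hom[OF pq(1,2)]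
      by (simp add: power_add mult_ac)
  qed
  moreover have "\<forall>g\<in>Q'. \<chi>' g \<noteq> 0"
  proof
    fix g assume "g \<in> Q'"
    then obtain p i where p: "p \<in> Q" "g = p + m i" using Q'E by metis
    show "\<chi>' g \<noteq> 0" unfolding p(2) val[OF p(1)] using nz[OF p(1)] ynz by simp
  qed
  moreover have "\<forall>q\<in>Q. \<chi>' q = \<chi> q" using val[of _ 0] by simp
  ultimately show ?thesis by blast
qed

lemma extend_character:
  fixes Q :: "'g::{ab_group_add,finite} set" and \<chi> :: "'g \<Rightarrow> 'k::alg_closed_field"
  assumes "add_subgroup Q" and "\<And>p q. p \<in> Q \<Longrightarrow> q \<in> Q \<Longrightarrow> \<chi> (p + q) = \<chi> p * \<chi> q"
    and "\<And>q. q \<in> Q \<Longrightarrow> \<chi> q \<noteq> 0"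
  shows "\<exists>\<chi>'. (\<forall>p q. \<chi>' (p + q) = \<chi>' p * \<chi>' q) \<and> (\<forall>q. \<chi>' q \<noteq> 0) \<and> (\<forall>q\<in>Q. \<chi>' q = \<chi> q)"
  using assms
proof (induction "card (UNIV - Q)" arbitrary: Q \<chi> rule: less_induct)
  case less
  show ?case
  proof (cases "Q = UNIV")
    case True
    then show ?thesis using less.prems by (intro exI[of _ \<chi>]) auto
  next
    case False
    then obtain x where x: "x \<notin> Q" by blast
    obtain Q' \<chi>' where Q': "add_subgroup Q'" "insert x Q \<subseteq> Q'" "\<forall>p\<in>Q'. \<forall>q\<in>Q'. \<chi>' (p + q) = \<chi>' p * \<chi>' q"
      "\<forall>q\<in>Q'. \<chi>' q \<noteq> 0" "\<forall>q\<in>Q. \<chi>' q = \<chi> q"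
      using extend_character_step[OF less.prems, of x] by blast
    have "card (UNIV - Q') < card (UNIV - Q)" by (rule psubset_card_mono) (use Q'(2) x in auto)
    then obtain \<psi> where "\<forall>p q. \<psi> (p + q) = \<psi> p * \<psi> q" "\<forall>q. \<psi> q \<noteq> 0" "\<forall>q\<in>Q'. \<psi> q = \<chi>' q"
      using less.hyps[of Q' \<chi>'] Q' by blast
    then show ?thesis using Q'(2,5) by (intro exI[of _ \<psi>]) auto
  qed
qed

text \<open>
  In the twisted group algebra, \<beta>(s, h) compares X_s X_h with X_h X_s.  Moving X_s past X_h and then past
  X_k multiplies both factors; the three instances of the cocycle identity express this.
\<close>

lemma bichar_additive:
  assumes Q: "add_subgroup Q" and \<alpha>: "two_cocycle Q \<alpha>" and s: "s \<in> Q" "h \<in> Q" "k \<in> Q"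
  shows "bichar \<alpha> s (h + k) = bichar \<alpha> s h * bichar \<alpha> s (k :: 'g::ab_group_add)"
proof -
  have Qa: "p + q \<in> Q" if "p \<in> Q" "q \<in> Q" for p q using Q that by (auto simp: add_subgroup_def)
  have nz: "\<alpha> p q \<noteq> 0" if "p \<in> Q" "q \<in> Q" for p q using \<alpha> that by (auto simp: two_cocycle_def)
  have co: "\<alpha> p q * \<alpha> (p + q) t = \<alpha> q t * \<alpha> p (q + t)" if "p \<in> Q" "q \<in> Q" "t \<in> Q" for p q t
    using \<alpha> that by (auto simp: two_cocycle_def)
  have 1: "\<alpha> s h * \<alpha> (s + h) k = \<alpha> h k * \<alpha> s (h + k)" using co s by blast
  have 2: "\<alpha> h s * \<alpha> (s + h) k = \<alpha> s k * \<alpha> h (s + k)" using co[of h s k] s by (simp add: add.commute)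
  have 3: "\<alpha> h k * \<alpha> (h + k) s = \<alpha> k s * \<alpha> h (s + k)" using co[of h k s] s by (simp add: add.commute)
  note n = nz[OF s(1,2)] nz[OF s(2,1)] nz[OF s(1,3)] nz[OF s(3,1)] nz[OF s(2,3)] nz[OF s(1) Qa[OF s(2,3)]]
    nz[OF Qa[OF s(2,3)] s(1)] nz[OF s(2) Qa[OF s(1,3)]] nz[OF Qa[OF s(1,2)] s(3)]
  have e1: "\<alpha> s (h + k) = \<alpha> s h * \<alpha> (s + h) k / \<alpha> h k" using 1 n by (simp add: field_simps)
  have e3: "\<alpha> (h + k) s = \<alpha> k s * \<alpha> h (s + k) / \<alpha> h k" using 3 n by (simp add: field_simps)
  have e2: "\<alpha> (s + h) k = \<alpha> s k * \<alpha> h (s + k) / \<alpha> h s" using 2 n by (simp add: field_simps)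
  show ?thesis unfolding bichar_def e1 e3 e2 using n by (simp add: field_simps)
qed

section \<open>Matrix algebras with a given decomposition\<close>

text \<open>
  The element X_q \<otimes> A.
\<close>

definition at_degree :: "nat \<Rightarrow> 'g \<Rightarrow> 'k::field mat \<Rightarrow> 'g \<Rightarrow> 'k mat" where
  "at_degree r q A = (\<lambda>p. if p = q then A else 0\<^sub>m r r)"

lemma at_degree_carrier: "q \<in> Q \<Longrightarrow> A \<in> carrier_mat r r \<Longrightarrow> at_degree r q A \<in> carrier (twisted_mat_alg Q \<alpha> r)"
  by (auto simp: twisted_carrier at_degree_def)

lemma at_degree_mult_left:
  assumes Q: "add_subgroup Q" and s: "s \<in> Q" and A: "A \<in> carrier_mat r r"
    and F: "F \<in> carrier (twisted_mat_alg Q \<alpha> r)" and t: "t \<in> Q" and ij: "i < r" "j < r"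
  shows "(at_degree r s A \<otimes>\<^bsub>twisted_mat_alg Q \<alpha> r\<^esub> F) t $$ (i, j) = \<alpha> s (t - s) * (\<Sum>k<r. A $$ (i, k) * F (t - s) $$ (k, j))"
proof -
  have ts: "t - s \<in> Q" using Q s t unfolding add_subgroup_def by (metis add_uminus_conv_diff)
  have "(at_degree r s A \<otimes>\<^bsub>twisted_mat_alg Q \<alpha> r\<^esub> F) t $$ (i, j) =
    (\<Sum>p\<in>Q. if p = s then (\<Sum>q\<in>Q. if q = t - s then \<alpha> s (t - s) * (\<Sum>k<r. A $$ (i, k) * F (t - s) $$ (k, j)) else 0) else 0)"
    unfolding twisted_mult_index[OF at_degree_carrier[OF s A] F ij]
    using ij by (intro sum.cong refl) (auto simp: at_degree_def algebra_simps intro!: sum.cong sum.neutral)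
  then show ?thesis using s ts by simp
qed

lemma at_degree_mult_right:
  assumes Q: "add_subgroup Q" and s: "s \<in> Q" and A: "A \<in> carrier_mat r r"
    and F: "F \<in> carrier (twisted_mat_alg Q \<alpha> r)" and t: "t \<in> Q" and ij: "i < r" "j < r"
  shows "(F \<otimes>\<^bsub>twisted_mat_alg Q \<alpha> r\<^esub> at_degree r s A) t $$ (i, j) = \<alpha> (t - s) s * (\<Sum>k<r. F (t - s) $$ (i, k) * A $$ (k, j))"
proof -
  have ts: "t - s \<in> Q" using Q s t unfolding add_subgroup_def by (metis add_uminus_conv_diff)
  have "(F \<otimes>\<^bsub>twisted_mat_alg Q \<alpha> r\<^esub> at_degree r s A) t $$ (i, j) =
    (\<Sum>p\<in>Q. if p = t - s then (\<Sum>q\<in>Q. if q = s then \<alpha> (t - s) s * (\<Sum>k<r. F (t - s) $$ (i, k) * A $$ (k, j)) else 0) else 0)"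
    unfolding twisted_mult_index[OF F at_degree_carrier[OF s A] ij]
    using ij by (intro sum.cong refl) (auto simp: at_degree_def algebra_simps intro!: sum.cong sum.neutral)
  then show ?thesis using s ts by simp
qed

lemma mult_mat_unit_index:
  assumes "A \<in> carrier_mat n n" "a < n" "b < n" "i < n"
  shows "(A * mat_unit n i j) $$ (a, b) = (if b = j then A $$ (a, i) else (0 :: 'k::field))"
proof -
  have "(A * mat_unit n i j) $$ (a, b) = (\<Sum>k<n. if k = i then (if b = j then A $$ (a, i) else 0) else 0)"
    unfolding mat_mult_index[OF assms(1) mat_unit_carrier assms(2,3)]
    using assms(3) by (intro sum.cong refl) (simp add: mat_unit_index)
  then show ?thesis using assms(4) by simp
qed

lemma central_matrix_scalar:
  assumes z: "z \<in> carrier_mat n n" and n: "0 < n"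
    and c: "\<And>a. a \<in> carrier_mat n n \<Longrightarrow> z * a = a * (z :: 'k::field mat)"
  shows "z = z $$ (0, 0) \<cdot>\<^sub>m 1\<^sub>m n"
proof (rule mat_eqI[OF z])
  fix j b assume jb: "j < n" "b < n"
  have "(z * mat_unit n 0 j) $$ (0, b) = (mat_unit n 0 j * z) $$ (0, b)" using c[OF mat_unit_carrier] by simp
  then have "(if b = j then z $$ (0, 0) else 0) = z $$ (j, b)"
    unfolding mult_mat_unit_index[OF z n jb(2) n] mat_unit_mult_index[OF z n jb(2,1)] by simp
  then show "z $$ (j, b) = (z $$ (0, 0) \<cdot>\<^sub>m 1\<^sub>m n) $$ (j, b)" using jb by auto
qed simp

locale decomposed_matrix = graded_matrix n \<Gamma>
  for n :: nat and \<Gamma> :: "'g::{ab_group_add,finite} \<Rightarrow> 'k::field mat set" +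
  fixes r :: nat and Q :: "'g set" and \<alpha> :: "'g \<Rightarrow> 'g \<Rightarrow> 'k" and gs :: "'g list" and \<phi> :: "'k mat \<Rightarrow> 'g \<Rightarrow> 'k mat"
  assumes r_pos: "1 \<le> r" and Q: "add_subgroup Q" and cocycle: "two_cocycle Q \<alpha>" and len: "length gs = r"
    and iso: "\<phi> \<in> ring_iso (mat_alg n) (twisted_mat_alg Q \<alpha> r)"
    and lin: "\<And>c x. x \<in> carrier_mat n n \<Longrightarrow> \<phi> (c \<cdot>\<^sub>m x) = c \<odot>\<^bsub>twisted_mat_alg Q \<alpha> r\<^esub> \<phi> x"
    and img: "\<And>g. \<phi> ` \<Gamma> g = twisted_mat_grading Q \<alpha> gs g"
begin

abbreviation T where "T \<equiv> twisted_mat_alg Q \<alpha> r"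

lemma Q_closed: "0 \<in> Q" "p \<in> Q \<Longrightarrow> q \<in> Q \<Longrightarrow> p + q \<in> Q" "q \<in> Q \<Longrightarrow> - q \<in> Q" "p \<in> Q \<Longrightarrow> q \<in> Q \<Longrightarrow> p - q \<in> Q"
  using Q unfolding add_subgroup_def by (auto, metis add_uminus_conv_diff)

lemma \<alpha>_nz: "p \<in> Q \<Longrightarrow> q \<in> Q \<Longrightarrow> \<alpha> p q \<noteq> 0"
  using cocycle by (auto simp: two_cocycle_def)

lemma phi_carrier: "a \<in> carrier_mat n n \<Longrightarrow> \<phi> a \<in> Congruence.carrier T"
  and phi_mult: "a \<in> carrier_mat n n \<Longrightarrow> b \<in> carrier_mat n n \<Longrightarrow> \<phi> (a * b) = \<phi> a \<otimes>\<^bsub>T\<^esub> \<phi> b"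
  and phi_add: "a \<in> carrier_mat n n \<Longrightarrow> b \<in> carrier_mat n n \<Longrightarrow> \<phi> (a + b) = \<phi> a \<oplus>\<^bsub>T\<^esub> \<phi> b"
  and phi_one: "\<phi> (1\<^sub>m n) = \<one>\<^bsub>T\<^esub>"
proof -
  have "\<phi> \<in> Ring.ring_hom (mat_alg n) T" using iso by (simp add: ring_iso_def)
  note h = ring_hom_memE[OF this, unfolded module_mat_simps]
  show "a \<in> carrier_mat n n \<Longrightarrow> \<phi> a \<in> Congruence.carrier T"
    "a \<in> carrier_mat n n \<Longrightarrow> b \<in> carrier_mat n n \<Longrightarrow> \<phi> (a * b) = \<phi> a \<otimes>\<^bsub>T\<^esub> \<phi> b"
    "a \<in> carrier_mat n n \<Longrightarrow> b \<in> carrier_mat n n \<Longrightarrow> \<phi> (a + b) = \<phi> a \<oplus>\<^bsub>T\<^esub> \<phi> b"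
    "\<phi> (1\<^sub>m n) = \<one>\<^bsub>T\<^esub>" using h by blast+
qed

lemma phi_inj: "a \<in> carrier_mat n n \<Longrightarrow> b \<in> carrier_mat n n \<Longrightarrow> \<phi> a = \<phi> b \<Longrightarrow> a = b"
  and phi_surj: "F \<in> Congruence.carrier T \<Longrightarrow> \<exists>a\<in>carrier_mat n n. \<phi> a = F"
proof -
  have "bij_betw \<phi> (carrier_mat n n) (Congruence.carrier T)" using iso by (simp add: ring_iso_def module_mat_simps)
  then show "a \<in> carrier_mat n n \<Longrightarrow> b \<in> carrier_mat n n \<Longrightarrow> \<phi> a = \<phi> b \<Longrightarrow> a = b"
    "F \<in> Congruence.carrier T \<Longrightarrow> \<exists>a\<in>carrier_mat n n. \<phi> a = F"
    by (auto simp: bij_betw_def inj_on_def) (metis imageE)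
qed

lemma phi_degree: "a \<in> \<Gamma> g \<Longrightarrow> h \<in> Q \<Longrightarrow> i < r \<Longrightarrow> j < r \<Longrightarrow> \<phi> a h $$ (i, j) \<noteq> 0 \<Longrightarrow> g = - (gs ! j) + h + gs ! i"
  using img[of g] len unfolding twisted_mat_grading_eq by blast

lemma T_one: "\<one>\<^bsub>T\<^esub> = at_degree r 0 (inverse (\<alpha> 0 0) \<cdot>\<^sub>m 1\<^sub>m r)"
  by (auto simp: twisted_simps at_degree_def basis_fun_def zero_smult_mat[OF one_carrier_mat])

text \<open>
  The element U = X_s \<otimes> diag(\<chi>(g_i)) satisfies U F = \<chi>(g) F U for F = X_h \<otimes> e_ij of degree g: the left side
  has the factor \<alpha>(s, h) \<chi>(g_i), the right side \<alpha>(h, s) \<chi>(g_j), and \<chi>(g) = \<beta>(s, h) \<chi>(g_i) / \<chi>(g_j).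
  It does not commute with X_t \<otimes> 1.
\<close>

lemma not_primeness_if_nontrivial:
  assumes s: "s \<in> Q" and t: "t \<in> Q" and st: "bichar \<alpha> s t \<noteq> 1"
    and \<chi>: "\<And>g h. \<chi> (g + h) = \<chi> g * \<chi> h" "\<And>g. \<chi> g \<noteq> 0" "\<And>q. q \<in> Q \<Longrightarrow> \<chi> q = bichar \<alpha> s q"
  shows "\<not> primeness_property (mat_alg n) \<Gamma>"
proof -
  define A where "A = mat r r (\<lambda>(i, j). if i = j then \<chi> (gs ! i) else 0)"
  \<comment> \<open>The inverse of U is X_{-s} times B; the scalar compensates for the cocycle not being normalised.\<close>
  define B where "B = inverse (\<alpha> s (- s) * \<alpha> 0 0) \<cdot>\<^sub>m mat r r (\<lambda>(i, j). if i = j then inverse (\<chi> (gs ! i)) else 0)"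
  have A: "A \<in> carrier_mat r r" and B: "B \<in> carrier_mat r r" by (simp_all add: A_def B_def)
  have Al: "(\<Sum>k<r. A $$ (i, k) * f k) = \<chi> (gs ! i) * f i" if "i < r" for i f
  proof -
    have "(\<Sum>k<r. A $$ (i, k) * f k) = (\<Sum>k<r. if k = i then \<chi> (gs ! i) * f i else 0)"
      using that by (intro sum.cong refl) (auto simp: A_def)
    then show ?thesis using that by simp
  qed
  have Ar: "(\<Sum>k<r. f k * A $$ (k, j)) = f j * \<chi> (gs ! j)" if "j < r" for j f
  proof -
    have "(\<Sum>k<r. f k * A $$ (k, j)) = (\<Sum>k<r. if k = j then f j * \<chi> (gs ! j) else 0)"
      using that by (intro sum.cong refl) (auto simp: A_def)
    then show ?thesis using that by simp
  qed
  let ?U = "at_degree r s A" and ?V = "at_degree r (- s) B" and ?E = "at_degree r t (1\<^sub>m r)"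
  have U: "?U \<in> Congruence.carrier T" by (rule at_degree_carrier[OF s A])
  have V: "?V \<in> Congruence.carrier T" by (rule at_degree_carrier[OF Q_closed(3)[OF s] B])
  have E: "?E \<in> Congruence.carrier T" by (rule at_degree_carrier[OF t one_carrier_mat])
  obtain u v a0 where u: "u \<in> carrier_mat n n" "\<phi> u = ?U" and v: "v \<in> carrier_mat n n" "\<phi> v = ?V"
    and a0: "a0 \<in> carrier_mat n n" "\<phi> a0 = ?E" using phi_surj[OF U] phi_surj[OF V] phi_surj[OF E] by blast
  interpret TM: Module.module class_ring T by (rule twisted_module)
  show ?thesis
  proof (rule not_primeness[OF u(1) v(1) _ _ \<chi>(2) a0(1)])
    have "?U \<otimes>\<^bsub>T\<^esub> ?V = \<one>\<^bsub>T\<^esub>"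
      unfolding T_one
    proof (rule twisted_eqI[OF twisted_mult_carrier[OF Q U V] at_degree_carrier[OF Q_closed(1)]])
      fix q i j assume x: "q \<in> Q" "i < r" "j < r"
      show "(?U \<otimes>\<^bsub>T\<^esub> ?V) q $$ (i, j) = at_degree r 0 (inverse (\<alpha> 0 0) \<cdot>\<^sub>m 1\<^sub>m r) q $$ (i, j)"
        unfolding at_degree_mult_left[OF Q s A V x] Al[OF x(2)]
        using x \<alpha>_nz[OF s Q_closed(3)[OF s]] \<alpha>_nz[OF Q_closed(1) Q_closed(1)] \<chi>(2)
        by (auto simp: at_degree_def B_def field_simps)
    qed simp
    then have "\<phi> (u * v) = \<phi> (1\<^sub>m n)" using phi_mult u v phi_one by simp
    then show "u * v = 1\<^sub>m n" using phi_inj u v by simp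
    fix g a assume a: "a \<in> \<Gamma> g"
    note ac = carrier[OF a]
    have "?U \<otimes>\<^bsub>T\<^esub> \<phi> a = \<chi> g \<odot>\<^bsub>T\<^esub> (\<phi> a \<otimes>\<^bsub>T\<^esub> ?U)"
    proof (rule twisted_eqI[OF twisted_mult_carrier[OF Q U phi_carrier[OF ac]]])
      have aU: "\<phi> a \<otimes>\<^bsub>T\<^esub> ?U \<in> Congruence.carrier T" by (rule twisted_mult_carrier[OF Q phi_carrier[OF ac] U])
      show "\<chi> g \<odot>\<^bsub>T\<^esub> (\<phi> a \<otimes>\<^bsub>T\<^esub> ?U) \<in> Congruence.carrier T"
        by (rule TM.smult_closed[OF _ aU]) simp
      fix q i j assume x: "q \<in> Q" "i < r" "j < r"
      let ?h = "q - s"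
      have h: "?h \<in> Q" using Q_closed(4) x s by blast
      have "(?U \<otimes>\<^bsub>T\<^esub> \<phi> a) q $$ (i, j) = \<alpha> s ?h * (\<chi> (gs ! i) * \<phi> a ?h $$ (i, j))"
        unfolding at_degree_mult_left[OF Q s A phi_carrier[OF ac] x] Al[OF x(2)] ..
      also have "\<dots> = \<chi> g * (\<alpha> ?h s * (\<phi> a ?h $$ (i, j) * \<chi> (gs ! j)))"
      proof (cases "\<phi> a ?h $$ (i, j) = 0")
        case False
        then have "g = - (gs ! j) + ?h + gs ! i" using phi_degree[OF a h x(2,3)] by simp
        then have "g + gs ! j = ?h + gs ! i" by (simp add: algebra_simps)
        then have g: "\<chi> g * \<chi> (gs ! j) = bichar \<alpha> s ?h * \<chi> (gs ! i)" using \<chi>(1,3) h by metis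
        have "bichar \<alpha> s ?h * \<alpha> ?h s = \<alpha> s ?h" using \<alpha>_nz[OF h s] by (simp add: bichar_def)
        then have "\<alpha> s ?h * (\<chi> (gs ! i) * \<phi> a ?h $$ (i, j))
          = (bichar \<alpha> s ?h * \<chi> (gs ! i)) * (\<alpha> ?h s * \<phi> a ?h $$ (i, j))"
          by (simp only: mult_ac flip: \<open>bichar \<alpha> s ?h * \<alpha> ?h s = \<alpha> s ?h\<close>)
        then show ?thesis unfolding g[symmetric] by (simp only: mult_ac)
      qed simp
      also have "\<dots> = \<chi> g * (\<phi> a \<otimes>\<^bsub>T\<^esub> ?U) q $$ (i, j)"
        unfolding at_degree_mult_right[OF Q s A phi_carrier[OF ac] x] Ar[OF x(3)] ..
      also have "\<dots> = (\<chi> g \<odot>\<^bsub>T\<^esub> (\<phi> a \<otimes>\<^bsub>T\<^esub> ?U)) q $$ (i, j)"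
        unfolding twisted_simps using smult_index[OF twisted_carrierD[OF aU] x(2,3)] by simp
      finally show "(?U \<otimes>\<^bsub>T\<^esub> \<phi> a) q $$ (i, j) = (\<chi> g \<odot>\<^bsub>T\<^esub> (\<phi> a \<otimes>\<^bsub>T\<^esub> ?U)) q $$ (i, j)" .
    qed
    then have "\<phi> (u * a) = \<phi> (\<chi> g \<cdot>\<^sub>m (a * u))" using phi_mult lin u ac by simp
    then show "u * a = \<chi> g \<cdot>\<^sub>m (a * u)" using phi_inj u ac by simp
  next
    show "u * a0 \<noteq> a0 * u"
    proof
      assume "u * a0 = a0 * u"
      then have "?U \<otimes>\<^bsub>T\<^esub> ?E = ?E \<otimes>\<^bsub>T\<^esub> ?U" using phi_mult u a0 by metis
      then have eq: "(?U \<otimes>\<^bsub>T\<^esub> ?E) (s + t) $$ (0, 0) = (?E \<otimes>\<^bsub>T\<^esub> ?U) (s + t) $$ (0, 0)" by simp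
      have x: "s + t \<in> Q" "0 < r" using Q_closed s t r_pos by auto
      have "\<alpha> s t * \<chi> (gs ! 0) = \<alpha> t s * \<chi> (gs ! 0)"
        using eq x(2) unfolding at_degree_mult_left[OF Q s A E x(1) x(2) x(2)] at_degree_mult_right[OF Q s A E x(1) x(2) x(2)] Al[OF x(2)] Ar[OF x(2)]
        by (simp add: at_degree_def)
      then have "\<alpha> s t = \<alpha> t s" using \<chi>(2) by simp
      then show False using st \<alpha>_nz[OF t s] by (simp add: bichar_def)
    qed
  qed
qed

text \<open>
  For trivial bicharacter X_q \<otimes> 1 is central, hence a multiple of the unit.  The unit has
  degree 0, whereas X_q \<otimes> 1 has degree q.
\<close>

lemma trivial_support:
  assumes triv: "trivial_bichar Q \<alpha>" shows "Q = {0}"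
proof -
  have "q = 0" if q: "q \<in> Q" for q
  proof (rule ccontr)
    assume q0: "q \<noteq> 0"
    let ?Z = "at_degree r q (1\<^sub>m r :: 'k mat)"
    have Z: "?Z \<in> Congruence.carrier T" by (rule at_degree_carrier[OF q one_carrier_mat])
    have com: "?Z \<otimes>\<^bsub>T\<^esub> F = F \<otimes>\<^bsub>T\<^esub> ?Z" if F: "F \<in> Congruence.carrier T" for F
    proof (rule twisted_eqI[OF twisted_mult_carrier[OF Q Z F] twisted_mult_carrier[OF Q F Z]])
      fix t i j assume x: "t \<in> Q" "i < r" "j < r"
      have sym: "\<alpha> q (t - q) = \<alpha> (t - q) q"
      proof -
        have h: "t - q \<in> Q" using Q_closed(4) x q by blast
        have "bichar \<alpha> q (t - q) = 1" using triv q h by (auto simp: trivial_bichar_def)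
        then show ?thesis using \<alpha>_nz[OF h q] by (simp add: bichar_def field_simps)
      qed
      have l: "(\<Sum>k<r. 1\<^sub>m r $$ (i, k) * f k) = f i" for f :: "nat \<Rightarrow> 'k"
      proof -
        have "(\<Sum>k<r. 1\<^sub>m r $$ (i, k) * f k) = (\<Sum>k<r. if k = i then f i else 0)"
          using x by (intro sum.cong refl) auto
        then show ?thesis using x by simp
      qed
      have l': "(\<Sum>k<r. f k * 1\<^sub>m r $$ (k, j)) = f j" for f :: "nat \<Rightarrow> 'k"
      proof -
        have "(\<Sum>k<r. f k * 1\<^sub>m r $$ (k, j)) = (\<Sum>k<r. if k = j then f j else 0)"
          using x by (intro sum.cong refl) auto
        then show ?thesis using x by simp
      qed
      show "(?Z \<otimes>\<^bsub>T\<^esub> F) t $$ (i, j) = (F \<otimes>\<^bsub>T\<^esub> ?Z) t $$ (i, j)"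
        unfolding at_degree_mult_left[OF Q q one_carrier_mat F x] at_degree_mult_right[OF Q q one_carrier_mat F x] l l' sym ..
    qed
    obtain z where z: "z \<in> carrier_mat n n" "\<phi> z = ?Z" using phi_surj[OF Z] by blast
    have "z * a = a * z" if a: "a \<in> carrier_mat n n" for a
    proof -
      have "\<phi> (z * a) = \<phi> (a * z)" using phi_mult[OF z(1) a] phi_mult[OF a z(1)] com[OF phi_carrier[OF a]] z(2) by simp
      then show ?thesis using phi_inj z(1) a by simp
    qed
    from central_matrix_scalar[OF z(1) n_pos this] have "\<phi> z = \<phi> (z $$ (0, 0) \<cdot>\<^sub>m 1\<^sub>m n)" by simp
    then have "?Z = z $$ (0, 0) \<odot>\<^bsub>T\<^esub> \<one>\<^bsub>T\<^esub>" using lin phi_one z by simp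
    then have "?Z q $$ (0, 0) = (z $$ (0, 0) \<odot>\<^bsub>T\<^esub> \<one>\<^bsub>T\<^esub>) q $$ (0, 0)" by simp
    then show False using q0 r_pos by (simp add: T_one twisted_simps(3) at_degree_def)
  qed
  then show ?thesis using Q_closed(1) by blast
qed

text \<open>
  With Q = {0}, an element is its value F 0, and the product of F and H has the value
  \<alpha>(0, 0) (F 0) (H 0); multiplication by \<alpha>(0, 0) makes the evaluation at 0 multiplicative.
\<close>

lemma trivial_isomorphic:
  assumes Q0: "Q = {0}"
  shows "graded_isomorphic (mat_alg n) \<Gamma> (mat_alg r) (\<lambda>g. elementary_grading gs (- g))"
  unfolding graded_isomorphic_def
proof (intro bexI conjI allI ballI)
  let ?k = "\<alpha> 0 0"
  have k: "?k \<noteq> 0" using \<alpha>_nz Q_closed by blast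
  define \<psi> where "\<psi> a = ?k \<cdot>\<^sub>m \<phi> a 0" for a
  have pc: "\<phi> a 0 \<in> carrier_mat r r" if "a \<in> carrier_mat n n" for a using twisted_carrierD[OF phi_carrier[OF that]] .
  have ext: "F = H" if "F \<in> Congruence.carrier T" "H \<in> Congruence.carrier T" "F 0 = H 0" for F H
    using twisted_eqI[OF that(1,2)] that(3) Q0 by simp
  have m: "(F \<otimes>\<^bsub>T\<^esub> H) 0 = ?k \<cdot>\<^sub>m (F 0 * H 0)" if F: "F \<in> Congruence.carrier T" and H: "H \<in> Congruence.carrier T" for F H
  proof (rule mat_eqI[of _ r r])
    note c = twisted_carrierD[OF F, of 0] twisted_carrierD[OF H, of 0]
    show "(F \<otimes>\<^bsub>T\<^esub> H) 0 \<in> carrier_mat r r" using twisted_carrierD[OF twisted_mult_carrier[OF Q F H]] .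
    show "?k \<cdot>\<^sub>m (F 0 * H 0) \<in> carrier_mat r r" using c by auto
    fix i j assume ij: "i < r" "j < r"
    show "(F \<otimes>\<^bsub>T\<^esub> H) 0 $$ (i, j) = (?k \<cdot>\<^sub>m (F 0 * H 0)) $$ (i, j)"
      unfolding twisted_mult_index[OF F H ij] smult_index[OF mult_carrier_square[OF c] ij] mat_mult_index[OF c ij] by (simp add: Q0)
  qed
  have inv: "inverse ?k \<cdot>\<^sub>m (?k \<cdot>\<^sub>m X) = X" for X using k by (simp add: smult_smult_mat)
  have inv': "?k \<cdot>\<^sub>m (inverse ?k \<cdot>\<^sub>m X) = X" for X using k by (simp add: smult_smult_mat)
  show "\<psi> \<in> ring_iso (mat_alg n) (mat_alg r)"
    unfolding ring_iso_def
  proof (intro CollectI conjI)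
    show "\<psi> \<in> Ring.ring_hom (mat_alg n) (mat_alg r)"
    proof (rule ring_hom_memI, unfold module_mat_simps)
      fix a b :: "'k mat" assume ab: "a \<in> carrier_mat n n" "b \<in> carrier_mat n n"
      show "\<psi> a \<in> carrier_mat r r" using pc[OF ab(1)] by (simp add: \<psi>_def)
      show "\<psi> (a * b) = \<psi> a * \<psi> b"
        unfolding \<psi>_def phi_mult[OF ab] m[OF phi_carrier[OF ab(1)] phi_carrier[OF ab(2)]]
        using pc[OF ab(1)] pc[OF ab(2)] by (simp add: mult_smult_assoc_mat[of _ r r _ r] mult_smult_distrib[of _ r r _ r])
      show "\<psi> (a + b) = \<psi> a + \<psi> b"
        unfolding \<psi>_def phi_add[OF ab] twisted_simps using add_smult_distrib_left_mat[OF pc[OF ab(1)] pc[OF ab(2)]] .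
    next
      show "\<psi> (1\<^sub>m n) = 1\<^sub>m r" unfolding \<psi>_def phi_one T_one by (simp add: at_degree_def inv')
    qed
    show "bij_betw \<psi> (Congruence.carrier (mat_alg n)) (Congruence.carrier (mat_alg r))"
      unfolding module_mat_simps
    proof (rule bij_betwI')
      fix a b :: "'k mat" assume ab: "a \<in> carrier_mat n n" "b \<in> carrier_mat n n"
      show "\<psi> a = \<psi> b \<longleftrightarrow> a = b"
      proof
        assume "\<psi> a = \<psi> b"
        then have "\<phi> a 0 = \<phi> b 0" unfolding \<psi>_def using inv by metis
        then show "a = b" using phi_inj[OF ab ext[OF phi_carrier[OF ab(1)] phi_carrier[OF ab(2)]]] by simp
      qed simp
    next
      fix a :: "'k mat" assume "a \<in> carrier_mat n n"
      then show "\<psi> a \<in> carrier_mat r r" using pc by (simp add: \<psi>_def)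
    next
      fix Y :: "'k mat" assume Y: "Y \<in> carrier_mat r r"
      have "at_degree r 0 (inverse ?k \<cdot>\<^sub>m Y) \<in> Congruence.carrier T" by (rule at_degree_carrier[OF Q_closed(1) smult_carrier_mat[OF Y]])
      then obtain a where "a \<in> carrier_mat n n" "\<phi> a = at_degree r 0 (inverse ?k \<cdot>\<^sub>m Y)" using phi_surj by blast
      then show "\<exists>a\<in>carrier_mat n n. Y = \<psi> a" by (intro bexI[of _ a]) (simp_all add: \<psi>_def at_degree_def inv')
    qed
  qed
  show "\<psi> (c \<odot>\<^bsub>mat_alg n\<^esub> x) = c \<odot>\<^bsub>mat_alg r\<^esub> \<psi> x" if "x \<in> Congruence.carrier (mat_alg n)"
    for c and x :: "'k mat"
    using that by (simp add: module_mat_simps \<psi>_def lin twisted_simps smult_smult_mat mult.commute)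
  show "\<psi> ` \<Gamma> g = elementary_grading gs (- g)" for g
  proof -
    have deg: "gs ! j - gs ! i = - g \<longleftrightarrow> g = - (gs ! j) + 0 + gs ! i" for i j
      by (auto simp: algebra_simps)
    have "\<psi> ` \<Gamma> g = (\<lambda>F. ?k \<cdot>\<^sub>m F 0) ` (\<phi> ` \<Gamma> g)" by (auto simp: \<psi>_def)
    also have "\<dots> = elementary_grading gs (- g)"
    proof (intro equalityI subsetI)
      fix Y assume "Y \<in> (\<lambda>F. ?k \<cdot>\<^sub>m F 0) ` (\<phi> ` \<Gamma> g)"
      then obtain F where F: "F \<in> Congruence.carrier T" "Y = ?k \<cdot>\<^sub>m F 0"
        "\<And>i j. i < r \<Longrightarrow> j < r \<Longrightarrow> F 0 $$ (i, j) \<noteq> 0 \<Longrightarrow> g = - (gs ! j) + 0 + gs ! i"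
        unfolding img twisted_mat_grading_eq len Q0 by blast
      note Fc = twisted_carrierD[OF F(1), of 0]
      have "gs ! j - gs ! i = - g" if "i < r" "j < r" "Y $$ (i, j) \<noteq> 0" for i j
        using F(3)[OF that(1,2)] that(3) unfolding F(2) smult_index[OF Fc that(1,2)] deg by auto
      moreover have "Y \<in> carrier_mat r r" using Fc F(2) by simp
      ultimately show "Y \<in> elementary_grading gs (- g)" unfolding elementary_grading_eq len by blast
    next
      fix Y :: "'k mat" assume "Y \<in> elementary_grading gs (- g)"
      then have Y: "Y \<in> carrier_mat r r" "\<And>i j. i < r \<Longrightarrow> j < r \<Longrightarrow> Y $$ (i, j) \<noteq> 0 \<Longrightarrow> gs ! j - gs ! i = - g"
        unfolding elementary_grading_eq len by blast+
      let ?F = "at_degree r 0 (inverse ?k \<cdot>\<^sub>m Y)"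
      have Fc: "?F \<in> Congruence.carrier T" by (rule at_degree_carrier[OF Q_closed(1) smult_carrier_mat[OF Y(1)]])
      have "g = - (gs ! j) + h + gs ! i" if "h \<in> Q" "i < r" "j < r" "?F h $$ (i, j) \<noteq> 0" for h i j
        using that Y(2)[OF that(2,3)] Q0 smult_index[OF Y(1) that(2,3)] unfolding deg by (simp add: at_degree_def)
      then have "?F \<in> \<phi> ` \<Gamma> g" using Fc unfolding img twisted_mat_grading_eq len by blast
      moreover have "?k \<cdot>\<^sub>m ?F 0 = Y" by (simp add: at_degree_def inv')
      ultimately show "Y \<in> (\<lambda>F. ?k \<cdot>\<^sub>m F 0) ` (\<phi> ` \<Gamma> g)" by (metis (no_types, lifting) imageI)
    qed
    finally show ?thesis .
  qed
qed

end

theorem theorem20: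
  fixes \<Gamma> :: "'g::{ab_group_add,finite} \<Rightarrow> 'k::{alg_closed_field,field_char_0} mat set"
    and n :: nat
  assumes "0 < n"
    and "algebra_grading (mat_alg n) \<Gamma>"
  shows "(\<exists>r Q \<alpha> gs. is_decomposition n \<Gamma> r Q \<alpha> gs) \<and>
    (\<forall>r Q \<alpha> gs. is_decomposition n \<Gamma> r Q \<alpha> gs \<longrightarrow>
      (\<not> trivial_bichar Q \<alpha> \<longrightarrow>
         primeness_property (mat_alg n) \<Gamma> \<longrightarrow> is_elementary n \<Gamma>) \<and>
      (trivial_bichar Q \<alpha> \<longrightarrow>
         (primeness_property (mat_alg n) \<Gamma> \<longleftrightarrow>
          primeness_property (mat_alg r :: ('k, 'k mat) module) (elementary_grading gs))))"
proof (intro conjI allI impI)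
  interpret G: graded_matrix_ac n \<Gamma> by unfold_locales fact+
  show "\<exists>r Q \<alpha> gs. is_decomposition n \<Gamma> r Q \<alpha> gs" by (rule G.exists_decomposition)
  fix r Q \<alpha> gs assume dec: "is_decomposition n \<Gamma> r Q \<alpha> gs"
  obtain \<phi> where "\<phi> \<in> ring_iso (mat_alg n) (twisted_mat_alg Q \<alpha> r)"
    "\<And>c x. x \<in> carrier_mat n n \<Longrightarrow> \<phi> (c \<cdot>\<^sub>m x) = c \<odot>\<^bsub>twisted_mat_alg Q \<alpha> r\<^esub> \<phi> x"
    "\<And>g. \<phi> ` \<Gamma> g = twisted_mat_grading Q \<alpha> gs g"
    using dec unfolding is_decomposition_def graded_isomorphic_def module_mat_simps by blast
  then interpret D: decomposed_matrix n \<Gamma> r Q \<alpha> gs \<phi>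
    using dec by unfold_locales (auto simp: is_decomposition_def)
  show "is_elementary n \<Gamma>" if "\<not> trivial_bichar Q \<alpha>" "primeness_property (mat_alg n) \<Gamma>"
  proof -
    obtain s t where st: "s \<in> Q" "t \<in> Q" "bichar \<alpha> s t \<noteq> 1" using \<open>\<not> trivial_bichar Q \<alpha>\<close> by (auto simp: trivial_bichar_def)
    have "bichar \<alpha> s q \<noteq> 0" if "q \<in> Q" for q using D.\<alpha>_nz st(1) that by (simp add: bichar_def)
    then obtain \<chi> where "\<forall>p q. \<chi> (p + q) = \<chi> p * \<chi> q" "\<forall>q. \<chi> q \<noteq> 0" "\<forall>q\<in>Q. \<chi> q = bichar \<alpha> s q"
      using extend_character[OF D.Q, of "bichar \<alpha> s"] bichar_additive[OF D.Q D.cocycle st(1)] by blast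
    then have "\<not> primeness_property (mat_alg n) \<Gamma>" using D.not_primeness_if_nontrivial[OF st, of \<chi>] by blast
    then show ?thesis using that by blast
  qed
  show "primeness_property (mat_alg n) \<Gamma> \<longleftrightarrow> primeness_property (mat_alg r :: ('k, 'k mat) module) (elementary_grading gs)"
    if triv: "trivial_bichar Q \<alpha>"
  proof -
    have c: "elementary_grading gs g \<subseteq> (carrier_mat r r :: 'k mat set)" for g
      unfolding elementary_grading_eq D.len by blast
    have "primeness_property (mat_alg n) \<Gamma> \<longleftrightarrow> primeness_property (mat_alg r :: ('k, 'k mat) module) (\<lambda>g. elementary_grading gs (- g))"
      by (rule primeness_graded_isomorphic[OF D.trivial_isomorphic[OF D.trivial_support[OF triv]]]) (use G.carrier in blast)
    also have "\<dots> \<longleftrightarrow> primeness_property (mat_alg r :: ('k, 'k mat) module) (elementary_grading gs)"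
      using primeness_neg_degree[OF c] primeness_neg_degree[of "\<lambda>g. elementary_grading gs (- g)" r, OF c] by auto
    finally show ?thesis .
  qed
qed

end
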